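(* Let $X$ be a random variable with values in $[0,1)$ having a density (bounded or not). The minimum depth $M_n$ of a scaled attachment random recursive tree with attachment $X$ satisfies \[ \frac{M_n}{\log n}\to\alpha_{\min}\quad\text{in probability as } n\to\infty . \]
   Context: Scaled attachment random recursive tree (SARRT) with attachment $X$: let $X_0,X_1,X_2,\dots$ be i.i.d. random variables distributed as $X\in[0,1)$. The nodes are labeled $0,1,2,\dots$ (the tree of order $n$ uses nodes $0,\dots,n$); the root is $0$ and the parent of node $i\ge1$ is the node labeled $\lfloor iX_i\rfloor$. Set $L(i,0)=i$ and $L(i,j+1)=\lfloor L(i,j)X_{L(i,j)}\rfloor$. The depth of node $i$ is $D_i=\min\{j\ge0:L(i,j)=0\}$, and the minimum depth is $M_n=\min_{n/2\le i\le n}D_i$. Let $\mu=\mathbf{E}\{-\log X\}\in(0,+\infty]$, with $1/\mu=0$ when $\mu=+\infty$. Let $\Lambda(\lambda)=\log\mathbf{E}\{X^\lambda\}\in(-\infty,+\infty]$ for $\lambda\in\mathbb R$, $\Lambda^*(z)=\sup_{\lambda\in\mathbb R}\{\lambda z-\Lambda(\lambda)\}$, $\Psi(c)=c\,\Lambda^*(-1/c)$ for $c>0$, and \[ \alpha_{\min}=\sup\Big(\{0\}\cup\left\{c:\ 0<c<\tfrac1\mu\ \text{ and }\ \Psi(c)>1\right\}\Big) \] (so $\alpha_{\min}=0$ if no $c\in(0,1/\mu)$ satisfies $\Psi(c)>1$, in particular if $\mu=+\infty$). *)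

theory Defs
  imports "HOL-Probability.Probability"
begin

text \<open>
  The tree, as a deterministic function of a realization \<open>x\<close> of the attachment
  sequence. For \<open>x l\<close> in \<open>[0, 1)\<close> one has \<open>\<lfloor>l * x l\<rfloor> < l\<close> whenever \<open>l > 0\<close>, so the
  \<open>LEAST\<close> below is attained, and the root is a fixed point of the parent map.
\<close>

definition sarrt_parent :: "(nat \<Rightarrow> real) \<Rightarrow> nat \<Rightarrow> nat" where
  "sarrt_parent x i = nat \<lfloor>real i * x i\<rfloor>"

primrec sarrt_ancestor :: "(nat \<Rightarrow> real) \<Rightarrow> nat \<Rightarrow> nat \<Rightarrow> nat" where
  "sarrt_ancestor x i 0 = i"
| "sarrt_ancestor x i (Suc j) = sarrt_parent x (sarrt_ancestor x i j)"

definition sarrt_depth :: "(nat \<Rightarrow> real) \<Rightarrow> nat \<Rightarrow> nat" where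
  "sarrt_depth x i = (LEAST j. sarrt_ancestor x i j = 0)"

definition sarrt_min_depth :: "(nat \<Rightarrow> real) \<Rightarrow> nat \<Rightarrow> nat" where
  "sarrt_min_depth x n = Min (sarrt_depth x ` {i. real n / 2 \<le> real i \<and> i \<le> n})"

text \<open>
  The constants attached to the law of \<open>X\<close>. Where \<open>X\<close> vanishes, \<open>ln\<close> and \<open>powr\<close> are
  \<open>0\<close> instead of the usual extended values; this is immaterial when \<open>X\<close> has a
  density, since then \<open>X\<close> is almost surely nonzero. For \<open>X\<close> with values in \<open>[0, 1)\<close>
  the integrand \<open>- ln X\<close> is nonnegative, so \<open>ennreal\<close> truncates nothing.
\<close>

definition neg_log_mean :: "'a measure \<Rightarrow> ('a \<Rightarrow> real) \<Rightarrow> ennreal" where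
  "neg_log_mean M X = (\<integral>\<^sup>+ \<omega>. ennreal (- ln (X \<omega>)) \<partial>M)"

definition power_moment :: "'a measure \<Rightarrow> ('a \<Rightarrow> real) \<Rightarrow> real \<Rightarrow> ennreal" where
  "power_moment M X l = (\<integral>\<^sup>+ \<omega>. ennreal (X \<omega> powr l) \<partial>M)"

definition log_moment :: "'a measure \<Rightarrow> ('a \<Rightarrow> real) \<Rightarrow> real \<Rightarrow> ereal" where
  "log_moment M X l =
     (if power_moment M X l = \<infinity> then \<infinity>
      else if power_moment M X l = 0 then - \<infinity>
      else ereal (ln (enn2real (power_moment M X l))))"

definition log_moment_conj :: "'a measure \<Rightarrow> ('a \<Rightarrow> real) \<Rightarrow> real \<Rightarrow> ereal" where
  "log_moment_conj M X z = (SUP l. ereal (l * z) - log_moment M X l)"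

definition rate_Psi :: "'a measure \<Rightarrow> ('a \<Rightarrow> real) \<Rightarrow> real \<Rightarrow> ereal" where
  "rate_Psi M X c = ereal c * log_moment_conj M X (- 1 / c)"

text \<open>
  In \<open>ennreal\<close>, \<open>1 / \<infinity> = 0\<close>. As \<open>X < 1\<close>, the mean of \<open>- ln X\<close> is positive, so the
  set below is bounded and its supremum in the reals is the intended one.
\<close>

definition alpha_min :: "'a measure \<Rightarrow> ('a \<Rightarrow> real) \<Rightarrow> real" where
  "alpha_min M X =
     Sup ({0} \<union> {c. 0 < c \<and> ennreal c < 1 / neg_log_mean M X \<and> rate_Psi M X c > 1})"

text \<open>
  Convergence in probability to a constant. Measurability is part of the notion, as
  \<open>measure\<close> is \<open>0\<close> on nonmeasurable sets.
\<close>

definition tendsto_in_prob :: "'a measure \<Rightarrow> (nat \<Rightarrow> 'a \<Rightarrow> real) \<Rightarrow> real \<Rightarrow> bool" where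
  "tendsto_in_prob M Y a \<longleftrightarrow>
     (\<forall>n. Y n \<in> borel_measurable M) \<and>
     (\<forall>\<epsilon>>0. (\<lambda>n. measure M {\<omega> \<in> space M. \<bar>Y n \<omega> - a\<bar> > \<epsilon>}) \<longlonglongrightarrow> 0)"

end

theory Submission
  imports Defs "HOL-Real_Asymp.Real_Asymp"
begin

text \<open>
  \<^emph>\<open>Lower bound.\<close> For \<open>c < \<alpha>\<^sub>m\<^sub>i\<^sub>n\<close> some negative power of \<open>X\<close> has a moment for which the Chernoff
  bound makes the probability that a given node near \<open>n\<close> has depth at most \<open>c ln n\<close> of smaller order
  than \<open>1 / n\<close>. The rounding in the parent map is harmless as long as the ancestors have large
  labels, where it costs a factor close to 1 per generation.

  \<^emph>\<open>Upper bound.\<close> For \<open>c > \<alpha>\<^sub>m\<^sub>i\<^sub>n\<close> a truncated and exponentially tilted law of \<open>X\<close> shows that,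
  for a suitable number \<open>K\<close> of generations and some \<open>b > K / c\<close>, every node \<open>v\<close> with large
  label is expected to have many \<open>K\<close>-th generation descendants with labels around \<open>v e\<^sup>b\<close>. This is
  where the density enters: \<open>v / X\<close> is asymptotically equidistributed modulo 1, so a node \<open>v\<close> is
  expected to have \<open>E (1 / X)\<close> children in spite of the rounding. The number of children of a
  random set of nodes deviates from its conditional expectation by a martingale in the label, so its
  variance is at most linear in the size of the set. Hence a set of \<open>N\<close> nodes of depth at most \<open>d\<close>
  with labels in a window \<open>[m, m \<rho>)\<close> gives, outside an event of probability \<open>O(1 / N)\<close>, at least \<open>2 N\<close>
  nodes of depth at most \<open>d + K\<close> in the window multiplied by \<open>e\<^sup>b\<close>. Starting from all nodes of a
  window with a large constant \<open>m\<close>, the failure probabilities form a geometric series, and about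
  \<open>ln n / b\<close> blocks reach the labels of order \<open>n\<close>. A bounded number of further generations moves some of the
  nodes into \<open>[n / 2, n]\<close>.
\<close>

section \<open>Equidistribution of the parent labels\<close>

text \<open>Powers of the label are asymptotic eigenfunctions: an attachment \<open>x\<close> gives
  \<open>v\<close> about \<open>1 / x\<close> children with labels near \<open>v / x\<close>, so the
  weight \<open>i powr (- t)\<close>, summed over the expected children of \<open>v\<close>, is
  about \<open>v powr (- t)\<close> times the moment of order \<open>t - 1\<close>. With
  \<open>l = t - 1\<close>, the expected number of \<open>K\<close>-th generation descendants near
  \<open>v * exp (K * z)\<close> has exponential rate \<open>z + inf (l * z + \<Lambda> l)\<close>
  over \<open>l\<close>, which is \<open>z - \<Lambda>* (- z)\<close>; it is positive exactly when
  \<open>\<Psi> (1 / z) < 1\<close>. Truncating the attachments to \<open>{1 / B..<1}\<close> makes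
  all moments finite and bounds the expected number of children by \<open>2 * B\<close>; in return
  the constant, defined by full moments, has to be reached along growing \<open>B\<close>. Two
  further obstacles shape the upper bound. Labels spread out during a block, so a window has to be
  found that a block carries into its own translate. The last window must have ratio 2, and a law
  concentrated near one value does not bring labels there by itself; this calls for steering between
  two separate ranges of attachments.\<close>

definition hit :: "nat \<Rightarrow> nat \<Rightarrow> real set" where
  "hit i v = {x. nat \<lfloor>real i * x\<rfloor> = v}"

text \<open>The number of children of \<open>v\<close> if all attachments were equal to \<open>x \<in> {1 / B..<1}\<close>.\<close>

definition hits :: "nat \<Rightarrow> nat \<Rightarrow> real \<Rightarrow> real" where
  "hits B v x = (\<Sum>i<(v + 1) * B. indicator (hit i v) x)"

lemma hit_iff: "0 \<le> x \<Longrightarrow> x \<in> hit i v \<longleftrightarrow> real v \<le> real i * x \<and> real i * x < real v + 1"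
  unfolding hit_def by (auto simp: nat_eq_iff floor_eq_iff nat_floor_neg)

lemma hit_measurable [measurable]: "hit i v \<in> sets borel"
  unfolding hit_def by measurable

lemma hits_measurable [measurable]: "hits B v \<in> borel_measurable borel"
  unfolding hits_def by measurable

text \<open>Telescoping of \<open>ln (1 + 1 / n) \<le> 1 / n\<close>. With \<open>q + 1\<close> in
  the numerator the bound covers an empty sum as well, the logarithm then being nonpositive.\<close>

lemma harmonic_segment_ge:
  assumes "1 \<le> p" shows "ln ((real q + 1) / real p) \<le> (\<Sum>i=p..q. 1 / real i)"

proof (induction q)
  case 0
  then show ?case using assms by (auto simp: ln_div)
next
  case (Suc q)
  show ?case
  proof (cases "p \<le> Suc q")
    case True
    have "ln ((real (Suc q) + 1) / real p) = ln ((real q + 1) / real p) + ln (1 + 1 / real (Suc q))"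
    proof -
      have "(real (Suc q) + 1) / real p = (real q + 1) / real p * (1 + 1 / real (Suc q))"
        using assms by (simp add: divide_simps)
      then show ?thesis using assms by (subst (asm) eq_commute) (simp add: ln_mult_pos[symmetric] add_pos_pos)
    qed
    also have "\<dots> \<le> (\<Sum>i=p..q. 1 / real i) + 1 / real (Suc q)"
      using Suc ln_add_one_self_le_self[of "1 / real (Suc q)"] by auto
    finally show ?thesis using True by simp
  next
    case False
    then have "ln ((real (Suc q) + 1) / real p) \<le> 0" using assms by (subst ln_le_zero_iff) auto
    then show ?thesis using False by simp
  qed
qed

lemma harmonic_segment_le:
  assumes "1 \<le> p" "p \<le> q" shows "(\<Sum>i=p..q. 1 / real i) \<le> 1 / real p + ln (real q / real p)"
  using assms(2)
proof (induction q rule: dec_induct)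
  case base
  then show ?case using assms by simp
next
  case (step q)
  have "1 / real (Suc q) \<le> ln (real (Suc q) / real q)"
    using ln_add_one_self_le_self2[of "- 1 / real (Suc q)"] step assms
    by (auto simp: ln_div field_simps)
  also have "\<dots> = ln (real (Suc q)/ real p) - ln (real q / real p)"
    using step assms by (simp add: ln_div)
  finally show ?case using step by simp
qed

lemma card_nat_interval_le:
  assumes "0 \<le> l" shows "real (card {i::nat. a \<le> real i \<and> real i < a + l}) \<le> l + 1"
proof -
  have "{i::nat. a \<le> real i \<and> real i < a + l} = {nat \<lceil>a\<rceil>..<nat \<lceil>a + l\<rceil>}"
    by (auto simp: nat_le_iff zless_nat_eq_int_zless ceiling_le_iff less_ceiling_iff)
  then show ?thesis using assms
    by (simp add: of_nat_diff_if) linarith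
qed

section \<open>Bounds and averages of the number of children at a fixed attachment\<close>

lemma hits_card:
  "hits B v x = real (card {i. i < (v+1)*B \<and> x \<in> hit i v})"
  unfolding hits_def
  by (simp add: indicator_def sum.If_cases Collect_conj_eq lessThan_def)

lemma hits_nonneg: "0 \<le> hits B v x" unfolding hits_card by simp

text \<open>The labels \<open>i\<close> with \<open>x \<in> hit i v\<close> are integers in an
  interval of length \<open>1 / x\<close>.\<close>

lemma hits_le:
  assumes "0 < x" shows "hits B v x \<le> 1 / x + 1"
proof -
  have "card {i. i < (v+1)*B \<and> x \<in> hit i v} \<le> card {i::nat. v / x \<le> real i \<and> real i < v / x + 1 / x}"
  proof (rule card_mono)
    have "{i::nat. v / x \<le> real i \<and> real i < v / x + 1 / x} \<subseteq> {..nat \<lceil>v / x + 1 / x\<rceil>}"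
      by (auto simp: ) linarith
    then show "finite {i::nat. v / x \<le> real i \<and> real i < v / x + 1 / x}"
      using finite_subset by blast
    show "{i. i < (v+1)*B \<and> x \<in> hit i v} \<subseteq> {i::nat. v / x \<le> real i \<and> real i < v / x + 1 / x}"
      using assms by (auto simp: hit_iff field_simps)
  qed
  also have "real \<dots> \<le> 1 / x + 1" using card_nat_interval_le[of "1/x" "v/x"] assms by simp
  finally show ?thesis unfolding hits_card by simp
qed

lemma hits_le_const:
  assumes "1 / real B \<le> x" "0 < B" shows "hits B v x \<le> 2 * real B"
proof -
  have "0 < x" using assms by (smt (verit) divide_pos_pos of_nat_0_less_iff)
  moreover have "1 / x \<le> B" using assms \<open>0 < x\<close> by (simp add: field_simps)
  moreover have "1 \<le> real B" using assms by simp
  ultimately show ?thesis using hits_le[of x B v] by linarith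
qed

text \<open>The candidate labels fill an interval of length \<open>1 / x \<ge> 1\<close>, which
  contains an integer. Rounding thus never leaves a node without a possible child; this crude bound
  serves where any positive growth factor will do.\<close>

lemma hits_ge_1:
  assumes "1 / real B \<le> x" "0 < B" "x \<le> 1" shows "1 \<le> hits B v x"
proof -
  have x: "0 < x" using assms by (smt (verit) divide_pos_pos of_nat_0_less_iff)
  define i where "i = nat \<lceil>v / x\<rceil>"
  have "0 \<le> v / x" using x by simp
  then have i: "v / x \<le> i" "i < v / x + 1" unfolding i_def by linarith+
  have h: "x \<in> hit i v"
    using i x assms by (auto simp: hit_iff field_simps)
  have "real i < v / x + 1 / x" using i x assms by (smt (verit) divide_le_eq_1 le_divide_eq_1)
  also have "\<dots> = (v + 1) * (1 / x)" by (simp add: add_divide_distrib)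
  also have "\<dots> \<le> real (v + 1) * real B"
    using assms x by (intro mult_left_mono) (auto simp: field_simps)
  finally have "i < (v+1) * B" by (metis of_nat_less_iff of_nat_mult)
  with h have "{i} \<subseteq> {i. i < (v+1)*B \<and> x \<in> hit i v}" by auto
  then have "card {i} \<le> card {i. i < (v+1)*B \<and> x \<in> hit i v}" by (intro card_mono) auto
  then show ?thesis unfolding hits_card by simp
qed

text \<open>For \<open>i > 0\<close> the set \<open>hit i v\<close> meets the positive reals in an
  interval from \<open>v / i\<close> to \<open>(v + 1) / i\<close>, of length \<open>1 / i\<close>.
  Summing over the \<open>i\<close> between about \<open>v / b\<close> and \<open>v / a\<close>
  gives a harmonic segment, hence \<open>ln b - ln a\<close>, the integral of \<open>1 / x\<close>;
  the intervals cut by an endpoint contribute a vanishing amount.\<close>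

lemma hits_interval:
  assumes "0 < B" "1 / real B \<le> a" "a < b" "b \<le> 1"
  shows "(\<lambda>v. \<integral>x. indicator {a..b} x * hits B v x \<partial>lborel) \<longlonglongrightarrow> ln b - ln a"
proof (rule tendsto_sandwich)
  have a: "0 < a" using assms by (smt (verit) divide_pos_pos of_nat_0_less_iff)
  have fin: "emeasure lborel (hit i v \<inter> {a..b}) < \<infinity>" for i v
  proof -
    have "emeasure lborel (hit i v \<inter> {a..b}) \<le> emeasure lborel {a..b}" by (rule emeasure_mono) auto
    also have "\<dots> < \<infinity>" using a assms by (simp add: emeasure_lborel_Icc_eq) 
    finally show ?thesis .
  qed
  have int: "(\<integral>x. indicator {a..b} x * hits B v x \<partial>lborel)
      = (\<Sum>i<(v+1)*B. measure lborel (hit i v \<inter> {a..b}))" for v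
  proof -
    have "(\<integral>x. indicator {a..b} x * hits B v x \<partial>lborel)
       = (\<integral>x. (\<Sum>i<(v+1)*B. indicator (hit i v \<inter> {a..b}) x) \<partial>lborel)"
      unfolding hits_def sum_distrib_left
      by (intro Bochner_Integration.integral_cong refl sum.cong) (auto simp: indicator_def)
    also have "\<dots> = (\<Sum>i<(v+1)*B. measure lborel (hit i v \<inter> {a..b}))"
      using fin by (subst Bochner_Integration.integral_sum) auto
    finally show ?thesis .
  qed
  show "\<forall>\<^sub>F v in sequentially. (\<integral>x. indicator {a..b} x * hits B v x \<partial>lborel)
     \<le> b / real v + (ln ((real v + 1) / a) - ln (real v / b))"
  proof (rule eventually_sequentiallyI[of 1])
    fix v :: nat assume v: "1 \<le> v"
    \<comment> \<open>Upper bound: every \<open>i\<close> whose interval meets \<open>{a..b}\<close>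
      lies in \<open>{p..q}\<close>.\<close>
    define p q where "p = nat \<lceil>v / b\<rceil>" and "q = nat \<lfloor>(real v + 1) / a\<rfloor>"
    have b: "0 < b" using a assms by simp
    have vb: "1 \<le> v / b" using v b assms by (simp add: field_simps)
    have le: "v / b \<le> v / a" using a assms b by (intro divide_left_mono) auto
    have "v / a + 1 \<le> (real v + 1) / a" using a assms by (simp add: field_simps)
    then have pq: "1 \<le> p" "p \<le> q" "v / b \<le> p" "q \<le> (real v + 1) / a"
      unfolding p_def q_def using vb le by linarith+
    have "(\<Sum>i<(v+1)*B. measure lborel (hit i v \<inter> {a..b})) \<le> (\<Sum>i<(v+1)*B. if i \<in> {p..q} then 1 / real i else 0)"
    proof (rule sum_mono)
      fix i
      have 1: "hit i v \<inter> {a..b} = {}" if "i \<notin> {p..q}"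
      proof (rule ccontr)
        assume "hit i v \<inter> {a..b} \<noteq> {}"
        then obtain x where x: "x \<in> hit i v" "a \<le> x" "x \<le> b" by auto
        then have h: "real v \<le> real i * x" "real i * x < real v + 1" using a by (auto simp: hit_iff)
        have "real v \<le> i * b" using h(1) x mult_left_mono[of x b "real i"] by linarith
        then have "v / b \<le> i" using b by (simp add: field_simps)
        moreover have "i * a \<le> v + 1" using h(2) x mult_left_mono[of a x "real i"] by linarith
        then have "i \<le> (real v + 1) / a" using a by (simp add: field_simps)
        ultimately have "p \<le> i" "i \<le> q" unfolding p_def q_def by (simp_all add: le_nat_floor)
        then show False using that by simp
      qed
      have 2: "measure lborel (hit i v \<inter> {a..b}) \<le> 1 / real i" if "i \<in> {p..q}"
      proof -
        have i: "0 < i" using that pq by simp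
        have "hit i v \<inter> {a..b} \<subseteq> {v / i .. (real v + 1) / i}"
        proof
          fix x assume "x \<in> hit i v \<inter> {a..b}"
          then have "v \<le> i * x" "i * x < real v + 1" using a by (auto simp: hit_iff)
          then show "x \<in> {v / i .. (real v + 1) / i}"
            using i by (simp add: divide_le_eq le_divide_eq mult.commute)
        qed
        then have "measure lborel (hit i v \<inter> {a..b}) \<le> measure lborel {v / i .. (real v + 1) / i}"
          by (intro measure_mono_fmeasurable) (auto simp: fmeasurable_def emeasure_lborel_Icc_eq)
        also have "\<dots> = 1 / i" using i by (simp add: field_simps)
        finally show ?thesis .
      qed
      show "measure lborel (hit i v \<inter> {a..b}) \<le> (if i \<in> {p..q} then 1 / real i else 0)"
        using 1 2 by auto
    qed
    also have "\<dots> \<le> (\<Sum>i=p..q. 1 / real i)"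
      by (subst sum.inter_restrict[symmetric]) (auto intro!: sum_mono2)
    also have "\<dots> \<le> 1 / real p + ln (real q / real p)" using pq by (intro harmonic_segment_le)
    also have "\<dots> \<le> b / real v + (ln ((real v + 1) / a) - ln (real v / b))"
    proof -
      have "ln (real q / real p) = ln q - ln p" using pq by (simp add: ln_div)
      moreover have "ln q \<le> ln ((real v + 1) / a)" using pq by simp
      moreover have "ln (v / b) \<le> ln p" using pq vb by simp
      moreover have "1 / real p \<le> b / v" using pq(3) b v \<open>1 \<le> p\<close>
        by (simp add: divide_le_eq le_divide_eq mult.commute)
      ultimately show ?thesis by linarith
    qed
    finally show "(\<integral>x. indicator {a..b} x * hits B v x \<partial>lborel)
     \<le> b / real v + (ln ((real v + 1) / a) - ln (real v / b))" unfolding int by simp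
  qed
  show "\<forall>\<^sub>F v in sequentially. ln (real v / a) - ln ((real v + 1) / b + 1) \<le> (\<integral>x. indicator {a..b} x * hits B v x \<partial>lborel)"
  proof (rule eventually_sequentiallyI[of 1])
    fix v :: nat assume v: "1 \<le> v"
    \<comment> \<open>Lower bound: the range is narrowed so that for \<open>i\<close> in
      \<open>{p..q}\<close> the whole interval lies in \<open>{a..b}\<close>.\<close>
    define p q where "p = nat \<lceil>(real v + 1) / b\<rceil>" and "q = nat \<lfloor>real v / a\<rfloor>"
    have b: "0 < b" using a assms by simp
    have vb: "1 \<le> (real v + 1) / b" using v b assms by (simp add: field_simps)
    have "0 \<le> v / a" using a by simp
    then have pq: "1 \<le> p" "p \<le> (real v + 1) / b + 1" "(real v + 1) / b \<le> p" "v / a \<le> real q + 1" "q \<le> v / a"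
      unfolding p_def q_def using vb by linarith+
    \<comment> \<open>\<open>1 / B \<le> a\<close> keeps these labels below the cut-off in
      \<open>hits\<close>.\<close>
    have q: "q < (v+1) * B"
    proof -
      have "v / a = v * (1 / a)" by simp
      also have "\<dots> \<le> real v * real B" using a assms by (intro mult_left_mono) (auto simp: field_simps)
      also have "\<dots> < (v+1)*B" using assms by simp
      finally show ?thesis using pq(5) by (smt (verit) of_nat_less_iff of_nat_mult)
    qed
    have "ln (real v / a) - ln ((real v + 1) / b + 1) \<le> ln (real q + 1) - ln p"
      using pq a v by (intro diff_mono) (auto simp: )
    also have "\<dots> = ln ((real q + 1) / p)" using pq by (simp add: ln_div)
    also have "\<dots> \<le> (\<Sum>i=p..q. 1 / real i)" using pq by (intro harmonic_segment_ge)
    also have "\<dots> \<le> (\<Sum>i\<in>{p..q}. measure lborel (hit i v \<inter> {a..b}))"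
    proof (rule sum_mono)
      fix i assume i: "i \<in> {p..q}"
      have i0: "0 < i" using i pq by simp
      have "(real v + 1) / b \<le> i" using pq(3) i by (smt (verit) atLeastAtMost_iff of_nat_mono)
      then have 1: "real v + 1 \<le> i * b" using b by (simp add: field_simps)
      have 2: "i * a \<le> v"
      proof -
        have "i \<le> v / a" using i pq(5) by (smt (verit) atLeastAtMost_iff of_nat_mono)
        then show ?thesis using a by (simp add: field_simps)
      qed
      have "1 / i = measure lborel {v / i ..< (real v + 1) / i}"
        using i0 by (simp add: field_simps)
      also have "\<dots> \<le> measure lborel (hit i v \<inter> {a..b})"
      proof (rule measure_mono_fmeasurable)
        show "{real v / real i..<(real v + 1) / real i} \<subseteq> hit i v \<inter> {a..b}"
        proof
          fix x assume x: "x \<in> {real v / real i..<(real v + 1) / real i}"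
          then have 3: "v \<le> i * x" "i * x < v + 1" using i0 by (auto simp: field_simps)
          have "i * a \<le> i * x" "i * x \<le> i * b" using 1 2 3 by linarith+
          then have "a \<le> x" "x \<le> b" using i0 by auto
          then show "x \<in> hit i v \<inter> {a..b}" using 3 a by (auto simp: hit_iff)
        qed
        show "hit i v \<inter> {a..b} \<in> fmeasurable lborel" using fin by (auto simp: fmeasurable_def)
      qed auto
      finally show "1 / real i \<le> measure lborel (hit i v \<inter> {a..b})" .
    qed
    also have "\<dots> \<le> (\<Sum>i<(v+1)*B. measure lborel (hit i v \<inter> {a..b}))"
      using q by (intro sum_mono2) auto
    finally show "ln (real v / a) - ln ((real v + 1) / b + 1) \<le> (\<integral>x. indicator {a..b} x * hits B v x \<partial>lborel)"
      unfolding int .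
  qed
  have b: "0 < b" using a assms by simp
  show "(\<lambda>v. ln (real v / a) - ln ((real v + 1) / b + 1)) \<longlonglongrightarrow> ln b - ln a"
  proof -
    have "(\<lambda>v. ln (real v / a) - ln ((real v + 1) / b + 1)) \<longlonglongrightarrow> ln (inverse a) - ln (inverse b)"
      using a b by real_asymp
    then show ?thesis using a b by (simp add: ln_inverse)
  qed
  show "(\<lambda>v. b / real v + (ln ((real v + 1) / a) - ln (real v / b))) \<longlonglongrightarrow> ln b - ln a"
  proof -
    have "(\<lambda>v. b / real v + (ln ((real v + 1) / a) - ln (real v / b))) \<longlonglongrightarrow> ln (inverse a) - ln (inverse b)"
      using a b by real_asymp
    then show ?thesis using a b by (simp add: ln_inverse)
  qed
qed


text \<open>Dynkin argument starting from half-lines, which the cell cuts down to intervals. The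
  bound \<open>2 * B\<close> on \<open>hits\<close> over the cell is uniform in \<open>v\<close> and
  carries the limit through countable disjoint unions.\<close>

lemma hits_borel_set:
  assumes B: "0 < B" and A: "A \<in> sets borel"
  defines "I \<equiv> {1 / real B..1}"
  shows "(\<lambda>v. \<integral>x. indicator (A \<inter> I) x * hits B v x \<partial>lborel)
    \<longlonglongrightarrow> (\<integral>x. indicator (A \<inter> I) x * (1 / x) \<partial>lborel)"
proof -
  define J where "J v A = (\<integral>x. indicator (A \<inter> I) x * hits B v x \<partial>lborel)" for v A
  define J' where "J' A = (\<integral>x. indicator (A \<inter> I) x * (1 / x) \<partial>lborel)" for A
  define P where "P A \<longleftrightarrow> (\<lambda>v. J v A) \<longlonglongrightarrow> J' A" for A
  have B1: "1 / real B \<le> 1" using B by simp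
  have pos: "0 < x" if "x \<in> I" for x
    using that B unfolding I_def by (smt (verit) atLeastAtMost_iff divide_pos_pos of_nat_0_less_iff)
  have le: "1 / x \<le> 2 * B" if "x \<in> I" for x
    using that B pos[OF that] unfolding I_def by (auto simp: field_simps)
  have finI: "emeasure lborel (A \<inter> I) < \<infinity>" if "A \<in> sets borel" for A
  proof -
    have "emeasure lborel (A \<inter> I) \<le> emeasure lborel I"
      using that by (intro emeasure_mono) (auto simp: I_def)
    also have "\<dots> < \<infinity>" using B1 by (simp add: I_def emeasure_lborel_Icc_eq)
    finally show ?thesis .
  qed
  have [measurable]: "I \<in> sets borel" by (simp add: I_def)
  have intd: "integrable lborel (\<lambda>x. indicator (A \<inter> I) x * g x)"
    if [measurable]: "A \<in> sets borel" "g \<in> borel_measurable borel"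
      and g: "\<And>x. x \<in> I \<Longrightarrow> \<bar>g x\<bar> \<le> 2 * real B" for A and g :: "real \<Rightarrow> real"
  proof (rule Bochner_Integration.integrable_bound[where f = "\<lambda>x. indicator (A \<inter> I) x * (2 * real B)"])
    show "integrable lborel (\<lambda>x. indicator (A \<inter> I) x * (2 * real B))"
      using finI[OF that(1)] by (intro integrable_mult_left integrable_real_indicator) auto
    show "AE x in lborel. norm (indicator (A \<inter> I) x * g x) \<le> norm (indicator (A \<inter> I) x * (2 * real B))"
      using g by (auto simp: indicator_def)
  qed measurable
  have h: "\<bar>hits B v x\<bar> \<le> 2 * real B" if "x \<in> I" for v x
    using that hits_le_const[of B x v] B hits_nonneg[of B v x] unfolding I_def by auto
  have h': "\<bar>1 / x\<bar> \<le> 2 * real B" if "x \<in> I" for x using le[OF that] pos[OF that] by simp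
  have half: "P {..t}" for t
  proof -
    define u where "u = min t 1"
    have "{..t} \<inter> I = {..u} \<inter> I" by (auto simp: I_def u_def)
    then have P_eq: "P {..t} = P {..u}" by (simp add: P_def J_def J'_def)
    consider "u \<le> 1 / B" | "1 / B < u" "u \<le> 1" by (fastforce simp: u_def)
    then show ?thesis
    proof cases
      case 1
      have null: "AE x in lborel. x \<notin> {..u} \<inter> I"
        using AE_lborel_singleton[of "1 / real B"] by eventually_elim (use 1 in \<open>auto simp: I_def\<close>)
      have "J v {..u} = 0" for v unfolding J_def
        by (rule integral_eq_zero_AE) (use null in eventually_elim, auto)
      moreover have "J' {..u} = 0" unfolding J'_def
        by (rule integral_eq_zero_AE) (use null in eventually_elim, auto)
      ultimately show ?thesis unfolding P_eq by (simp add: P_def)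
    next
      case 2
      have inv: "(\<integral>x. indicator {1 / real B..u} x * (1 / x) \<partial>lborel) = ln u - ln (1 / B)"
      proof -
        have "((\<lambda>x. 1 / x) has_integral (ln u - ln (1 / B))) {1/B..u}"
          using 2 B pos by (intro fundamental_theorem_of_calculus)
            (auto simp flip: has_real_derivative_iff_has_vector_derivative
              intro!: derivative_eq_intros simp: I_def)
        moreover have "set_integrable lborel {1/B..u} (\<lambda>x. 1 / x)"
          using intd[of "{..u}" "\<lambda>x. 1 / x"] h' 2 unfolding set_integrable_def I_def
          by (simp add: Int_atLeastAtMostL1 min_def)
        ultimately have "(LINT x:{1/B..u}|lborel. 1 / x) = ln u - ln (1 / B)"
          using set_borel_integral_eq_integral(2) by (metis integral_unique)
        then show ?thesis by (simp add: set_lebesgue_integral_def)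
      qed
      have "{..u} \<inter> I = {1 / real B..u}" using 2 by (auto simp: I_def)
      then show ?thesis using hits_interval[OF B order_refl 2] inv unfolding P_eq by (simp add: P_def J_def J'_def)
    qed
  qed
  have UN: "P UNIV" using half[of 1] by (simp add: P_def J_def J'_def I_def Int_absorb1)
  have diff: "(\<integral>x. indicator ((UNIV - A) \<inter> I) x * g x \<partial>lborel)
      = (\<integral>x. indicator (UNIV \<inter> I) x * g x \<partial>lborel) - (\<integral>x. indicator (A \<inter> I) x * g x \<partial>lborel)"
    if [measurable]: "A \<in> sets borel" "g \<in> borel_measurable borel"
      and g: "\<And>x. x \<in> I \<Longrightarrow> \<bar>g x\<bar> \<le> 2 * real B" for A and g :: "real \<Rightarrow> real"
  proof -
    have "indicator ((UNIV - A) \<inter> I) x * g x = indicator (UNIV \<inter> I) x * g x - indicator (A \<inter> I) x * g x" for x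
      by (auto simp: indicator_def)
    then show ?thesis
      using intd[of UNIV g] intd[of A g] that by (simp only: Bochner_Integration.integral_diff) auto
  qed
  have "P A"
  proof (rule sigma_sets_induct_disjoint[where G = "range atMost" and \<Omega> = UNIV])
    show "Int_stable (range (atMost :: real \<Rightarrow> _))" by (auto simp: Int_stable_def)
    show "A \<in> sigma_sets UNIV (range atMost)" using A by (simp add: borel_eq_atMost)
    show "P {}" by (simp add: P_def J_def J'_def)
    show "P A" if "A \<in> range atMost" for A using that half by auto
  next
    fix A :: "real set" assume A: "A \<in> sigma_sets UNIV (range atMost)" and PA: "P A"
    have [measurable]: "A \<in> sets borel" using A by (simp add: borel_eq_atMost)
    have "J v (UNIV - A) = J v UNIV - J v A" for v
      unfolding J_def using h by (intro diff) auto
    moreover have "J' (UNIV - A) = J' UNIV - J' A"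
      unfolding J'_def using h' by (intro diff) auto
    ultimately show "P (UNIV - A)"
      using UN PA unfolding P_def by (auto intro: tendsto_diff)
  next
    fix A :: "nat \<Rightarrow> real set"
    assume disj: "disjoint_family A" and A: "range A \<subseteq> sigma_sets UNIV (range atMost)"
      and PA: "\<And>i. P (A i)"
    have m [measurable]: "A i \<in> sets borel" for i using A by (auto simp: borel_eq_atMost)
    have Um: "\<Union> (range A) \<in> sets borel" by measurable
    define c where "c i = measure lborel (A i \<inter> I)" for i
    have dI: "disjoint_family (\<lambda>i. A i \<inter> I)" using disj by (auto simp: disjoint_family_on_def)
    have "(\<lambda>i. measure lborel (A i \<inter> I)) sums measure lborel (\<Union>i. A i \<inter> I)"
      using dI finI[OF Um] by (intro measure_UNION) (auto simp: Int_UN_distrib2)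
    then have sumc: "summable (\<lambda>i. 2 * real B * c i)" unfolding c_def by (intro summable_mult) (rule sums_summable)
    have sums: "(\<lambda>i. \<integral>x. indicator (A i \<inter> I) x * g x \<partial>lborel) sums (\<integral>x. indicator (\<Union> (range A) \<inter> I) x * g x \<partial>lborel)"
      and bnd: "norm (\<integral>x. indicator (A i \<inter> I) x * g x \<partial>lborel) \<le> 2 * real B * c i"
      if [measurable]: "g \<in> borel_measurable borel"
        and g: "\<And>x. x \<in> I \<Longrightarrow> \<bar>g x\<bar> \<le> 2 * real B" for g :: "real \<Rightarrow> real" and i
    proof -
      have "set_integrable lborel (\<Union>i. A i \<inter> I) g"
        using intd[OF Um that] by (simp add: set_integrable_def Int_UN_distrib2)
      from lebesgue_integral_countable_add[OF _ _ this] dI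
      have "(LINT x:(\<Union>i. A i \<inter> I)|lborel. g x) = (\<Sum>i. (LINT x:A i \<inter> I|lborel. g x))"
        by (auto simp: disjoint_family_on_def)
      have bb: "norm (\<integral>x. indicator (A i \<inter> I) x * g x \<partial>lborel) \<le> 2 * real B * c i" for i
      proof -
        have "norm (\<integral>x. indicator (A i \<inter> I) x * g x \<partial>lborel) \<le> (\<integral>x. indicator (A i \<inter> I) x * (2 * real B) \<partial>lborel)"
          using finI[OF m, of i] g
          by (intro Bochner_Integration.integral_norm_bound_integral intd integrable_mult_left integrable_real_indicator)
             (auto simp: indicator_def that)
        then show ?thesis by (simp add: c_def mult.commute)
      qed
      show "norm (\<integral>x. indicator (A i \<inter> I) x * g x \<partial>lborel) \<le> 2 * real B * c i" by (rule bb)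
      have "summable (\<lambda>i. \<integral>x. indicator (A i \<inter> I) x * g x \<partial>lborel)"
        by (rule summable_comparison_test'[OF sumc]) (rule bb)
      then show "(\<lambda>i. \<integral>x. indicator (A i \<inter> I) x * g x \<partial>lborel) sums (\<integral>x. indicator (\<Union> (range A) \<inter> I) x * g x \<partial>lborel)"
        using \<open>(LINT x:(\<Union>i. A i \<inter> I)|lborel. g x) = _\<close>
        by (simp add: sums_iff set_lebesgue_integral_def Int_UN_distrib2)
    qed
    \<comment> \<open>Interchange of the limit in \<open>v\<close> with the sum over the disjoint
      pieces: their measures inside the cell are summable, so \<open>2 * B * c i\<close> is a
      majorant.\<close>
    have "(\<lambda>v. \<Sum>i. J v (A i)) \<longlonglongrightarrow> (\<Sum>i. J' (A i))"
    proof (rule conjunct2[OF conjunct2[OF tannerys_theorem[where M = "\<lambda>i. 2 * real B * c i"]]])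
      show "(\<lambda>v. J v (A i)) \<longlonglongrightarrow> J' (A i)" for i using PA by (simp add: P_def)
      show "\<forall>\<^sub>F (k, v) in sequentially \<times>\<^sub>F sequentially. norm (J v (A k)) \<le> 2 * real B * c k"
        using bnd[OF hits_measurable h] by (intro always_eventually) (auto simp: J_def)
    qed (use sumc in auto)
    then show "P (\<Union> (range A))"
      using sums_unique[OF sums[OF hits_measurable h]] sums_unique[OF sums[of "\<lambda>x. 1 / x", OF _ h']]
      unfolding P_def J_def J'_def by simp
  qed auto
  then show ?thesis by (simp add: P_def J_def J'_def I_def)
qed

text \<open>Weak-star convergence in \<open>L^\<infinity>\<close> tested against \<open>L^1\<close>:
  on the cell the functions \<open>hits B v\<close> are uniformly bounded, and simple functions are
  dense in \<open>L^1\<close>. Testing with arbitrary integrable \<open>g\<close> is what admits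
  unbounded densities.\<close>

lemma hits_equidistributed:
  assumes B: "0 < B" and g: "integrable lborel g"
  defines "I \<equiv> {1 / real B..1}"
  shows "(\<lambda>v. \<integral>x. g x * (indicator I x * hits B v x) \<partial>lborel)
    \<longlonglongrightarrow> (\<integral>x. g x * (indicator I x * (1 / x)) \<partial>lborel)"
  using g
proof (induction rule: integrable_induct)
  case (base A c)
  have eq: "(\<integral>x. indicator A x *\<^sub>R c * (indicator I x * w x) \<partial>lborel)
      = c * (\<integral>x. indicator (A \<inter> I) x * w x \<partial>lborel)" for w :: "real \<Rightarrow> real"
  proof -
    have "(\<lambda>x. indicator A x *\<^sub>R c * (indicator I x * w x)) = (\<lambda>x. c * (indicator (A \<inter> I) x * w x))"
      by (auto simp: indicator_def)
    then show ?thesis by simp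
  qed
  show ?case unfolding eq
    using tendsto_mult_left[OF hits_borel_set[OF B, of A, folded I_def], of c] base by simp
next
  have pos: "0 < x" if "x \<in> I" for x
    using that B unfolding I_def by (smt (verit) atLeastAtMost_iff divide_pos_pos of_nat_0_less_iff)
  have h: "\<bar>indicator I x * hits B v x\<bar> \<le> 2 * real B" for v x
    using hits_le_const[of B x v] B hits_nonneg[of B v x] unfolding I_def by (auto simp: indicator_def)
  have h': "\<bar>indicator I x * (1 / x)\<bar> \<le> 2 * real B" for x
    using B pos[of x] unfolding I_def by (auto simp: indicator_def field_simps)
  have [measurable]: "I \<in> sets borel" by (simp add: I_def)
  have int: "integrable lborel (\<lambda>x. g x * w x)"
    if [measurable]: "integrable lborel g" "w \<in> borel_measurable borel" and "\<And>x. \<bar>w x\<bar> \<le> 2 * real B"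
    for g w :: "real \<Rightarrow> real"
    by (rule Bochner_Integration.integrable_bound[where f = "\<lambda>x. 2 * real B * \<bar>g x\<bar>"])
      (use that in \<open>auto simp: abs_mult mult.commute intro!: mult_left_mono\<close>)
  {
    case (add f g)
    have ad: "(\<integral>x. (f x + g x) * w x \<partial>lborel) = (\<integral>x. f x * w x \<partial>lborel) + (\<integral>x. g x * w x \<partial>lborel)"
      if [measurable]: "w \<in> borel_measurable borel" and "\<And>x. \<bar>w x\<bar> \<le> 2 * real B" for w :: "real \<Rightarrow> real"
      using int[OF add(1) that] int[OF add(2) that] by (simp add: distrib_right)
    have "(\<lambda>x. indicator I x * hits B v x) \<in> borel_measurable borel"
      "(\<lambda>x. indicator I x * (1 / x)) \<in> borel_measurable borel" for v
      by measurable
    from ad[OF this(1) h] ad[OF this(2) h'] show ?case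
      using tendsto_add[OF add(3,4)] by (simp only:)
  next
    case (lim f s)
    define e where "e i = 2 * real B * (\<integral>x. \<bar>s i x - f x\<bar> \<partial>lborel)" for i
    have close: "\<bar>(\<integral>x. s i x * w x \<partial>lborel) - (\<integral>x. f x * w x \<partial>lborel)\<bar> \<le> e i"
      if [measurable]: "w \<in> borel_measurable borel" and w: "\<And>x. \<bar>w x\<bar> \<le> 2 * real B" for w :: "real \<Rightarrow> real" and i
    proof -
      have "(\<integral>x. s i x * w x \<partial>lborel) - (\<integral>x. f x * w x \<partial>lborel) = (\<integral>x. (s i x - f x) * w x \<partial>lborel)"
        using int[OF lim(1) that] int[OF lim(4) that] by (simp add: left_diff_distrib)
      also have "\<bar>\<dots>\<bar> \<le> (\<integral>x. 2 * real B * \<bar>s i x - f x\<bar> \<partial>lborel)"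
        unfolding real_norm_def[symmetric]
      proof (rule Bochner_Integration.integral_norm_bound_integral)
        have d: "integrable lborel (\<lambda>x. s i x - f x)" using lim(1,4) by simp
        show "integrable lborel (\<lambda>x. (s i x - f x) * w x)" by (rule int[OF d that])
        show "integrable lborel (\<lambda>x. 2 * real B * norm (s i x - f x))"
          using d by (intro integrable_mult_right integrable_norm)
        show "norm ((s i x - f x) * w x) \<le> 2 * real B * norm (s i x - f x)" for x
          using mult_left_mono[OF w[of x], of "\<bar>s i x - f x\<bar>"] by (simp add: abs_mult mult.commute)
      qed
      finally show ?thesis by (simp add: e_def)
    qed
    have "(\<lambda>i. \<integral>x. \<bar>s i x - f x\<bar> \<partial>lborel) \<longlonglongrightarrow> integral\<^sup>L lborel (\<lambda>x::real. 0)"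
    proof (rule integral_dominated_convergence[where w = "\<lambda>x. 3 * \<bar>f x\<bar>" and f = "\<lambda>x. 0" and s = "\<lambda>i x. \<bar>s i x - f x\<bar>"])
      show "AE x in lborel. (\<lambda>i. \<bar>s i x - f x\<bar>) \<longlonglongrightarrow> 0"
      proof (rule AE_I2)
        fix x :: real
        have "(\<lambda>i. s i x) \<longlonglongrightarrow> f x" using lim(2)[of x] by simp
        from tendsto_rabs_zero[OF LIM_zero[OF this]] show "(\<lambda>i. \<bar>s i x - f x\<bar>) \<longlonglongrightarrow> 0" .
      qed
      show "AE x in lborel. norm \<bar>s i x - f x\<bar> \<le> 3 * \<bar>f x\<bar>" for i
      proof (rule AE_I2)
        fix x :: real
        have "\<bar>s i x\<bar> \<le> 2 * \<bar>f x\<bar>" using lim(3)[of x i] by simp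
        then show "norm \<bar>s i x - f x\<bar> \<le> 3 * \<bar>f x\<bar>" unfolding real_norm_def by linarith
      qed
    qed (use lim(1,4) in simp_all)
    then have e: "e \<longlonglongrightarrow> 0" unfolding e_def by (auto intro: tendsto_mult_right_zero)
    show ?case
    \<comment> \<open>The \<open>L^1\<close> error of the approximation \<open>s i\<close> enters
      twice, uniformly in \<open>v\<close>, and the convergence for the fixed \<open>s i\<close>
      once.\<close>
    proof (rule LIMSEQ_I)
      fix r :: real assume r: "0 < r"
      from order_tendstoD(2)[OF e, of "r/3"] r obtain i where i: "e i < r / 3"
        by (auto simp: eventually_sequentially)
      from LIMSEQ_D[OF lim(5)[of i], of "r/3"] r obtain n0 where
        n0: "\<And>v. v \<ge> n0 \<Longrightarrow> \<bar>(\<integral>x. s i x * (indicator I x * hits B v x) \<partial>lborel)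
          - (\<integral>x. s i x * (indicator I x * (1 / x)) \<partial>lborel)\<bar> < r / 3" by auto
      show "\<exists>n0. \<forall>v\<ge>n0. norm ((\<integral>x. f x * (indicator I x * hits B v x) \<partial>lborel)
          - (\<integral>x. f x * (indicator I x * (1 / x)) \<partial>lborel)) < r"
      proof (intro exI allI impI)
        fix v assume "n0 \<le> v"
        have "(\<lambda>x. indicator I x * hits B v x) \<in> borel_measurable borel"
          "(\<lambda>x. indicator I x * (1 / x)) \<in> borel_measurable borel"
          by measurable
        from n0[OF \<open>n0 \<le> v\<close>] close[OF this(1) h, of i] close[OF this(2) h', of i] i
        show "norm ((\<integral>x. f x * (indicator I x * hits B v x) \<partial>lborel)
          - (\<integral>x. f x * (indicator I x * (1 / x)) \<partial>lborel)) < r"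
          unfolding real_norm_def abs_less_iff abs_le_iff by linarith
      qed
    qed
  }
qed

section \<open>Expected numbers of descendants\<close>

text \<open>Node \<open>i\<close> is a child of \<open>v\<close> through an attachment in \<open>A\<close> with probability
  \<open>measure P (A \<inter> hit i v)\<close>. For \<open>A \<subseteq> {1 / B..<1}\<close> this requires \<open>i < (v + 1) * B\<close>, so the
  sum below runs over all possible children.\<close>

definition child_sum :: "real measure \<Rightarrow> real set \<Rightarrow> nat \<Rightarrow> (nat \<Rightarrow> real) \<Rightarrow> nat \<Rightarrow> real" where
  "child_sum P A B h v = (\<Sum>i<(v + 1) * B. h i * measure P (A \<inter> hit i v))"

definition window :: "real \<Rightarrow> real \<Rightarrow> nat \<Rightarrow> real" where
  "window a b i = (if a \<le> real i \<and> real i < b then 1 else 0)"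

definition trunc_moment :: "real measure \<Rightarrow> nat \<Rightarrow> real \<Rightarrow> real" where
  "trunc_moment P B l = (\<integral>x. indicator {1 / real B..<1} x * x powr l \<partial>P)"

text \<open>Minus the derivative of \<open>trunc_moment\<close> in \<open>l\<close>. The quotient of
  the two is the mean of \<open>- ln X\<close> under the truncated law tilted by
  \<open>x powr l\<close>, the typical logarithmic growth of a label per generation.\<close>

definition trunc_log_moment :: "real measure \<Rightarrow> nat \<Rightarrow> real \<Rightarrow> real" where
  "trunc_log_moment P B l = (\<integral>x. indicator {1 / real B..<1} x * (x powr l * (- ln x)) \<partial>P)"

text \<open>For \<open>u = - w\<close> with \<open>w > 0\<close>, the product of
  \<open>1 - w + w\<^sup>2\<close> with the quadratic Taylor minorant of \<open>exp w\<close> is at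
  least 1. The bound holds on the whole half-line, so both directions of an exponent shift are
  treated alike.\<close>

lemma exp_le_quadratic:
  assumes "u \<le> (1::real)" shows "exp u \<le> 1 + u + u\<^sup>2"
proof (cases "0 \<le> u")
  case True
  then show ?thesis using exp_bound[of u] assms by simp
next
  case False
  define w where "w = - u"
  have w: "0 \<le> w" using False by (simp add: w_def)
  have "1 \<le> (1 - w + w\<^sup>2) * (1 + w + w\<^sup>2 / 2)"
  proof -
    have "(1 - w + w\<^sup>2) * (1 + w + w\<^sup>2 / 2) = 1 + w\<^sup>2 / 2 + w ^ 3 / 2 + w ^ 4 / 2"
      by (simp add: field_simps power2_eq_square power3_eq_cube power4_eq_xxxx)
    then show ?thesis using w by simp
  qed
  also have "\<dots> \<le> (1 - w + w\<^sup>2) * exp w"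
  proof (rule mult_left_mono)
    show "1 + w + w\<^sup>2 / 2 \<le> exp w" using exp_lower_Taylor_quadratic[OF w] .
    have "1 - w + w\<^sup>2 = (w - 1/2)\<^sup>2 + 3/4" by (simp add: power2_eq_square field_simps)
    then show "0 \<le> 1 - w + w\<^sup>2" by simp
  qed
  finally have "1 / exp w \<le> 1 - w + w\<^sup>2" by (simp add: field_simps)
  then show ?thesis by (simp add: w_def exp_minus inverse_eq_divide)
qed

text \<open>The support is placed in the open interval, 0 being a null point of a density; so the
  default values of \<open>ln\<close> and \<open>powr\<close> at 0 never matter.\<close>

locale attachment_law = prob_space P for P :: "real measure" +
  fixes f :: "real \<Rightarrow> real"
  assumes P_eq: "P = density lborel (\<lambda>x. ennreal (f x))"
    and f_meas [measurable]: "f \<in> borel_measurable borel"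
    and f_nonneg: "\<And>x. 0 \<le> f x"
    and in_unit: "AE x in P. 0 < x \<and> x < 1"
begin

lemma sets_P [simp, measurable_cong]: "sets P = sets borel" by (simp add: P_eq)

lemma space_P [simp]: "space P = UNIV" by (simp add: P_eq)

lemma cell_subset_pos: "0 < B \<Longrightarrow> x \<in> {1 / real B..<1} \<Longrightarrow> 0 < x"
  by (smt (verit) atLeastLessThan_iff divide_pos_pos of_nat_0_less_iff)

lemma powr_le_cell:
  assumes "0 < B" "x \<in> {1 / real B..<1}" shows "x powr l \<le> real B powr \<bar>l\<bar>"
proof -
  have x: "0 < x" using cell_subset_pos assms by blast
  have "x powr l \<le> x powr (- \<bar>l\<bar>)" using assms x by (intro powr_mono') auto
  also have "\<dots> = (1 / x) powr \<bar>l\<bar>" using x by (simp add: powr_minus powr_divide inverse_eq_divide)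
  also have "\<dots> \<le> real B powr \<bar>l\<bar>"
    using assms x by (intro powr_mono2) (auto simp: field_simps)
  finally show ?thesis .
qed

lemma integrable_cell:
  fixes g :: "real \<Rightarrow> real"
  assumes "0 < B" and [measurable]: "g \<in> borel_measurable borel"
    and "\<And>x. x \<in> {1 / real B..<1} \<Longrightarrow> \<bar>g x\<bar> \<le> C"
  shows "integrable P (\<lambda>x. indicator {1 / real B..<1} x * g x)"
proof (rule integrable_const_bound[where B = "\<bar>C\<bar>"])
  show "AE x in P. norm (indicator {1 / real B..<1} x * g x) \<le> \<bar>C\<bar>"
    using assms(3) by (intro AE_I2) (force simp: indicator_def)
qed measurable

lemma integrable_trunc_moment: "0 < B \<Longrightarrow> integrable P (\<lambda>x. indicator {1 / real B..<1} x * x powr l)"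
  by (rule integrable_cell[where C = "real B powr \<bar>l\<bar>"]) (use powr_le_cell in auto)

lemma ln_cell:
  assumes "0 < B" "x \<in> {1 / real B..<1}" shows "0 < - ln x" "- ln x \<le> ln B"
proof -
  have x: "0 < x" using cell_subset_pos assms by blast
  then show "0 < - ln x" using assms by simp
  have "ln (1 / real B) \<le> ln x" using assms x by (subst ln_le_cancel_iff) auto
  then show "- ln x \<le> ln B" using assms by (simp add: ln_div)
qed

lemma integrable_trunc_log_moment:
  "0 < B \<Longrightarrow> integrable P (\<lambda>x. indicator {1 / real B..<1} x * (x powr l * (- ln x)))"
proof (rule integrable_cell[where C = "real B powr \<bar>l\<bar> * ln B"])
  fix x assume "0 < B" "x \<in> {1 / real B..<1}"
  then show "\<bar>x powr l * - ln x\<bar> \<le> real B powr \<bar>l\<bar> * ln B"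
    using mult_mono[OF powr_le_cell[of B x l], of "- ln x" "ln B"] ln_cell[of B x]
    by (simp add: abs_mult)
qed auto

text \<open>With \<open>f\<close> times a power as the test function, equidistribution replaces
  \<open>hits\<close> by \<open>1 / x\<close>, which lowers the exponent by one. The power is
  bounded on the cell, so the test function is integrable for every real \<open>l\<close>.\<close>

lemma hits_law:
  assumes B: "0 < B"
  shows "(\<lambda>v. \<integral>x. indicator {1 / real B..<1} x * (x powr l * hits B v x) \<partial>P) \<longlonglongrightarrow> trunc_moment P B (l - 1)"
proof -
  define A where "A = {1 / real B..<1}"
  have [measurable]: "A \<in> sets borel" by (simp add: A_def)
  have "integrable P (\<lambda>x. indicator A x * x powr l)" unfolding A_def by (rule integrable_trunc_moment[OF B])
  then have g: "integrable lborel (\<lambda>x. f x * (indicator A x * x powr l))"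
    unfolding P_eq by (subst (asm) integrable_real_density) (use f_nonneg in auto)
  have "(\<integral>x. indicator A x * (x powr l * w x) \<partial>P)
      = (\<integral>x. f x * (indicator A x * x powr l) * (indicator {1 / real B..1} x * w x) \<partial>lborel)"
    if [measurable]: "w \<in> borel_measurable borel" for w
    unfolding P_eq by (subst integral_real_density)
      (use f_nonneg in \<open>auto intro!: Bochner_Integration.integral_cong simp: A_def indicator_def\<close>)
  note this[OF hits_measurable] this[of "\<lambda>x. 1 / x"]
  moreover have "trunc_moment P B (l - 1) = (\<integral>x. indicator A x * (x powr l * (1 / x)) \<partial>P)"
    unfolding trunc_moment_def A_def
  proof (rule Bochner_Integration.integral_cong[OF refl])
    fix x :: real
    show "indicator {1 / real B..<1} x * x powr (l - 1) = indicator {1 / real B..<1} x * (x powr l * (1 / x))"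
      using cell_subset_pos[OF B, of x] by (auto simp: indicator_def powr_diff)
  qed
  ultimately show ?thesis using hits_equidistributed[OF B g] unfolding A_def by simp
qed

section \<open>Iterated expected offspring of power weights\<close>

lemma child_sum_mono:
  assumes "\<And>i. v \<le> i \<Longrightarrow> h i \<le> h' i" "A \<subseteq> {0..<1}"
  shows "child_sum P A B h v \<le> child_sum P A B h' v"
  unfolding child_sum_def
proof (rule sum_mono)
  fix i
  show "h i * measure P (A \<inter> hit i v) \<le> h' i * measure P (A \<inter> hit i v)"
  proof (cases "v \<le> i")
    case False
    then have "A \<inter> hit i v = {}"
    proof -
      have "x \<notin> hit i v" if "x \<in> A" for x
      proof -
        have "real i * x \<le> real i" using that assms(2) by (auto intro!: mult_left_le)
        then show ?thesis using False that assms(2) by (auto simp: hit_iff)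
      qed
      then show ?thesis by auto
    qed
    then show ?thesis by simp
  qed (use assms in \<open>auto intro: mult_right_mono\<close>)
qed

lemma child_sum_linear:
  "child_sum P A B (\<lambda>i. a * h i + b * g i) v = a * child_sum P A B h v + b * child_sum P A B g v"
  unfolding child_sum_def by (simp add: sum.distrib sum_distrib_left algebra_simps)

lemma child_sum_scale: "child_sum P A B (\<lambda>i. a * h i) v = a * child_sum P A B h v"
  using child_sum_linear[of A B a h 0 h v] by simp

text \<open>Descendants through attachments below 1 have labels at least \<open>v\<close>, so only
  the weights from \<open>v\<close> on count. This lets estimates that hold for large labels only be
  iterated.\<close>

lemma child_sum_pow_mono:
  assumes "\<And>i. v \<le> i \<Longrightarrow> h i \<le> h' i" "A \<subseteq> {0..<1}"
  shows "(child_sum P A B ^^ k) h v \<le> (child_sum P A B ^^ k) h' v"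
  using assms(1)
proof (induction k arbitrary: v)
  case (Suc k)
  then show ?case using assms(2) by (auto intro!: child_sum_mono)
qed auto

lemma child_sum_pow_linear:
  "(child_sum P A B ^^ k) (\<lambda>i. a * h i + b * g i) = (\<lambda>v. a * (child_sum P A B ^^ k) h v + b * (child_sum P A B ^^ k) g v)"
  by (induction k) (auto simp: child_sum_linear)

lemma child_sum_eq_integral:
  assumes "A \<in> sets borel"
  shows "child_sum P A B h v = (\<integral>x. indicator A x * (\<Sum>i<(v+1)*B. h i * indicator (hit i v) x) \<partial>P)"
proof -
  have [measurable]: "A \<in> sets borel" by fact
  have "(\<integral>x. indicator A x * (\<Sum>i<(v+1)*B. h i * indicator (hit i v) x) \<partial>P)
     = (\<integral>x. (\<Sum>i<(v+1)*B. h i * indicator (A \<inter> hit i v) x) \<partial>P)"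
    by (intro Bochner_Integration.integral_cong refl) (auto simp: sum_distrib_left indicator_def intro!: sum.cong)
  also have "\<dots> = child_sum P A B h v"
    unfolding child_sum_def by (subst Bochner_Integration.integral_sum) (auto intro!: integrable_mult_right integrable_real_indicator simp: emeasure_eq_measure)
  finally show ?thesis ..
qed

text \<open>If \<open>x \<in> hit i v\<close>, then \<open>i * x / v\<close> lies between 1 and
  \<open>1 + 1 / v\<close>, so \<open>i powr (- t)\<close> is \<open>v powr (- t) * x powr t\<close>
  up to a factor tending to 1; the rest is \<open>hits_law\<close>.\<close>

lemma child_sum_powr:
  assumes B: "0 < B"
  shows "(\<lambda>v. child_sum P {1 / real B..<1} B (\<lambda>i. real i powr (- t)) v * real v powr t) \<longlonglongrightarrow> trunc_moment P B (t - 1)"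
proof (rule tendsto_sandwich)
  define A where "A = {1 / real B..<1}"
  have [measurable]: "A \<in> sets borel" by (simp add: A_def)
  define I where "I v = (\<integral>x. indicator A x * (x powr t * hits B v x) \<partial>P)" for v
  \<comment> \<open>\<open>min\<close> and \<open>max\<close> with 1 cover both signs of
    \<open>t\<close>.\<close>
  define lo hi where "lo v = min 1 ((1 + 1 / real v) powr (- t))" and "hi v = max 1 ((1 + 1 / real v) powr (- t))" for v
  have intI: "integrable P (\<lambda>x. indicator A x * (x powr t * hits B v x))" for v
    unfolding A_def
  proof (rule integrable_cell[OF B, where C = "real B powr \<bar>t\<bar> * (2 * real B)"])
    fix x assume x: "x \<in> {1 / real B..<1}"
    then have "\<bar>hits B v x\<bar> \<le> 2 * real B" using B hits_le_const[of B x v] hits_nonneg[of B v x] by auto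
    then show "\<bar>x powr t * hits B v x\<bar> \<le> real B powr \<bar>t\<bar> * (2 * real B)"
      using powr_le_cell[OF B x, of t] by (auto simp: abs_mult intro!: mult_mono)
  qed measurable
  have pt: "lo v * (x powr t * indicator (hit i v) x) \<le> real i powr (- t) * real v powr t * indicator (hit i v) x
      \<and> real i powr (- t) * real v powr t * indicator (hit i v) x \<le> hi v * (x powr t * indicator (hit i v) x)"
    if v: "1 \<le> v" and x: "x \<in> A" for v i x
  proof (cases "x \<in> hit i v")
    case True
    have x0: "0 < x" using x cell_subset_pos[OF B] by (simp add: A_def)
    have h: "v \<le> i * x" "i * x < v + 1" using True x0 by (auto simp: hit_iff)
    have i: "0 < real i" using h v by (cases "i = 0") auto
    define r where "r = i * x / v"
    have r: "1 \<le> r" "r \<le> 1 + 1 / v" using h v by (auto simp: r_def field_simps)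
    have eq: "real i powr (- t) * real v powr t = r powr (- t) * x powr t"
      using i x0 v by (simp add: r_def powr_divide powr_mult powr_minus field_simps)
    have "lo v \<le> r powr (- t) \<and> r powr (- t) \<le> hi v"
    proof (cases "0 \<le> t")
      case True
      have "(1 + 1 / v) powr (- t) \<le> r powr (- t)" "r powr (- t) \<le> 1 powr (- t)"
        using True r powr_mono2'[of "- t" 1 r] powr_mono2'[of "- t" r "1 + 1 / v"] by auto
      then show ?thesis by (auto simp: lo_def hi_def)
    next
      case False
      have "r powr (- t) \<le> (1 + 1 / v) powr (- t)" "1 powr (- t) \<le> r powr (- t)"
        using False r powr_mono2[of "- t" 1 r] powr_mono2[of "- t" r "1 + 1 / v"] by auto
      then show ?thesis by (auto simp: lo_def hi_def)
    qed
    then show ?thesis using True unfolding eq by (auto intro: mult_right_mono)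
  qed auto
  have eq: "child_sum P A B (\<lambda>i. real i powr (- t)) v * real v powr t
      = (\<integral>x. indicator A x * (\<Sum>i<(v+1)*B. real i powr (- t) * real v powr t * indicator (hit i v) x) \<partial>P)" for v
    using child_sum_eq_integral[of A B "\<lambda>i. real v powr t * real i powr (- t)" v]
    by (simp add: child_sum_scale mult_ac)
  have int1: "integrable P (\<lambda>x. indicator A x * (\<Sum>i<(v+1)*B. real i powr (- t) * real v powr t * indicator (hit i v) x))" for v
  proof (rule integrable_const_bound[where B = "\<Sum>i<(v+1)*B. real i powr (- t) * real v powr t"])
    have 1: "0 \<le> (\<Sum>i<(v+1)*B. real i powr (- t) * real v powr t * indicator (hit i v) x)" for x
      by (intro sum_nonneg) auto
    have 2: "(\<Sum>i<(v+1)*B. real i powr (- t) * real v powr t * indicator (hit i v) x)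
        \<le> (\<Sum>i<(v+1)*B. real i powr (- t) * real v powr t)" for x
      by (intro sum_mono) (auto simp: indicator_def)
    have 3: "0 \<le> (\<Sum>i<(v+1)*B. real i powr (- t) * real v powr t)" by (intro sum_nonneg) auto
    show "AE x in P. norm (indicator A x * (\<Sum>i<(v+1)*B. real i powr (- t) * real v powr t * indicator (hit i v) x))
        \<le> (\<Sum>i<(v+1)*B. real i powr (- t) * real v powr t)"
    proof (rule AE_I2)
      fix x
      show "norm (indicator A x * (\<Sum>i<(v+1)*B. real i powr (- t) * real v powr t * indicator (hit i v) x))
        \<le> (\<Sum>i<(v+1)*B. real i powr (- t) * real v powr t)"
        using 1[of x] 2[of x] 3 by (cases "x \<in> A") (simp_all del: mult_indicator_subset)
    qed
  qed measurable
  have "lo v * I v \<le> child_sum P A B (\<lambda>i. real i powr (- t)) v * real v powr t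
     \<and> child_sum P A B (\<lambda>i. real i powr (- t)) v * real v powr t \<le> hi v * I v" if v: "1 \<le> v" for v
  proof
    have l: "lo v * (indicator A x * (x powr t * hits B v x))
       \<le> indicator A x * (\<Sum>i<(v+1)*B. real i powr (- t) * real v powr t * indicator (hit i v) x)
      \<and> indicator A x * (\<Sum>i<(v+1)*B. real i powr (- t) * real v powr t * indicator (hit i v) x)
        \<le> hi v * (indicator A x * (x powr t * hits B v x))" for x
    proof (cases "x \<in> A")
      case True
      have e: "c * (x powr t * hits B v x) = (\<Sum>i<(v+1)*B. c * (x powr t * indicator (hit i v) x))" for c
        by (simp only: hits_def sum_distrib_left)
      show ?thesis unfolding indicator_simps(1)[OF True] mult_1 unfolding e
        using pt[OF v True] by (intro conjI sum_mono) auto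
    qed simp
    show "lo v * I v \<le> child_sum P A B (\<lambda>i. real i powr (- t)) v * real v powr t"
      unfolding eq I_def integral_mult_right_zero[symmetric]
      using l by (intro integral_mono integrable_mult_right intI int1) auto
    show "child_sum P A B (\<lambda>i. real i powr (- t)) v * real v powr t \<le> hi v * I v"
      unfolding eq I_def integral_mult_right_zero[symmetric]
      using l by (intro integral_mono integrable_mult_right intI int1) auto
  qed
  then show "\<forall>\<^sub>F v in sequentially. lo v * I v \<le> child_sum P {1 / real B..<1} B (\<lambda>i. real i powr (- t)) v * real v powr t"
    "\<forall>\<^sub>F v in sequentially. child_sum P {1 / real B..<1} B (\<lambda>i. real i powr (- t)) v * real v powr t \<le> hi v * I v"
    unfolding A_def by (auto intro!: eventually_sequentiallyI[of 1])
  have I: "I \<longlonglongrightarrow> trunc_moment P B (t - 1)" unfolding I_def A_def by (rule hits_law[OF B])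
  have one: "(\<lambda>v. (1 + 1 / real v) powr (- t)) \<longlonglongrightarrow> 1" by real_asymp
  show "(\<lambda>v. lo v * I v) \<longlonglongrightarrow> trunc_moment P B (t - 1)"
    using tendsto_mult[OF tendsto_min[OF tendsto_const one] I, of 1] unfolding lo_def by simp
  show "(\<lambda>v. hi v * I v) \<longlonglongrightarrow> trunc_moment P B (t - 1)"
    using tendsto_mult[OF tendsto_max[OF tendsto_const one] I, of 1] unfolding hi_def by simp
qed

text \<open>A bound \<open>e\<close> on the deviation of \<open>G i * i powr t\<close> from its
  limit for all \<open>i \<ge> v\<close> passes to \<open>child_sum\<close> at \<open>v\<close>, as
  children have labels at least \<open>v\<close>; it is only multiplied by the bounded factor
  \<open>H v\<close>.\<close>

lemma child_sum_iter_powr: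
  assumes B: "0 < B"
  shows "(\<lambda>v. (child_sum P {1 / real B..<1} B ^^ k) (\<lambda>i. real i powr (- t)) v * real v powr t)
    \<longlonglongrightarrow> trunc_moment P B (t - 1) ^ k"
proof (induction k)
  case 0
  have "\<forall>\<^sub>F v in sequentially. real v powr (- t) * real v powr t = 1"
    by (rule eventually_sequentiallyI[of 1]) (simp flip: powr_add)
  then show ?case by (simp add: tendsto_eventually)
next
  case (Suc k)
  define A where "A = {1 / real B..<1}"
  define \<phi> where "\<phi> = trunc_moment P B (t - 1)"
  define G where "G = (child_sum P A B ^^ k) (\<lambda>i. real i powr (- t))"
  define H where "H v = child_sum P A B (\<lambda>i. real i powr (- t)) v * real v powr t" for v
  have H: "H \<longlonglongrightarrow> \<phi>" using child_sum_powr[OF B, of t] unfolding H_def A_def \<phi>_def .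
  have A: "A \<subseteq> {0..<1}" using cell_subset_pos[OF B] by (force simp: A_def)
  have G: "(\<lambda>v. G v * real v powr t) \<longlonglongrightarrow> \<phi> ^ k" using Suc by (simp add: G_def A_def \<phi>_def)
  have bound: "\<bar>child_sum P A B G v * real v powr t - \<phi> ^ k * H v\<bar> \<le> e * H v"
    if e: "\<And>i. i \<ge> v \<Longrightarrow> \<bar>G i * real i powr t - \<phi> ^ k\<bar> \<le> e" "1 \<le> v" for e v
  proof -
    have 1: "(\<phi> ^ k - e) * real i powr (- t) \<le> G i \<and> G i \<le> (\<phi> ^ k + e) * real i powr (- t)" if "i \<ge> v" for i
    proof -
      have "G i = (G i * real i powr t) * real i powr (- t)" using that e(2) by (simp add: mult.assoc flip: powr_add)
      moreover have "\<phi> ^ k - e \<le> G i * real i powr t" "G i * real i powr t \<le> \<phi> ^ k + e" using e(1)[OF that] by auto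
      ultimately show ?thesis by (metis mult_right_mono powr_ge_zero)
    qed
    have "(\<phi> ^ k - e) * child_sum P A B (\<lambda>i. real i powr (- t)) v \<le> child_sum P A B G v"
      unfolding child_sum_scale[symmetric] using 1 A by (intro child_sum_mono) auto
    moreover have "child_sum P A B G v \<le> (\<phi> ^ k + e) * child_sum P A B (\<lambda>i. real i powr (- t)) v"
      unfolding child_sum_scale[symmetric] using 1 A by (intro child_sum_mono) auto
    ultimately have "(\<phi> ^ k - e) * H v \<le> child_sum P A B G v * real v powr t"
      "child_sum P A B G v * real v powr t \<le> (\<phi> ^ k + e) * H v"
      unfolding H_def by (simp_all flip: mult.assoc add: mult_right_mono)
    then show ?thesis by (simp add: algebra_simps abs_le_iff)
  qed
  have "(\<lambda>v. child_sum P A B G v * real v powr t - \<phi> ^ k * H v) \<longlonglongrightarrow> 0"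
  proof (rule LIMSEQ_I)
    fix r :: real assume r: "0 < r"
    define e where "e = r / (\<bar>\<phi>\<bar> + 2)"
    have e: "0 < e" using r by (simp add: e_def)
    obtain n1 where n1: "\<And>i. i \<ge> n1 \<Longrightarrow> \<bar>G i * real i powr t - \<phi> ^ k\<bar> < e"
      using LIMSEQ_D[OF G e] by auto
    obtain n2 where n2: "\<And>i. i \<ge> n2 \<Longrightarrow> \<bar>H i - \<phi>\<bar> < 1"
      using LIMSEQ_D[OF H, of 1] by auto
    show "\<exists>n0. \<forall>v\<ge>n0. norm (child_sum P A B G v * real v powr t - \<phi> ^ k * H v - 0) < r"
    proof (intro exI[of _ "max 1 (max n1 n2)"] allI impI)
      fix v assume v: "max 1 (max n1 n2) \<le> v"
      have "\<bar>child_sum P A B G v * real v powr t - \<phi> ^ k * H v\<bar> \<le> e * H v"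
        using v n1 by (intro bound) (auto intro: less_imp_le)
      also have "e * H v \<le> e * (\<bar>\<phi>\<bar> + 1)" using n2[of v] v e by (intro mult_left_mono) auto
      also have "\<dots> < e * (\<bar>\<phi>\<bar> + 2)" using e by simp
      also have "\<dots> = r" unfolding e_def by simp
      finally show "norm (child_sum P A B G v * real v powr t - \<phi> ^ k * H v - 0) < r" by simp
    qed
  qed
  from tendsto_add[OF this tendsto_mult[OF tendsto_const[of "\<phi> ^ k"] H]]
  show ?case by (simp add: G_def A_def \<phi>_def mult.commute)
qed

text \<open>Chernoff bounds for both tails in one inequality. With \<open>l = ln (i / v)\<close>,
  the function \<open>\<kappa> * exp (- (t * l)) * (1 - exp ((l - b) * \<tau>) - exp ((a - l) *
  \<tau>))\<close> is at most 1 for \<open>a \<le> l < b\<close> and nonpositive elsewhere, hence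
  below the indicator of the window. It is a combination of three powers of \<open>i\<close>, whose
  iterated sums have known asymptotics.\<close>

lemma child_sum_iter_window_ge:
  fixes v k :: nat
  assumes B: "0 < B" and v: "1 \<le> v" and \<tau>: "0 < \<tau>"
  defines "S u \<equiv> (child_sum P {1 / real B..<1} B ^^ k) (\<lambda>i. real i powr (- u)) v * real v powr u"
  shows "min (exp (t * a)) (exp (t * b)) * (S t - exp (- (b * \<tau>)) * S (t - \<tau>) - exp (a * \<tau>) * S (t + \<tau>))
    \<le> (child_sum P {1 / real B..<1} B ^^ k) (window (v * exp a) (v * exp b)) v"
proof -
  define A where "A = {1 / real B..<1}"
  have A: "A \<subseteq> {0..<1}" using cell_subset_pos[OF B] by (force simp: A_def)
  define \<kappa> where "\<kappa> = min (exp (t * a)) (exp (t * b))"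
  have \<kappa>: "0 < \<kappa>" by (simp add: \<kappa>_def)
  \<comment> \<open>The factor 1 and the bracketing match the two-term form of
    \<open>child_sum_pow_linear\<close>, applied twice.\<close>
  define h where "h = (\<lambda>i::nat. (\<kappa> * real v powr t) * real i powr (- t)
    + 1 * (- (\<kappa> * exp (- (b * \<tau>)) * real v powr (t - \<tau>)) * real i powr (- (t - \<tau>))
    + - (\<kappa> * exp (a * \<tau>) * real v powr (t + \<tau>)) * real i powr (- (t + \<tau>))))"
  have "(child_sum P A B ^^ k) h v = \<kappa> * (S t - exp (- (b * \<tau>)) * S (t - \<tau>) - exp (a * \<tau>) * S (t + \<tau>))"
    unfolding h_def child_sum_pow_linear S_def A_def by (simp add: algebra_simps)
  moreover have "h i \<le> window (v * exp a) (v * exp b) i" if "v \<le> i" for i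
  proof -
    have v0: "0 < real v" and i0: "0 < real i" using v that by auto
    define l where "l = ln (real i / v)"
    have el: "real i = v * exp l" using v0 i0 by (simp add: l_def)
    have p: "real v powr u * real i powr (- u) = exp (- (u * l))" for u
    proof -
      have "ln (v * exp l) = ln v + l" using v0 by (simp add: ln_mult)
      then show ?thesis using v0 by (simp add: el powr_def algebra_simps flip: exp_add)
    qed
    have h: "h i = \<kappa> * exp (- (t * l)) * (1 - exp ((l - b) * \<tau>) - exp ((a - l) * \<tau>))"
    proof -
      have "h i = \<kappa> * (real v powr t * real i powr (- t)) - \<kappa> * exp (- (b * \<tau>)) * (real v powr (t - \<tau>) * real i powr (- (t - \<tau>)))
        - \<kappa> * exp (a * \<tau>) * (real v powr (t + \<tau>) * real i powr (- (t + \<tau>)))"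
        unfolding h_def by (simp add: algebra_simps)
      also have "\<dots> = \<kappa> * exp (- (t * l)) * (1 - exp ((l - b) * \<tau>) - exp ((a - l) * \<tau>))"
        unfolding p by (simp add: algebra_simps flip: exp_add)
      finally show ?thesis .
    qed
    show ?thesis
    proof (cases "a \<le> l \<and> l < b")
      case True
      have "\<kappa> * exp (- (t * l)) \<le> 1"
      proof (cases "0 \<le> t")
        case t: True
        have "\<kappa> \<le> exp (t * l)" unfolding \<kappa>_def
          by (rule min.coboundedI1) (use t True in \<open>simp add: mult_left_mono\<close>)
        then show ?thesis by (simp add: exp_minus field_simps)
      next
        case t: False
        have "\<kappa> \<le> exp (t * l)" unfolding \<kappa>_def
          by (rule min.coboundedI2) (use t True in \<open>simp add: mult_left_mono_neg\<close>)
        then show ?thesis by (simp add: exp_minus field_simps)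
      qed
      moreover have "1 - exp ((l - b) * \<tau>) - exp ((a - l) * \<tau>) \<le> 1"
        by (smt (verit) exp_gt_zero)
      ultimately have "h i \<le> 1" unfolding h using \<kappa>
        by (smt (verit) exp_gt_zero mult_left_le mult_pos_pos)
      moreover have "window (v * exp a) (v * exp b) i = 1"
        using True v0 by (simp add: window_def el)
      ultimately show ?thesis by simp
    next
      case False
      have "1 - exp ((l - b) * \<tau>) - exp ((a - l) * \<tau>) \<le> 0"
      proof (cases "a \<le> l")
        case True
        then have "1 \<le> exp ((l - b) * \<tau>)" using False \<tau> by auto
        then show ?thesis by (smt (verit) exp_gt_zero)
      next
        case False
        then have "1 \<le> exp ((a - l) * \<tau>)" using \<tau> by auto
        then show ?thesis by (smt (verit) exp_gt_zero)
      qed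
      then have "h i \<le> 0" unfolding h using \<kappa> by (intro mult_nonneg_nonpos) auto
      then show ?thesis by (smt (verit) window_def)
    qed
  qed
  ultimately show ?thesis
    using child_sum_pow_mono[OF _ A, where h = h and h' = "window (v * exp a) (v * exp b)" and v = v]
    unfolding \<kappa>_def A_def by metis
qed

text \<open>Second-order expansion of the moment in its exponent; the remainder is controlled by
  \<open>- ln x \<le> ln B\<close> on the cell.\<close>

lemma trunc_moment_shift_le:
  assumes B: "0 < B" and \<tau>: "\<bar>\<tau>\<bar> * ln B \<le> 1"
  shows "trunc_moment P B (l - \<tau>) \<le> trunc_moment P B l * (1 + \<tau>\<^sup>2 * (ln B)\<^sup>2) + \<tau> * trunc_log_moment P B l"
proof -
  define A where "A = {1 / real B..<1}"
  define g where "g x = (1 + \<tau>\<^sup>2 * (ln B)\<^sup>2) * (indicator A x * x powr l) + \<tau> * (indicator A x * (x powr l * (- ln x)))" for x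
  have "trunc_moment P B (l - \<tau>) \<le> (\<integral>x. g x \<partial>P)"
    unfolding trunc_moment_def
  proof (rule integral_mono)
    show "integrable P (\<lambda>x. indicator {1 / real B..<1} x * x powr (l - \<tau>))" by (rule integrable_trunc_moment[OF B])
    show "integrable P g" unfolding g_def A_def
      using B by (intro Bochner_Integration.integrable_add integrable_mult_right integrable_trunc_moment integrable_trunc_log_moment)
    fix x
    show "indicator {1 / real B..<1} x * x powr (l - \<tau>) \<le> g x"
    proof (cases "x \<in> A")
      case True
      have x: "0 < x" using cell_subset_pos[OF B] True by (auto simp: A_def)
      define y where "y = - ln x"
      have y: "0 < y" "y \<le> ln B" using ln_cell[OF B, of x] True by (auto simp: y_def A_def)
      have "\<tau> * y \<le> \<bar>\<tau>\<bar> * ln B" using y by (smt (verit) abs_ge_self abs_ge_zero mult_mono)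
      then have "exp (\<tau> * y) \<le> 1 + \<tau> * y + (\<tau> * y)\<^sup>2" using \<tau> by (intro exp_le_quadratic) auto
      also have "(\<tau> * y)\<^sup>2 \<le> \<tau>\<^sup>2 * (ln B)\<^sup>2" using y by (simp add: power_mult_distrib mult_left_mono power_mono)
      finally have "x powr l * exp (\<tau> * y) \<le> x powr l * (1 + \<tau> * y + \<tau>\<^sup>2 * (ln B)\<^sup>2)"
        by (intro mult_left_mono) auto
      moreover have "x powr (l - \<tau>) = x powr l * exp (\<tau> * y)"
        using x by (simp add: y_def powr_def algebra_simps flip: exp_add)
      ultimately show ?thesis using True by (simp add: g_def A_def y_def algebra_simps)
    qed (simp add: A_def g_def)
  qed
  also have "\<dots> = (\<integral>x. (1 + \<tau>\<^sup>2 * (ln B)\<^sup>2) * (indicator A x * x powr l) \<partial>P)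
      + (\<integral>x. \<tau> * (indicator A x * (x powr l * (- ln x))) \<partial>P)"
    unfolding g_def A_def
    by (rule Bochner_Integration.integral_add[OF integrable_mult_right[OF integrable_trunc_moment[OF B]]
      integrable_mult_right[OF integrable_trunc_log_moment[OF B]]])
  also have "\<dots> = trunc_moment P B l * (1 + \<tau>\<^sup>2 * (ln B)\<^sup>2) + \<tau> * trunc_log_moment P B l"
    unfolding integral_mult_right_zero trunc_moment_def trunc_log_moment_def A_def
    by (rule arg_cong2[where f = "(+)"], rule mult.commute, rule refl)
  finally show ?thesis .
qed

text \<open>After \<open>K\<close> generations the tilted weight concentrates at labels around
  \<open>v * exp (K * x)\<close>, each tail losing a factor
  \<open>exp (- (K * (\<tau> * \<eta> / 2)))\<close>. The hypothesis \<open>grow\<close> says that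
  undoing the tilt leaves exponential growth. The number 8 is spent later: a factor 2 for
  Chebyshev's inequality, a factor 2 for the union of two source windows, and a factor 2 gained per
  block.\<close>

lemma eventually_window_ge:
  assumes B: "0 < B" and mom: "0 < trunc_moment P B l"
    and x_def: "x = trunc_log_moment P B l / trunc_moment P B l"
    and grow: "0 < (l + 1) * x + ln (trunc_moment P B l)"
  shows "\<exists>\<eta>0>0. \<forall>\<eta>. 0 < \<eta> \<and> \<eta> < \<eta>0 \<longrightarrow> (\<exists>K0. \<forall>K\<ge>K0. \<forall>\<^sub>F v in sequentially.
    8 \<le> (child_sum P {1 / real B..<1} B ^^ K)
      (window (v * exp (K * (x - \<eta>))) (v * exp (K * (x + \<eta>)))) v)"
proof -
  define \<theta> where "\<theta> = l + 1"
  define \<phi> where "\<phi> = trunc_moment P B l"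
  define \<gamma> where "\<gamma> = \<theta> * x + ln \<phi>"
  define C where "C = (ln B)\<^sup>2"
  have \<gamma>: "0 < \<gamma>" and \<phi>: "0 < \<phi>" using grow mom by (simp_all add: \<gamma>_def \<theta>_def \<phi>_def)
  have lB: "0 \<le> ln B" using B by simp
  have C: "0 \<le> C" by (simp add: C_def)
  \<comment> \<open>Undoing the tilt at an edge of the window costs up to
    \<open>\<bar>\<theta>\<bar> * \<eta>\<close> per generation; for \<open>\<eta> < \<eta>0\<close>
    this does not use up the rate \<open>\<gamma>\<close>.\<close>
  define \<eta>0 where "\<eta>0 = \<gamma> / (\<bar>\<theta>\<bar> + 1)"
  have "\<exists>K0. \<forall>K\<ge>K0. \<forall>\<^sub>F v in sequentially.
    8 \<le> (child_sum P {1 / real B..<1} B ^^ K)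
      (window (v * exp (K * (x - \<eta>))) (v * exp (K * (x + \<eta>)))) v" if \<eta>: "0 < \<eta>" "\<eta> < \<eta>0" for \<eta>
  proof -
    define \<delta> where "\<delta> = \<gamma> - \<bar>\<theta>\<bar> * \<eta>"
    have "\<bar>\<theta>\<bar> * \<eta> < (\<bar>\<theta>\<bar> + 1) * \<eta>" using \<eta> by simp
    also have "\<dots> < \<gamma>" using \<eta> by (simp add: \<eta>0_def field_simps)
    finally have \<delta>: "0 < \<delta>" by (simp add: \<delta>_def)
    \<comment> \<open>The first bound admits the quadratic expansion, the second keeps the quadratic
      error within half of the Chernoff gain \<open>\<tau> * \<eta>\<close>.\<close>
    define \<tau> where "\<tau> = min (1 / (ln B + 1)) (\<eta> / (2 * (C + 1)))"
    have \<tau>: "0 < \<tau>" using \<eta> lB C by (simp add: \<tau>_def)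
    have \<tau>1: "\<bar>\<tau>\<bar> * ln B \<le> 1"
    proof -
      have "\<tau> * ln B \<le> 1 / (ln B + 1) * ln B" using lB by (intro mult_right_mono) (auto simp: \<tau>_def)
      also have "\<dots> \<le> 1" using lB by (simp add: field_simps)
      finally show ?thesis using \<tau> by simp
    qed
    have \<tau>2: "\<tau> * C \<le> \<eta> / 2"
    proof -
      have "\<tau> * C \<le> \<eta> / (2 * (C + 1)) * C" using C by (intro mult_right_mono) (auto simp: \<tau>_def)
      also have "\<dots> \<le> \<eta> / 2" using C \<eta> by (simp add: field_simps)
      finally show ?thesis .
    qed
    have shift: "trunc_moment P B (l - u) \<le> \<phi> * exp (u * x + \<tau> * (\<eta> / 2))" if u: "\<bar>u\<bar> = \<tau>" for u
    proof -
      have "u\<^sup>2 = \<tau> * \<tau>" using u by (metis power2_abs power2_eq_square)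
      then have "u\<^sup>2 * C \<le> \<tau> * (\<eta> / 2)" using \<tau>2 \<tau> by (simp add: mult_left_mono mult.assoc)
      have "trunc_moment P B (l - u) \<le> \<phi> * (1 + u\<^sup>2 * C) + u * trunc_log_moment P B l"
        unfolding \<phi>_def C_def by (rule trunc_moment_shift_le[OF B]) (use \<tau>1 u \<tau> in simp)
      also have "\<dots> = \<phi> * (1 + (u * x + u\<^sup>2 * C))"
        using mom by (simp add: x_def \<phi>_def field_simps)
      also have "\<dots> \<le> \<phi> * exp (u * x + u\<^sup>2 * C)" using \<phi> by (intro mult_left_mono exp_ge_add_one_self) auto
      also have "\<dots> \<le> \<phi> * exp (u * x + \<tau> * (\<eta> / 2))" using \<phi> \<open>u\<^sup>2 * C \<le> \<tau> * (\<eta> / 2)\<close> by simp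
      finally show ?thesis .
    qed
    have nn: "0 \<le> trunc_moment P B l'" for l' unfolding trunc_moment_def
      by (intro Bochner_Integration.integral_nonneg) auto
    have "filterlim (\<lambda>K. exp (real K * \<delta>) * (1 - 2 * exp (- (real K * (\<tau> * \<eta> / 2))))) at_top sequentially"
      using \<delta> \<tau> \<eta> by real_asymp
    \<comment> \<open>9 instead of 8 leaves room for passing from the limit to large
      \<open>v\<close>.\<close>
    then obtain K0 where K0: "\<And>K. K \<ge> K0 \<Longrightarrow> 9 \<le> exp (real K * \<delta>) * (1 - 2 * exp (- (real K * (\<tau> * \<eta> / 2))))"
      unfolding filterlim_at_top eventually_sequentially by blast
    show ?thesis
    proof (intro exI allI impI)
      fix K assume K: "K0 \<le> K"
      define a b where "a = K * (x - \<eta>)" and "b = K * (x + \<eta>)"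
      define S where "S u v = (child_sum P {1 / real B..<1} B ^^ K) (\<lambda>i. real i powr (- u)) v * real v powr u" for u v
      define \<kappa> where "\<kappa> = min (exp (\<theta> * a)) (exp (\<theta> * b))"
      define R where "R v = \<kappa> * (S \<theta> v - exp (- (b * \<tau>)) * S (\<theta> - \<tau>) v - exp (a * \<tau>) * S (\<theta> + \<tau>) v)" for v
      define r where "r = \<kappa> * (trunc_moment P B (\<theta> - 1) ^ K - exp (- (b * \<tau>)) * trunc_moment P B (\<theta> - \<tau> - 1) ^ K
          - exp (a * \<tau>) * trunc_moment P B (\<theta> + \<tau> - 1) ^ K)"
      have "R \<longlonglongrightarrow> r" unfolding R_def r_def S_def
        by (intro tendsto_intros child_sum_iter_powr[OF B])
      have \<kappa>: "exp (K * (\<theta> * x - \<bar>\<theta>\<bar> * \<eta>)) \<le> \<kappa>"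
      proof -
        have "\<theta> * x - \<bar>\<theta>\<bar> * \<eta> \<le> \<theta> * (x - \<eta>)" "\<theta> * x - \<bar>\<theta>\<bar> * \<eta> \<le> \<theta> * (x + \<eta>)"
          using \<eta> by (auto simp: algebra_simps abs_if)
        then have "real K * (\<theta> * x - \<bar>\<theta>\<bar> * \<eta>) \<le> real K * (\<theta> * (x - \<eta>))"
           "real K * (\<theta> * x - \<bar>\<theta>\<bar> * \<eta>) \<le> real K * (\<theta> * (x + \<eta>))" by (auto intro: mult_left_mono)
        then show ?thesis unfolding \<kappa>_def a_def b_def by (simp add: mult.left_commute)
      qed
      have "exp (- (b * \<tau>)) * trunc_moment P B (\<theta> - \<tau> - 1) ^ K \<le> \<phi> ^ K * exp (- (real K * (\<tau> * \<eta> / 2)))"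
      proof -
        have "trunc_moment P B (\<theta> - \<tau> - 1) ^ K \<le> (\<phi> * exp (\<tau> * x + \<tau> * (\<eta> / 2))) ^ K"
          using shift[of \<tau>] \<tau> nn by (intro power_mono) (auto simp: \<theta>_def)
        also have "\<dots> = \<phi> ^ K * exp (K * (\<tau> * x + \<tau> * (\<eta> / 2)))" by (simp add: power_mult_distrib exp_of_nat_mult)
        finally have "exp (- (b * \<tau>)) * trunc_moment P B (\<theta> - \<tau> - 1) ^ K \<le> exp (- (b * \<tau>)) * (\<phi> ^ K * exp (K * (\<tau> * x + \<tau> * (\<eta> / 2))))"
          by (intro mult_left_mono) auto
        also have "\<dots> = \<phi> ^ K * exp (- (b * \<tau>) + K * (\<tau> * x + \<tau> * (\<eta> / 2)))" by (simp only: exp_add mult_ac)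
        also have "- (b * \<tau>) + K * (\<tau> * x + \<tau> * (\<eta> / 2)) = - (real K * (\<tau> * \<eta> / 2))"
          unfolding b_def by (simp add: algebra_simps)
        finally show ?thesis .
      qed
      moreover have "exp (a * \<tau>) * trunc_moment P B (\<theta> + \<tau> - 1) ^ K \<le> \<phi> ^ K * exp (- (real K * (\<tau> * \<eta> / 2)))"
      proof -
        have "trunc_moment P B (\<theta> + \<tau> - 1) ^ K \<le> (\<phi> * exp (- \<tau> * x + \<tau> * (\<eta> / 2))) ^ K"
          using shift[of "- \<tau>"] \<tau> nn by (intro power_mono) (auto simp: \<theta>_def)
        also have "\<dots> = \<phi> ^ K * exp (K * (- \<tau> * x + \<tau> * (\<eta> / 2)))" by (simp add: power_mult_distrib exp_of_nat_mult)
        finally have "exp (a * \<tau>) * trunc_moment P B (\<theta> + \<tau> - 1) ^ K \<le> exp (a * \<tau>) * (\<phi> ^ K * exp (K * (- \<tau> * x + \<tau> * (\<eta> / 2))))"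
          by (intro mult_left_mono) auto
        also have "\<dots> = \<phi> ^ K * exp (a * \<tau> + K * (- \<tau> * x + \<tau> * (\<eta> / 2)))" by (simp only: exp_add mult_ac)
        also have "a * \<tau> + K * (- \<tau> * x + \<tau> * (\<eta> / 2)) = - (real K * (\<tau> * \<eta> / 2))"
          unfolding a_def by (simp add: algebra_simps)
        finally show ?thesis .
      qed
      ultimately have r1: "\<phi> ^ K * (1 - 2 * exp (- (real K * (\<tau> * \<eta> / 2)))) \<le> trunc_moment P B (\<theta> - 1) ^ K
          - exp (- (b * \<tau>)) * trunc_moment P B (\<theta> - \<tau> - 1) ^ K - exp (a * \<tau>) * trunc_moment P B (\<theta> + \<tau> - 1) ^ K"
        by (simp add: \<phi>_def \<theta>_def algebra_simps)
      have pos: "0 \<le> 1 - 2 * exp (- (real K * (\<tau> * \<eta> / 2)))"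
        using K0[OF K] by (smt (verit) exp_gt_zero mult_nonneg_nonpos)
      have "exp (real K * \<delta>) = exp (K * (\<theta> * x - \<bar>\<theta>\<bar> * \<eta>)) * \<phi> ^ K"
      proof -
        have "\<phi> ^ K = exp (K * ln \<phi>)" using \<phi> by (simp add: exp_of_nat_mult)
        then show ?thesis by (simp add: \<delta>_def \<gamma>_def algebra_simps flip: exp_add)
      qed
      then have "exp (real K * \<delta>) * (1 - 2 * exp (- (real K * (\<tau> * \<eta> / 2))))
        = exp (K * (\<theta> * x - \<bar>\<theta>\<bar> * \<eta>)) * (\<phi> ^ K * (1 - 2 * exp (- (real K * (\<tau> * \<eta> / 2)))))" by simp
      also have "\<dots> \<le> \<kappa> * (\<phi> ^ K * (1 - 2 * exp (- (real K * (\<tau> * \<eta> / 2)))))"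
        using \<kappa> pos \<phi> by (intro mult_right_mono) auto
      also have "\<dots> \<le> r" unfolding r_def using r1 \<kappa> by (intro mult_left_mono) (auto simp: \<kappa>_def)
      finally have "8 < r" using K0[OF K] by simp
      from order_tendstoD(1)[OF \<open>R \<longlonglongrightarrow> r\<close> this]
      show "\<forall>\<^sub>F v in sequentially. 8 \<le> (child_sum P {1 / real B..<1} B ^^ K)
          (window (v * exp (K * (x - \<eta>))) (v * exp (K * (x + \<eta>)))) v"
        using eventually_ge_at_top[of 1]
      proof eventually_elim
        case (elim v)
        then show ?case
          using child_sum_iter_window_ge[OF B _ \<tau>, of v \<theta> a b K]
          unfolding R_def \<kappa>_def S_def a_def b_def by linarith
      qed
    qed
  qed
  moreover have "0 < \<eta>0" using \<gamma> by (simp add: \<eta>0_def)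
  ultimately show ?thesis by blast
qed

end

section \<open>The constant in terms of truncated moments\<close>

context attachment_law
begin

lemma prob_UNIV [simp]: "prob UNIV = 1" using prob_space by simp

section \<open>Full moments and the exponent for the lower bound\<close>

lemma powr_moment_pos:
  assumes "integrable P (\<lambda>x. x powr l)" shows "0 < (\<integral>x. x powr l \<partial>P)"
proof -
  have "(\<integral>x. x powr l \<partial>P) \<noteq> 0"
  proof
    assume "(\<integral>x. x powr l \<partial>P) = 0"
    then have "AE x in P. x powr l = 0"
      using assms by (subst (asm) integral_nonneg_eq_0_iff_AE) auto
    with in_unit have "AE x in P. False" by eventually_elim auto
    then show False by simp
  qed
  then show ?thesis by (smt (verit) Bochner_Integration.integral_nonneg powr_ge_zero)
qed

lemma log_moment_integrable:
  assumes "integrable P (\<lambda>x. x powr l)"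
  shows "log_moment P (\<lambda>x. x) l = ereal (ln (\<integral>x. x powr l \<partial>P))"
proof -
  have "power_moment P (\<lambda>x. x) l = ennreal (\<integral>x. x powr l \<partial>P)"
    unfolding power_moment_def using assms by (intro nn_integral_eq_integral) auto
  then show ?thesis using powr_moment_pos[OF assms] by (simp add: log_moment_def)
qed

lemma log_moment_not_integrable:
  assumes "\<not> integrable P (\<lambda>x. x powr l)" shows "log_moment P (\<lambda>x. x) l = \<infinity>"
proof -
  have "\<not> power_moment P (\<lambda>x. x) l < \<infinity>"
  proof
    assume "power_moment P (\<lambda>x. x) l < \<infinity>"
    then have "integrable P (\<lambda>x. x powr l)"
      unfolding power_moment_def by (intro integrableI_nonneg) simp_all
    then show False using assms by simp
  qed
  then have "power_moment P (\<lambda>x. x) l = \<infinity>" by (metis infinity_ennreal_def top.not_eq_extremum)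
  then show ?thesis by (simp add: log_moment_def)
qed

lemma neg_log_mean_finite:
  assumes "neg_log_mean P (\<lambda>x. x) < \<infinity>"
  shows "integrable P (\<lambda>x. - ln x)" "neg_log_mean P (\<lambda>x. x) = ennreal (\<integral>x. - ln x \<partial>P)"
    "0 < (\<integral>x. - ln x \<partial>P)"
proof -
  have nn: "AE x in P. 0 \<le> - ln x" using in_unit by eventually_elim auto
  show int: "integrable P (\<lambda>x. - ln x)"
    using assms nn unfolding neg_log_mean_def by (intro integrableI_nonneg) simp_all
  show "neg_log_mean P (\<lambda>x. x) = ennreal (\<integral>x. - ln x \<partial>P)"
    unfolding neg_log_mean_def using int nn by (rule nn_integral_eq_integral)
  have "(\<integral>x. - ln x \<partial>P) \<noteq> 0"
  proof
    assume "(\<integral>x. - ln x \<partial>P) = 0"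
    then have "AE x in P. - ln x = 0" using int nn by (subst (asm) integral_nonneg_eq_0_iff_AE) auto
    with in_unit have "AE x in P. False" by eventually_elim auto
    then show False by simp
  qed
  moreover have "0 \<le> (\<integral>x. - ln x \<partial>P)" using nn by (rule integral_nonneg_AE)
  ultimately show "0 < (\<integral>x. - ln x \<partial>P)" by simp
qed

text \<open>Jensen's inequality, from the tangent of the exponential at the mean of
  \<open>- ln x\<close>.\<close>

lemma ln_powr_moment_ge:
  assumes "integrable P (\<lambda>x. - ln x)" and l: "integrable P (\<lambda>x. x powr l)"
  shows "- l * (\<integral>x. - ln x \<partial>P) \<le> ln (\<integral>x. x powr l \<partial>P)"
proof -
  define \<mu> where "\<mu> = (\<integral>x. - ln x \<partial>P)"
  have "exp (- l * \<mu>) = (\<integral>x. exp (- l * \<mu>) * (1 - l * (- ln x - \<mu>)) \<partial>P)"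
    using assms(1) by (simp add: \<mu>_def prob_space)
  also have "\<dots> \<le> (\<integral>x. x powr l \<partial>P)"
  proof (rule integral_mono_AE[OF _ l])
    show "integrable P (\<lambda>x. exp (- l * \<mu>) * (1 - l * (- ln x - \<mu>)))" using assms(1) by simp
    show "AE x in P. exp (- l * \<mu>) * (1 - l * (- ln x - \<mu>)) \<le> x powr l"
      using in_unit
    proof eventually_elim
      case (elim x)
      have "exp (- l * \<mu>) * (1 - l * (- ln x - \<mu>)) \<le> exp (- l * \<mu>) * exp (- l * (- ln x - \<mu>))"
        using exp_ge_add_one_self[of "- l * (- ln x - \<mu>)"] by (intro mult_left_mono) auto
      also have "\<dots> = x powr l" using elim by (simp add: powr_def algebra_simps flip: exp_add)
      finally show ?case .
    qed
  qed
  finally have "ln (exp (- l * \<mu>)) \<le> ln (\<integral>x. x powr l \<partial>P)"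
    by (intro ln_mono) auto
  then show ?thesis by (simp add: \<mu>_def)
qed

text \<open>A supremum above \<open>c\<close> yields some \<open>c' > c\<close> in the defining set
  and an exponent \<open>l\<close> with \<open>1 / c' < - l / c' - E\<close>. Since
  \<open>c' < 1 / \<mu>\<close>, Jensen excludes \<open>l \<ge> 0\<close>. For negative
  \<open>l\<close> the logarithm \<open>E\<close> is nonnegative, so lowering \<open>c'\<close> to
  \<open>c\<close> preserves the inequality. The conclusion is what makes \<open>n\<close> times the
  Chernoff bound for \<open>c * ln n\<close> generations vanish.\<close>

lemma neg_moment_below_alpha_min:
  assumes c: "0 \<le> c" "c < alpha_min P (\<lambda>x. x)"
  shows "\<exists>s>0. integrable P (\<lambda>x. x powr (- s)) \<and> 1 + c * ln (\<integral>x. x powr (- s) \<partial>P) < s"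
proof -
  let ?S = "{c. 0 < c \<and> ennreal c < 1 / neg_log_mean P (\<lambda>x. x) \<and> rate_Psi P (\<lambda>x. x) c > 1}"
  have "\<exists>c'\<in>{0} \<union> ?S. c < c'" using c(2) unfolding alpha_min_def by (intro less_cSupD) auto
  then obtain c' where c': "c < c'" "0 < c'" "ennreal c' < 1 / neg_log_mean P (\<lambda>x. x)" "rate_Psi P (\<lambda>x. x) c' > 1"
    using c(1) by auto
  have fin: "neg_log_mean P (\<lambda>x. x) < \<infinity>" using c'(3) by (cases "neg_log_mean P (\<lambda>x. x)") (auto simp: top_unique)
  define \<mu> where "\<mu> = (\<integral>x. - ln x \<partial>P)"
  note \<mu> = neg_log_mean_finite[OF fin, folded \<mu>_def]
  have "ennreal c' < ennreal (1 / \<mu>)" using c'(3) \<mu> by (simp add: divide_ennreal[symmetric])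
  then have c\<mu>: "\<mu> < 1 / c'" using c' \<mu>(3) by (simp add: ennreal_less_iff field_simps)
  have "ereal (1 / c') < log_moment_conj P (\<lambda>x. x) (- 1 / c')"
  proof (rule ccontr)
    assume "\<not> ?thesis"
    then have "ereal c' * log_moment_conj P (\<lambda>x. x) (- 1 / c') \<le> ereal c' * ereal (1 / c')"
      using c' by (intro ereal_mult_left_mono) auto
    then show False using c' unfolding rate_Psi_def by (simp add: one_ereal_def)
  qed
  then obtain l where l: "ereal (1 / c') < ereal (l * (- 1 / c')) - log_moment P (\<lambda>x. x) l"
    unfolding log_moment_conj_def less_SUP_iff by auto
  then have int: "integrable P (\<lambda>x. x powr l)" using log_moment_not_integrable[of l] by force
  define E where "E = ln (\<integral>x. x powr l \<partial>P)"
  have l': "1 / c' < - l / c' - E" using l log_moment_integrable[OF int] by (simp add: E_def)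
  have jens: "- l * \<mu> \<le> E" using ln_powr_moment_ge[OF \<mu>(1) int] by (simp add: E_def \<mu>_def)
  have "l < 0"
  proof (rule ccontr)
    assume "\<not> l < 0"
    then have "l * \<mu> \<le> l * (1 / c')" using c\<mu> by (intro mult_left_mono) auto
    moreover have "0 < 1 / c'" using c' by simp
    ultimately show False using jens l' by simp
  qed
  have "1 \<le> (\<integral>x. x powr l \<partial>P)"
  proof -
    have "(\<integral>x. 1 \<partial>P) \<le> (\<integral>x. x powr l \<partial>P)"
    proof (rule integral_mono_AE)
      show "AE x in P. 1 \<le> x powr l" using in_unit
      proof eventually_elim
        case (elim x)
        then show ?case using powr_mono2'[of l x 1] \<open>l < 0\<close> by simp
      qed
    qed (use int in auto)
    then show ?thesis by (simp add: prob_space)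
  qed
  then have "0 \<le> E" by (simp add: E_def)
  then have "c * E \<le> c' * E" using c' by (intro mult_right_mono) auto
  moreover have "1 + c' * E < - l" using l' c' by (simp add: field_simps)
  ultimately show ?thesis using \<open>l < 0\<close> int by (intro exI[of _ "- l"]) (auto simp: E_def)
qed

section \<open>From full to truncated moments\<close>

lemma trunc_log_moment_0:
  assumes "0 < B" shows "trunc_log_moment P B 0 = (\<integral>x. indicator {1 / real B..<1} x * (- ln x) \<partial>P)"
  unfolding trunc_log_moment_def
  by (intro Bochner_Integration.integral_cong refl) (use cell_subset_pos assms in \<open>auto simp: indicator_def\<close>)

text \<open>For speeds below the mean the tilt \<open>l = 0\<close> will do: the truncated integral
  of \<open>- ln X\<close> increases to the full one, possibly infinite, while the truncated mass
  tends to 1. The logarithm of the mass then exceeds \<open>- 1 / c\<close>, as the growth condition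
  asks.\<close>

lemma growth_above_inverse_mean:
  assumes c: "0 < c" "ennreal (1 / c) < neg_log_mean P (\<lambda>x. x)"
  shows "\<exists>B>0. 0 < trunc_moment P B 0 \<and> 1 / c < trunc_log_moment P B 0 / trunc_moment P B 0
    \<and> 0 < trunc_log_moment P B 0 / trunc_moment P B 0 + ln (trunc_moment P B 0)"
proof -
  define A where "A n = {1 / real (Suc n)..<1}" for n
  have [measurable]: "A n \<in> sets borel" for n by (simp add: A_def)
  have Asub: "A m \<subseteq> A n" if "m \<le> n" for m n
  proof -
    have "1 / real (Suc n) \<le> 1 / real (Suc m)" using that by (intro divide_left_mono) auto
    then show ?thesis by (auto simp: A_def)
  qed
  have Alim: "eventually (\<lambda>n. x \<in> A n) sequentially" if x: "0 < x" "x < 1" for x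
  proof -
    obtain n where n: "1 / real (Suc n) < x" using reals_Archimedean[OF x(1)] unfolding inverse_eq_divide by blast
    then have "x \<in> A n" using x by (auto simp: A_def)
    then show ?thesis using Asub by (intro eventually_sequentiallyI[of n]) auto
  qed
  have tm: "trunc_moment P (Suc n) 0 = prob (A n)" for n
  proof -
    have "trunc_moment P (Suc n) 0 = (\<integral>x. indicator (A n) x \<partial>P)"
      unfolding trunc_moment_def A_def
      by (intro Bochner_Integration.integral_cong refl) (use cell_subset_pos[of "Suc n"] in \<open>auto simp: indicator_def\<close>)
    then show ?thesis by simp
  qed
  have tm_lim: "(\<lambda>n. trunc_moment P (Suc n) 0) \<longlonglongrightarrow> 1"
  proof -
    have "(\<lambda>n. \<integral>x. indicator (A n) x \<partial>P) \<longlonglongrightarrow> (\<integral>x. (1::real) \<partial>P)"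
    proof (rule integral_dominated_convergence[where w = "\<lambda>x. 1"])
      show "AE x in P. (\<lambda>n. indicator (A n) x :: real) \<longlonglongrightarrow> 1" using in_unit
      proof eventually_elim
        case (elim x)
        then have "eventually (\<lambda>n. indicator (A n) x = (1::real)) sequentially"
          using Alim[of x] by (auto elim!: eventually_mono simp: indicator_def)
        then show ?case by (rule tendsto_eventually)
      qed
    qed (auto simp: indicator_def)
    then show ?thesis by (simp add: tm prob_space)
  qed
  have tlm: "ennreal (trunc_log_moment P (Suc n) 0) = (\<integral>\<^sup>+x. ennreal (indicator (A n) x * (- ln x)) \<partial>P)" for n
  proof -
    have "integrable P (\<lambda>x. indicator (A n) x * (- ln x))"
      unfolding A_def by (rule integrable_cell[where C = "ln (real (Suc n))"]) (use ln_cell[of "Suc n"] in force)+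
    moreover have "AE x in P. 0 \<le> indicator (A n) x * (- ln x)"
      using ln_cell(1)[of "Suc n"] by (intro AE_I2) (auto simp: indicator_def A_def less_imp_le)
    ultimately show ?thesis unfolding trunc_log_moment_0[OF zero_less_Suc] A_def
      by (intro nn_integral_eq_integral[symmetric]) auto
  qed
  have "neg_log_mean P (\<lambda>x. x) = (SUP n. \<integral>\<^sup>+x. ennreal (indicator (A n) x * (- ln x)) \<partial>P)"
  proof -
    have "neg_log_mean P (\<lambda>x. x) = (\<integral>\<^sup>+x. (SUP n. ennreal (indicator (A n) x * (- ln x))) \<partial>P)"
      unfolding neg_log_mean_def
    proof (rule nn_integral_cong_AE)
      show "AE x in P. ennreal (- ln x) = (SUP n. ennreal (indicator (A n) x * (- ln x)))" using in_unit
      proof eventually_elim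
        case (elim x)
        obtain n where "x \<in> A n" using Alim elim by (meson eventually_sequentially order_refl)
        then show ?case
          by (intro antisym SUP_least) (auto simp: indicator_def intro!: SUP_upper2[of n])
      qed
    qed
    also have "\<dots> = (SUP n. \<integral>\<^sup>+x. ennreal (indicator (A n) x * (- ln x)) \<partial>P)"
    proof (rule nn_integral_monotone_convergence_SUP)
      show "incseq (\<lambda>n x. ennreal (indicator (A n) x * - ln x))"
      proof (intro incseq_SucI le_funI ennreal_leI)
        fix n x
        show "indicator (A n) x * (- ln x) \<le> indicator (A (Suc n)) x * (- ln x)"
          using Asub[of n "Suc n"] ln_cell(1)[of "Suc (Suc n)" x] by (auto simp: indicator_def A_def)
      qed
    qed measurable
    finally show ?thesis .
  qed
  then have "\<exists>n. ennreal (1 / c) < ennreal (trunc_log_moment P (Suc n) 0)"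
    using c(2) unfolding tlm by (simp only: less_SUP_iff) blast
  then obtain n0 where n0: "ennreal (1 / c) < ennreal (trunc_log_moment P (Suc n0) 0)" by blast
  have inc: "trunc_log_moment P (Suc n0) 0 \<le> trunc_log_moment P (Suc n) 0" if "n0 \<le> n" for n
  proof -
    have "ennreal (trunc_log_moment P (Suc n0) 0) \<le> ennreal (trunc_log_moment P (Suc n) 0)"
      unfolding tlm
    proof (intro nn_integral_mono ennreal_leI)
      fix x show "indicator (A n0) x * (- ln x) \<le> indicator (A n) x * (- ln x)"
        using Asub[OF that] ln_cell(1)[of "Suc n" x] by (auto simp: indicator_def A_def)
    qed
    moreover have "0 < trunc_log_moment P (Suc n0) 0" using n0 c
      by (metis ennreal_neg linorder_not_less not_less_zero)
    ultimately show ?thesis by (subst (asm) ennreal_le_iff2) auto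
  qed
  have "(\<lambda>n. ln (trunc_moment P (Suc n) 0)) \<longlonglongrightarrow> ln 1" using tm_lim by (intro tendsto_ln) auto
  then have "\<forall>\<^sub>F n in sequentially. - (1 / c) < ln (trunc_moment P (Suc n) 0)"
    using c by (intro order_tendstoD) auto
  moreover have "\<forall>\<^sub>F n in sequentially. 0 < trunc_moment P (Suc n) 0" using tm_lim by (intro order_tendstoD) auto
  ultimately have "\<forall>\<^sub>F n in sequentially. - (1 / c) < ln (trunc_moment P (Suc n) 0) \<and> 0 < trunc_moment P (Suc n) 0 \<and> n0 \<le> n"
    using eventually_ge_at_top[of n0] by eventually_elim auto
  then obtain n where n: "- (1 / c) < ln (trunc_moment P (Suc n) 0)" "0 < trunc_moment P (Suc n) 0" "n0 \<le> n"
    by (auto simp: eventually_sequentially)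
  have lt: "1 / c < trunc_log_moment P (Suc n) 0" using n0 inc[OF n(3)] c by (auto simp: ennreal_less_iff)
  \<comment> \<open>The mass is at most 1, so normalizing can only increase the mean.\<close>
  also have "trunc_log_moment P (Suc n) 0 \<le> trunc_log_moment P (Suc n) 0 / trunc_moment P (Suc n) 0"
  proof -
    have "trunc_moment P (Suc n) 0 \<le> 1" by (simp add: tm)
    moreover have "0 < trunc_log_moment P (Suc n) 0" using less_trans[OF _ lt, of 0] c by simp
    ultimately show ?thesis using n(2) by (simp add: le_divide_eq mult_left_le)
  qed
  finally show ?thesis using n by (intro exI[of _ "Suc n"]) auto
qed

lemma continuous_trunc_moments:
  assumes B: "0 < B"
  shows "continuous_on S (trunc_moment P B)" "continuous_on S (trunc_log_moment P B)"
proof -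
  have lim: "(\<lambda>n. \<integral>x. indicator {1 / real B..<1} x * (x powr u n * w x) \<partial>P)
      \<longlonglongrightarrow> (\<integral>x. indicator {1 / real B..<1} x * (x powr l * w x) \<partial>P)"
    if u: "u \<longlonglongrightarrow> l" and [measurable]: "w \<in> borel_measurable borel"
      and w: "\<And>x. x \<in> {1 / real B..<1} \<Longrightarrow> \<bar>w x\<bar> \<le> C" for u l w and C :: real
  proof -
    obtain R where R: "\<And>n. \<bar>u n\<bar> \<le> R" using convergent_imp_Bseq[OF convergentI[OF u]]
      by (auto simp: Bseq_def)
    have C: "0 \<le> \<bar>C\<bar>" by simp
    show ?thesis
    proof (rule integral_dominated_convergence[where w = "\<lambda>x. real B powr R * \<bar>C\<bar>"])
      show "AE x in P. (\<lambda>n. indicator {1 / real B..<1} x * (x powr u n * w x))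
        \<longlonglongrightarrow> indicator {1 / real B..<1} x * (x powr l * w x)" using in_unit
        by eventually_elim (intro tendsto_intros u, simp)
      show "AE x in P. norm (indicator {1 / real B..<1} x * (x powr u n * w x)) \<le> real B powr R * \<bar>C\<bar>" for n
      proof (rule AE_I2)
        fix x
        show "norm (indicator {1 / real B..<1} x * (x powr u n * w x)) \<le> real B powr R * \<bar>C\<bar>"
        proof (cases "x \<in> {1 / real B..<1}")
          case True
          have "x powr u n \<le> real B powr \<bar>u n\<bar>" by (rule powr_le_cell[OF B True])
          also have "\<dots> \<le> real B powr R" using R B by (intro powr_mono) auto
          finally have "x powr u n * \<bar>w x\<bar> \<le> real B powr R * \<bar>C\<bar>"
            using w[OF True] by (intro mult_mono) auto
          then show ?thesis using True by (simp add: abs_mult)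
        qed simp
      qed
    qed simp_all
  qed
  show "continuous_on S (trunc_moment P B)"
    unfolding continuous_on_sequentially o_def trunc_moment_def
    using lim[of _ _ "\<lambda>x. 1" 1] by simp
  have "\<bar>- ln x\<bar> \<le> ln B" if "x \<in> {1 / real B..<1}" for x using ln_cell[OF B that] by simp
  then show "continuous_on S (trunc_log_moment P B)"
    unfolding continuous_on_sequentially o_def trunc_log_moment_def
    using lim[of _ _ "\<lambda>x. - ln x" "ln B"] by simp
qed

text \<open>By contradiction and compactness. For large \<open>B\<close> some tilt gives the
  truncated mean \<open>z\<close>, as the law charges both sides of \<open>z\<close>. If all these
  tilts fail the growth condition, they stay bounded, and Fatou's lemma at a limit point
  \<open>l\<close> gives \<open>- l * z - E \<ge> z\<close> for the full moment, \<open>E\<close>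
  being its logarithm. But \<open>y \<mapsto> - l * y - E\<close> is affine, at most 0 at
  \<open>\<mu>\<close> by Jensen and at most \<open>z'\<close> at \<open>z'\<close>, hence below
  \<open>z\<close> at \<open>z\<close>. Tilts are sought for truncated laws because the full law may
  admit none with mean \<open>z\<close>.\<close>

lemma growth_below_inverse_mean:
  assumes fin: "neg_log_mean P (\<lambda>x. x) < \<infinity>"
    and z: "(\<integral>x. - ln x \<partial>P) < z" "z < z'"
    and conj_le: "\<And>l. integrable P (\<lambda>x. x powr l) \<Longrightarrow> - l * z' - ln (\<integral>x. x powr l \<partial>P) \<le> z'"
  shows "\<exists>B>0. \<exists>l. 0 < trunc_moment P B l \<and> trunc_log_moment P B l = z * trunc_moment P B l
    \<and> 0 < (l + 1) * z + ln (trunc_moment P B l)"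
proof (rule ccontr)
  assume no: "\<not> ?thesis"
  define \<mu> where "\<mu> = (\<integral>x. - ln x \<partial>P)"
  note \<mu> = neg_log_mean_finite[OF fin, folded \<mu>_def]
  have z\<mu>: "\<mu> < z" and z0: "0 < z" using z \<mu> by (simp_all add: \<mu>_def)
  \<comment> \<open>Attachments with \<open>- ln x\<close> away from \<open>z\<close> by a fixed
    margin, on either side; the margin makes their contribution grow exponentially in the
    tilt.\<close>
  define U where "U n = {x. 1 / real (Suc n) \<le> x \<and> x < 1 \<and> - ln x \<le> z - 1 / real (Suc n)}" for n
  define V where "V n = {x. 1 / real (Suc n) \<le> x \<and> x < 1 \<and> z + 1 / real (Suc n) \<le> - ln x}" for n
  have [measurable]: "U n \<in> sets borel" "V n \<in> sets borel" for n unfolding U_def V_def by measurable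
  have small: "\<exists>n. 1 / real (Suc n) \<le> a \<and> 1 / real (Suc n) \<le> b" if ab: "0 < a" "0 < b" for a b
  proof -
    obtain n where "inverse (real (Suc n)) < min a b" using reals_Archimedean[of "min a b"] ab by auto
    then show ?thesis by (intro exI[of _ n]) (simp add: inverse_eq_divide)
  qed
  have "\<exists>n. 0 < prob (U n)"
  proof (rule ccontr)
    assume "\<not> ?thesis"
    then have "prob (U n) = 0" for n using measure_nonneg[of P "U n"] by (metis less_eq_real_def)
    then have "AE x in P. x \<notin> U n" for n by (subst (asm) prob_eq_0) auto
    then have "AE x in P. \<forall>n. x \<notin> U n" by (simp add: AE_all_countable)
    then have "AE x in P. z \<le> - ln x" using in_unit
    proof eventually_elim
      case (elim x)
      show ?case
      proof (rule ccontr)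
        assume "\<not> z \<le> - ln x"
        with small[of x "z + ln x"] elim obtain n where "1 / real (Suc n) \<le> x" "1 / real (Suc n) \<le> z + ln x" by auto
        then have "x \<in> U n" using elim(2) by (simp add: U_def)
        then show False using elim(1) by blast
      qed
    qed
    then have "(\<integral>x. z \<partial>P) \<le> \<mu>" unfolding \<mu>_def using \<mu>(1) by (intro integral_mono_AE) auto
    then show False using z\<mu> by simp
  qed
  then obtain n1 where n1: "0 < prob (U n1)" by blast
  have "\<exists>n. 0 < prob (V n)"
  proof (rule ccontr)
    assume "\<not> ?thesis"
    then have "prob (V n) = 0" for n using measure_nonneg[of P "V n"] by (metis less_eq_real_def)
    then have "AE x in P. x \<notin> V n" for n by (subst (asm) prob_eq_0) auto
    then have "AE x in P. \<forall>n. x \<notin> V n" by (simp add: AE_all_countable)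
    then have le: "AE x in P. - ln x \<le> z" using in_unit
    proof eventually_elim
      case (elim x)
      show ?case
      proof (rule ccontr)
        assume "\<not> - ln x \<le> z"
        with small[of x "- ln x - z"] elim obtain n where "1 / real (Suc n) \<le> x" "1 / real (Suc n) \<le> - ln x - z" by auto
        then have "x \<in> V n" using elim(2) by (simp add: V_def)
        then show False using elim(1) by blast
      qed
    qed
    \<comment> \<open>If \<open>- ln X \<le> z\<close> almost surely, the exponent
      \<open>- m\<close> makes the conjugate at \<open>- z'\<close> at least
      \<open>m * (z' - z)\<close>, which exceeds \<open>z'\<close> for this
      \<open>m\<close>.\<close>
    obtain m :: nat where m: "z' / (z' - z) < m" using reals_Archimedean2 by blast
    have b: "AE x in P. x powr (- real m) \<le> exp (m * z)" using le in_unit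
    proof eventually_elim
      case (elim x)
      then have "real m * - ln x \<le> real m * z" by (intro mult_left_mono) auto
      then show ?case using elim by (simp add: powr_def)
    qed
    have int: "integrable P (\<lambda>x. x powr (- real m))"
    proof (rule integrable_const_bound)
      show "AE x in P. norm (x powr (- real m)) \<le> exp (m * z)" using b by eventually_elim simp
    qed simp
    have "(\<integral>x. x powr (- real m) \<partial>P) \<le> (\<integral>x. exp (m * z) \<partial>P)"
      using b int by (intro integral_mono_AE) auto
    then have "ln (\<integral>x. x powr (- real m) \<partial>P) \<le> ln (exp (m * z))"
      using powr_moment_pos[OF int] by (intro ln_mono) auto
    then have "m * z' - m * z \<le> z'" using conj_le[OF int] by simp
    moreover have "z' < m * (z' - z)" using m z by (simp add: field_simps)
    ultimately show False by (simp add: algebra_simps)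
  qed
  then obtain n2 where n2: "0 < prob (V n2)" by blast
  define p1 p2 e1 e2 where "p1 = prob (U n1)" and "p2 = prob (V n2)"
    and "e1 = 1 / real (Suc n1)" and "e2 = 1 / real (Suc n2)"
  have p: "0 < p1" "p1 \<le> 1" "0 < p2" "p2 \<le> 1" "0 < e1" "0 < e2" using n1 n2 by (auto simp: p1_def p2_def e1_def e2_def)
  define B0 where "B0 = Suc (max n1 n2)"
  have root: "\<exists>l. trunc_log_moment P B l = z * trunc_moment P B l" 
    and lower: "\<And>l. 0 \<le> l \<Longrightarrow> exp (l * e1) * p1 \<le> exp (l * z) * trunc_moment P B l"
      "\<And>l. l \<le> 0 \<Longrightarrow> exp (- l * e2) * p2 \<le> exp (l * z) * trunc_moment P B l" if BB: "B0 \<le> B" for B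
  proof -
    have B: "0 < B" using BB by (simp add: B0_def)
    define A where "A = {1 / real B..<1}"
    have [measurable]: "A \<in> sets borel" by (simp add: A_def)
    have "1 / real B \<le> 1 / real (Suc n1)" "1 / real B \<le> 1 / real (Suc n2)"
      using BB by (auto simp: B0_def intro!: divide_left_mono)
    then have sub: "U n1 \<subseteq> A" "V n2 \<subseteq> A" by (auto simp: U_def V_def A_def)
    have tilt: "exp (l * z) * x powr l = exp (- l * (- ln x - z))" if "x \<in> A" for x l
      using cell_subset_pos[OF B] that by (auto simp: A_def powr_def algebra_simps simp flip: exp_add)
    have iU: "integrable P (indicator (U n1) :: real \<Rightarrow> real)" "integrable P (indicator (V n2) :: real \<Rightarrow> real)"
      by (auto intro!: integrable_real_indicator simp: emeasure_eq_measure)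
    have G: "exp (l * z) * trunc_moment P B l = (\<integral>x. exp (l * z) * (indicator A x * x powr l) \<partial>P)" for l
      by (simp add: trunc_moment_def A_def)
    have Gint: "integrable P (\<lambda>x. exp (l * z) * (indicator A x * x powr l))" for l
      unfolding A_def by (intro integrable_mult_right integrable_trunc_moment[OF B])
    show "exp (l * e1) * p1 \<le> exp (l * z) * trunc_moment P B l" if "0 \<le> l" for l
    proof -
      have "exp (l * e1) * p1 = (\<integral>x. exp (l * e1) * indicator (U n1) x \<partial>P)" by (simp add: p1_def)
      also have "\<dots> \<le> exp (l * z) * trunc_moment P B l" unfolding G
      proof (intro integral_mono Gint integrable_mult_right iU)
        fix x show "exp (l * e1) * indicator (U n1) x \<le> exp (l * z) * (indicator A x * x powr l)"
        proof (cases "x \<in> U n1")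
          case True
          have "e1 \<le> z + ln x" using True by (simp add: U_def e1_def)
          then have "l * e1 \<le> l * (z + ln x)" using that by (rule mult_left_mono)
          then have "exp (l * e1) \<le> exp (- l * (- ln x - z))" by (simp add: algebra_simps)
          then show ?thesis using True sub tilt[of x l] by (auto simp: indicator_def)
        qed simp
      qed
      finally show ?thesis .
    qed
    show "exp (- l * e2) * p2 \<le> exp (l * z) * trunc_moment P B l" if "l \<le> 0" for l
    proof -
      have "exp (- l * e2) * p2 = (\<integral>x. exp (- l * e2) * indicator (V n2) x \<partial>P)" by (simp add: p2_def)
      also have "\<dots> \<le> exp (l * z) * trunc_moment P B l" unfolding G
      proof (intro integral_mono Gint integrable_mult_right iU)
        fix x show "exp (- l * e2) * indicator (V n2) x \<le> exp (l * z) * (indicator A x * x powr l)"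
        proof (cases "x \<in> V n2")
          case True
          have "e2 \<le> - ln x - z" using True by (simp add: V_def e2_def)
          then have "- l * e2 \<le> - l * (- ln x - z)" using that by (intro mult_left_mono) auto
          then have "exp (- l * e2) \<le> exp (- l * (- ln x - z))" by simp
          then show ?thesis using True sub tilt[of x l] by (auto simp: indicator_def)
        qed simp
      qed
      finally show ?thesis .
    qed
    \<comment> \<open>\<open>D l\<close> has the sign of the tilted mean minus \<open>z\<close>.
      Multiplied by \<open>exp (l * z)\<close> its integrand on the cell is
      \<open>exp (- l * (y - z)) * (y - z)\<close> with \<open>y = - ln x\<close>: large positive
      \<open>l\<close> favours \<open>y < z\<close>, large negative \<open>l\<close> favours
      \<open>y > z\<close>, and the intermediate value theorem gives a root.\<close>
    define D where "D l = trunc_log_moment P B l - z * trunc_moment P B l" for l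
    define I where "I l x = exp (l * z) * (indicator A x * (x powr l * (- ln x))) - z * (exp (l * z) * (indicator A x * x powr l))" for l x
    have Iint: "integrable P (I l)" for l unfolding I_def A_def
      by (intro Bochner_Integration.integrable_diff integrable_mult_right integrable_trunc_moment[OF B] integrable_trunc_log_moment[OF B])
    have Ieq: "exp (l * z) * D l = (\<integral>x. I l x \<partial>P)" for l
    proof -
      have "(\<integral>x. I l x \<partial>P) = (\<integral>x. exp (l * z) * (indicator A x * (x powr l * (- ln x))) \<partial>P)
          - (\<integral>x. z * (exp (l * z) * (indicator A x * x powr l)) \<partial>P)"
        unfolding I_def A_def
        by (rule Bochner_Integration.integral_diff[OF integrable_mult_right[OF integrable_trunc_log_moment[OF B]]
          integrable_mult_right[OF integrable_mult_right[OF integrable_trunc_moment[OF B]]]])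
      also have "\<dots> = exp (l * z) * trunc_log_moment P B l - z * (exp (l * z) * trunc_moment P B l)"
        by (simp only: integral_mult_right_zero trunc_log_moment_def trunc_moment_def A_def)
      finally show ?thesis by (simp add: D_def algebra_simps)
    qed
    have Ix: "I l x = (if x \<in> A then exp (- l * (- ln x - z)) * (- ln x - z) else 0)" for l x
      using tilt[of x l] by (auto simp: I_def algebra_simps)
    have lB: "0 \<le> ln B" using B by simp
    have up: "exp (l * z) * D l \<le> ln B - e1 * exp (l * e1) * p1" if l: "0 \<le> l" for l
    proof -
      have "exp (l * z) * D l \<le> (\<integral>x. ln B - e1 * exp (l * e1) * indicator (U n1) x \<partial>P)" unfolding Ieq
      proof (intro integral_mono Iint Bochner_Integration.integrable_diff integrable_const integrable_mult_right iU)
        fix x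
        show "I l x \<le> ln B - e1 * exp (l * e1) * indicator (U n1) x"
        proof (cases "x \<in> U n1")
          case True
          have e: "e1 \<le> z + ln x" using True by (simp add: U_def e1_def)
          then have "l * e1 \<le> l * (z + ln x)" using l by (rule mult_left_mono)
          then have "exp (l * e1) \<le> exp (- l * (- ln x - z))" by (simp add: algebra_simps)
          then have "e1 * exp (l * e1) \<le> (z + ln x) * exp (- l * (- ln x - z))" using e p by (intro mult_mono) auto
          then show ?thesis using True sub lB by (auto simp: Ix algebra_simps)
        next
          case False
          have "I l x \<le> ln B"
          proof (cases "x \<in> A \<and> z \<le> - ln x")
            case True
            then have "exp (- l * (- ln x - z)) \<le> 1" using l by (simp add: mult_nonneg_nonneg)
            then have "exp (- l * (- ln x - z)) * (- ln x - z) \<le> 1 * (- ln x - z)" using True by (intro mult_right_mono) auto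
            also have "\<dots> \<le> ln B" using ln_cell(2)[OF B, of x] True z0 by (simp add: A_def)
            finally show ?thesis using True by (simp add: Ix)
          next
            case False
            then have "x \<in> A \<Longrightarrow> exp (- l * (- ln x - z)) * (- ln x - z) \<le> 0" by (intro mult_nonneg_nonpos) auto
            then show ?thesis using lB by (auto simp: Ix)
          qed
          then show ?thesis using False by simp
        qed
      qed
      then show ?thesis using iU by (simp add: p1_def)
    qed
    have dn: "- z + e2 * exp (- l * e2) * p2 \<le> exp (l * z) * D l" if l: "l \<le> 0" for l
    proof -
      have "(\<integral>x. - z + e2 * exp (- l * e2) * indicator (V n2) x \<partial>P) \<le> exp (l * z) * D l" unfolding Ieq
      proof (intro integral_mono Iint Bochner_Integration.integrable_add integrable_const integrable_mult_right iU)
        fix x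
        show "- z + e2 * exp (- l * e2) * indicator (V n2) x \<le> I l x"
        proof (cases "x \<in> V n2")
          case True
          have e: "e2 \<le> - ln x - z" using True by (simp add: V_def e2_def)
          then have "- l * e2 \<le> - l * (- ln x - z)" using l by (intro mult_left_mono) auto
          then have "exp (- l * e2) \<le> exp (- l * (- ln x - z))" by simp
          then have "exp (- l * e2) * e2 \<le> exp (- l * (- ln x - z)) * (- ln x - z)" using e p by (intro mult_mono) auto
          then show ?thesis using True sub z0 by (auto simp: Ix mult.commute)
        next
          case False
          have "- z \<le> I l x"
          proof (cases "x \<in> A \<and> - ln x \<le> z")
            case True
            then have "- l * (- ln x - z) \<le> 0" using l by (intro mult_nonneg_nonpos) auto
            then have "exp (- l * (- ln x - z)) \<le> 1" by simp
            then have "exp (- l * (- ln x - z)) * (z + ln x) \<le> 1 * (z + ln x)" using True by (intro mult_right_mono) auto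
            also have "\<dots> \<le> z" using ln_cell(1)[OF B, of x] True by (simp add: A_def)
            finally show ?thesis using True by (simp add: Ix algebra_simps)
          next
            case False
            then have "x \<in> A \<Longrightarrow> 0 \<le> exp (- l * (- ln x - z)) * (- ln x - z)" by (intro mult_nonneg_nonneg) auto
            then show ?thesis using z0 by (auto simp: Ix)
          qed
          then show ?thesis using False by simp
        qed
      qed
      then show ?thesis using iU by (simp add: p2_def)
    qed
    have big: "\<exists>l\<ge>0. c < e * exp (l * e) * p" if "0 < e" "0 < p" for c e p :: real
    proof -
      have "filterlim (\<lambda>l. e * exp (l * e) * p) at_top at_top" using that by real_asymp
      then have "\<forall>\<^sub>F l in at_top. c < e * exp (l * e) * p \<and> 0 \<le> l"
        by (intro eventually_conj eventually_ge_at_top) (auto simp: filterlim_at_top_dense)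
      then show ?thesis using eventually_happens'[OF trivial_limit_at_top_linorder] by blast
    qed
    obtain l1 where l1: "0 \<le> l1" "ln B < e1 * exp (l1 * e1) * p1" using big[of e1 p1] p by blast
    obtain l2 where l2: "0 \<le> l2" "z < e2 * exp (l2 * e2) * p2" using big[of e2 p2] p by blast
    have "exp (l1 * z) * D l1 < 0" using up[of l1] l1 by simp
    then have D1: "D l1 < 0" by (simp add: mult_less_0_iff)
    have "0 < exp (- l2 * z) * D (- l2)" using dn[of "- l2"] l2 by simp
    then have D2: "0 < D (- l2)" by (simp add: zero_less_mult_iff)
    have cont: "continuous_on {- l2..l1} D" unfolding D_def by (intro continuous_intros continuous_trunc_moments[OF B])
    obtain l where "D l = 0" using IVT2'[of D l1 0 "- l2"] D1 D2 l1 l2 cont by auto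
    then show "\<exists>l. trunc_log_moment P B l = z * trunc_moment P B l" by (auto simp: D_def)
  qed
  have "\<forall>n. \<exists>l. trunc_log_moment P (B0 + n) l = z * trunc_moment P (B0 + n) l" using root by simp
  then obtain L where L: "\<And>n. trunc_log_moment P (B0 + n) (L n) = z * trunc_moment P (B0 + n) (L n)" by metis
  have tm_pos: "0 < trunc_moment P (B0 + n) l" for n l
  proof -
    have "0 < exp (l * z) * trunc_moment P (B0 + n) l"
    proof (cases "0 \<le> l")
      case True
      have "0 < exp (l * e1) * p1" using p by simp
      also have "\<dots> \<le> exp (l * z) * trunc_moment P (B0 + n) l" using True by (intro lower) simp_all
      finally show ?thesis .
    next
      case False
      have "0 < exp (- l * e2) * p2" using p by simp
      also have "\<dots> \<le> exp (l * z) * trunc_moment P (B0 + n) l" using False by (intro lower) simp_all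
      finally show ?thesis .
    qed
    then show ?thesis by (simp add: zero_less_mult_iff)
  qed
  have gr: "(L n + 1) * z + ln (trunc_moment P (B0 + n) (L n)) \<le> 0" for n
  proof (rule ccontr)
    assume "\<not> ?thesis"
    then have "0 < B0 + n \<and> (0 < trunc_moment P (B0 + n) (L n) \<and> trunc_log_moment P (B0 + n) (L n) = z * trunc_moment P (B0 + n) (L n)
      \<and> 0 < (L n + 1) * z + ln (trunc_moment P (B0 + n) (L n)))"
      using L[of n] tm_pos[of n "L n"] by (simp add: B0_def)
    then show False using no by blast
  qed
  have tm_le: "trunc_moment P (B0 + n) (L n) \<le> exp (- (L n + 1) * z)" for n
  proof -
    have "ln (trunc_moment P (B0 + n) (L n)) \<le> - (L n + 1) * z"
      using gr[of n] by (simp only: mult_minus_left)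
    then have "exp (ln (trunc_moment P (B0 + n) (L n))) \<le> exp (- (L n + 1) * z)"
      by (simp only: exp_le_cancel_iff)
    then show ?thesis using tm_pos[of n "L n"] by simp
  qed
  \<comment> \<open>Failure of growth caps the quantity that \<open>lower\<close> bounds from below
    by an exponential in \<open>\<bar>l\<bar>\<close>; so the tilts \<open>L n\<close> stay in a
    compact interval.\<close>
  have le1: "exp (L n * z) * trunc_moment P (B0 + n) (L n) \<le> 1" for n
  proof -
    have "exp (L n * z) * trunc_moment P (B0 + n) (L n) \<le> exp (L n * z) * exp (- (L n + 1) * z)"
      using tm_le by (intro mult_left_mono) auto
    also have "\<dots> = exp (- z)" by (simp add: algebra_simps flip: exp_add)
    also have "\<dots> \<le> 1" using z0 by simp
    finally show ?thesis .
  qed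
  have small_exp: "a \<le> - ln q / e" if "exp (a * e) * q \<le> 1" "0 < q" "0 < e" for a q e :: real
  proof -
    have "exp (a * e) \<le> 1 / q" using that by (simp add: field_simps)
    then have "a * e \<le> ln (1 / q)" using that by (subst ln_ge_iff) auto
    then show ?thesis using that by (simp add: ln_div field_simps)
  qed
  define R where "R = - ln p1 / e1 + - ln p2 / e2"
  have "L n \<in> {- R..R}" for n
  proof -
    have nn: "0 \<le> - ln p1 / e1" "0 \<le> - ln p2 / e2" using p by (simp_all add: divide_le_0_iff)
    show ?thesis
    proof (cases "0 \<le> L n")
      case True
      have "exp (L n * e1) * p1 \<le> 1" using lower(1)[of "B0 + n" "L n"] True le1[of n] by simp
      from small_exp[OF this] p True nn show ?thesis by (simp add: R_def)
    next
      case False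
      have "exp (- L n * e2) * p2 \<le> 1" using lower(2)[of "B0 + n" "L n"] False le1[of n] by simp
      from small_exp[OF this] p False nn show ?thesis by (simp add: R_def)
    qed
  qed
  then obtain l r where r: "strict_mono r" "(L \<circ> r) \<longlonglongrightarrow> l"
    using compact_Icc[of "- R" R] unfolding compact_def by metis
  \<comment> \<open>For Fatou's lemma: the truncation levels \<open>B0 + r k\<close> tend to
    infinity, so \<open>u k\<close> converges on the open unit interval to the full power
    \<open>x powr l\<close>.\<close>
  define u where "u k x = ennreal (indicator {1 / real (B0 + r k)..<1} x * x powr L (r k))" for k x
  have [measurable]: "u k \<in> borel_measurable P" for k unfolding u_def by measurable
  have "(\<integral>\<^sup>+x. ennreal (x powr l) \<partial>P) = (\<integral>\<^sup>+x. liminf (\<lambda>k. u k x) \<partial>P)"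
  proof (rule nn_integral_cong_AE)
    show "AE x in P. ennreal (x powr l) = liminf (\<lambda>k. u k x)" using in_unit
    proof eventually_elim
      case (elim x)
      obtain n where n: "inverse (real (Suc n)) < x" using reals_Archimedean[of x] elim by auto
      have "\<forall>\<^sub>F k in sequentially. ennreal (x powr L (r k)) = u k x"
      proof (rule eventually_sequentiallyI[of "Suc n"])
        fix k assume "Suc n \<le> k"
        then have "Suc n \<le> B0 + r k" using seq_suble[OF r(1), of k] by linarith
        then have "1 / real (B0 + r k) \<le> 1 / real (Suc n)" by (intro divide_left_mono) auto
        then show "ennreal (x powr L (r k)) = u k x" using n elim by (simp add: u_def inverse_eq_divide)
      qed
      moreover have "(\<lambda>k. ennreal (x powr L (r k))) \<longlonglongrightarrow> ennreal (x powr l)"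
        using r(2) elim unfolding o_def by (intro tendsto_ennrealI tendsto_powr tendsto_const) auto
      ultimately have "(\<lambda>k. u k x) \<longlonglongrightarrow> ennreal (x powr l)" by (rule Lim_transform_eventually[rotated])
      then show ?case by (intro lim_imp_Liminf[symmetric]) auto
    qed
  qed
  also have "\<dots> \<le> liminf (\<lambda>k. \<integral>\<^sup>+x. u k x \<partial>P)" by (rule nn_integral_liminf) simp
  also have "\<dots> \<le> liminf (\<lambda>k. ennreal (exp (- (L (r k) + 1) * z)))"
  proof (intro Liminf_mono always_eventually allI)
    fix k
    have "(\<integral>\<^sup>+x. u k x \<partial>P) = ennreal (trunc_moment P (B0 + r k) (L (r k)))"
      unfolding u_def trunc_moment_def
      by (intro nn_integral_eq_integral integrable_trunc_moment) (auto simp: B0_def)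
    then show "(\<integral>\<^sup>+x. u k x \<partial>P) \<le> ennreal (exp (- (L (r k) + 1) * z))" using tm_le by (simp add: ennreal_leI)
  qed
  also have "\<dots> = ennreal (exp (- (l + 1) * z))"
    using r(2) unfolding o_def by (intro lim_imp_Liminf tendsto_ennrealI tendsto_intros) auto
  finally have nn_le: "(\<integral>\<^sup>+x. ennreal (x powr l) \<partial>P) \<le> ennreal (exp (- (l + 1) * z))" .
  have int: "integrable P (\<lambda>x. x powr l)"
    using le_less_trans[OF nn_le ennreal_less_top] by (intro integrableI_nonneg) simp_all
  have "ennreal (\<integral>x. x powr l \<partial>P) \<le> ennreal (exp (- (l + 1) * z))"
    using nn_le nn_integral_eq_integral[OF int] by simp
  then have "(\<integral>x. x powr l \<partial>P) \<le> exp (- (l + 1) * z)" by simp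
  then have "ln (\<integral>x. x powr l \<partial>P) \<le> - (l + 1) * z"
    using powr_moment_pos[OF int] by (subst (asm) ln_le_cancel_iff[symmetric]) auto
  moreover have "- l * \<mu> \<le> ln (\<integral>x. x powr l \<partial>P)" using ln_powr_moment_ge[OF \<mu>(1) int] by (simp add: \<mu>_def)
  moreover have "- l * z' - ln (\<integral>x. x powr l \<partial>P) \<le> z'" using conj_le[OF int] .
  moreover define E where "E = ln (\<integral>x. x powr l \<partial>P)"
  ultimately have E: "E \<le> - (l + 1) * z" "- l * \<mu> - E \<le> 0" "- l * z' - E \<le> z'" by simp_all
  define t where "t = (z - \<mu>) / (z' - \<mu>)"
  have t: "0 \<le> t" "t < 1" "z = t * z' + (1 - t) * \<mu>"
  proof -
    have d: "0 < z' - \<mu>" using z\<mu> z by simp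
    show "0 \<le> t" "t < 1" using z\<mu> z d by (simp_all add: t_def)
    have "t * (z' - \<mu>) = z - \<mu>" using d by (simp add: t_def)
    then show "z = t * z' + (1 - t) * \<mu>" by (simp add: algebra_simps)
  qed
  have "- l * z - E = t * (- l * z' - E) + (1 - t) * (- l * \<mu> - E)"
    by (subst t(3)) (simp add: algebra_simps)
  also have "\<dots> \<le> t * z' + (1 - t) * 0"
    using t E by (intro add_mono mult_left_mono) auto
  also have "\<dots> < z" using t(3) mult_pos_pos[of "1 - t" \<mu>] t(2) \<mu>(3) by simp
  finally show False using E by (simp add: algebra_simps)
qed

text \<open>For \<open>1 / c < \<mu>\<close> the untilted case applies. Otherwise two points
  \<open>c2 < c1\<close> are inserted between \<open>alpha_min\<close> and \<open>c\<close>. As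
  \<open>c2 < 1 / \<mu>\<close> lies outside the defining set, \<open>\<Psi> c2 \<le> 1\<close>,
  which bounds the conjugate for \<open>z' = 1 / c2\<close> by \<open>z'\<close>; and
  \<open>z = 1 / c1\<close> strictly exceeds \<open>1 / c\<close>, hence also
  \<open>\<mu>\<close>.\<close>

lemma growth_above_alpha_min:
  assumes c: "alpha_min P (\<lambda>x. x) < c"
  shows "\<exists>B>0. \<exists>l. 0 < trunc_moment P B l \<and> 1 / c < trunc_log_moment P B l / trunc_moment P B l
    \<and> 0 < (l + 1) * (trunc_log_moment P B l / trunc_moment P B l) + ln (trunc_moment P B l)"
    and alpha_min_nonneg: "0 \<le> alpha_min P (\<lambda>x. x)"
proof -
  let ?S = "{c. 0 < c \<and> ennreal c < 1 / neg_log_mean P (\<lambda>x. x) \<and> rate_Psi P (\<lambda>x. x) c > 1}"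
  have pos: "neg_log_mean P (\<lambda>x. x) \<noteq> 0"
    using neg_log_mean_finite(2,3) by (cases "neg_log_mean P (\<lambda>x. x) < \<infinity>") auto
  have bdd: "bdd_above ({0} \<union> ?S)"
  proof -
    have fin: "1 / neg_log_mean P (\<lambda>x. x) < \<top>" using pos by (simp add: ennreal_divide_eq_top_iff less_top[symmetric])
    have "c \<le> enn2real (1 / neg_log_mean P (\<lambda>x. x))" if "c \<in> {0} \<union> ?S" for c
      using that enn2real_mono[of "ennreal c" "1 / neg_log_mean P (\<lambda>x. x)"] fin by auto
    then show ?thesis by (rule bdd_aboveI)
  qed
  show nn: "0 \<le> alpha_min P (\<lambda>x. x)" unfolding alpha_min_def by (rule cSup_upper[OF _ bdd]) simp
  then have c0: "0 < c" using c by simp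
  show "\<exists>B>0. \<exists>l. 0 < trunc_moment P B l \<and> 1 / c < trunc_log_moment P B l / trunc_moment P B l
    \<and> 0 < (l + 1) * (trunc_log_moment P B l / trunc_moment P B l) + ln (trunc_moment P B l)"
  proof (cases "ennreal (1 / c) < neg_log_mean P (\<lambda>x. x)")
    case True
    from growth_above_inverse_mean[OF c0 this] obtain B where
      "B > 0" "0 < trunc_moment P B 0" "1 / c < trunc_log_moment P B 0 / trunc_moment P B 0"
      "0 < trunc_log_moment P B 0 / trunc_moment P B 0 + ln (trunc_moment P B 0)" by blast
    then show ?thesis by (intro exI[of _ B] conjI exI[of _ 0]) auto
  next
    case False
    then have fin: "neg_log_mean P (\<lambda>x. x) < \<infinity>" by (metis ennreal_less_top infinity_ennreal_def le_less_trans linorder_not_less)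
    define \<mu> where "\<mu> = (\<integral>x. - ln x \<partial>P)"
    note \<mu> = neg_log_mean_finite[OF fin, folded \<mu>_def]
    have \<mu>c: "\<mu> \<le> 1 / c" using False \<mu> c0 by (simp add: ennreal_less_iff)
    define c1 c2 where "c1 = (alpha_min P (\<lambda>x. x) + c) / 2" and "c2 = (alpha_min P (\<lambda>x. x) + c1) / 2"
    have cc: "0 < c2" "c2 < c1" "c1 < c" "alpha_min P (\<lambda>x. x) < c2" using c nn c0 by (simp_all add: c1_def c2_def field_simps add_nonneg_pos)
    have zz: "1 / c < 1 / c1" "1 / c1 < 1 / c2" using cc by (auto intro!: divide_strict_left_mono)
    have "c2 \<notin> ?S"
    proof
      assume "c2 \<in> ?S"
      then have "c2 \<le> alpha_min P (\<lambda>x. x)" unfolding alpha_min_def by (intro cSup_upper[OF _ bdd]) simp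
      then show False using cc by simp
    qed
    moreover have "ennreal c2 < 1 / neg_log_mean P (\<lambda>x. x)"
    proof -
      have "\<mu> < 1 / c2" using \<mu>c zz by simp
      then have "c2 < 1 / \<mu>" using \<mu>(3) cc by (simp add: field_simps)
      then have "ennreal c2 < ennreal (1 / \<mu>)" using cc by (subst ennreal_less_iff) auto
      also have "\<dots> = 1 / neg_log_mean P (\<lambda>x. x)" using \<mu> divide_ennreal[of 1 \<mu>] by simp
      finally show ?thesis .
    qed
    ultimately have psi: "rate_Psi P (\<lambda>x. x) c2 \<le> 1" using cc by auto
    have conj: "log_moment_conj P (\<lambda>x. x) (- 1 / c2) \<le> ereal (1 / c2)"
    proof -
      have "ereal (1 / c2) * (ereal c2 * log_moment_conj P (\<lambda>x. x) (- 1 / c2)) \<le> ereal (1 / c2) * 1"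
        using psi cc unfolding rate_Psi_def by (intro ereal_mult_left_mono) auto
      then show ?thesis using cc by (simp add: mult.assoc[symmetric] one_ereal_def[symmetric])
    qed
    have "- l * (1 / c2) - ln (\<integral>x. x powr l \<partial>P) \<le> 1 / c2" if int: "integrable P (\<lambda>x. x powr l)" for l
    proof -
      have "ereal (l * (- 1 / c2)) - log_moment P (\<lambda>x. x) l \<le> log_moment_conj P (\<lambda>x. x) (- 1 / c2)"
        unfolding log_moment_conj_def by (rule SUP_upper) simp
      from order_trans[OF this conj] show ?thesis by (simp add: log_moment_integrable[OF int])
    qed
    from growth_below_inverse_mean[OF fin _ zz(2) this] \<mu>c zz(1) obtain B l where
      B: "0 < B" "0 < trunc_moment P B l" "trunc_log_moment P B l = 1 / c1 * trunc_moment P B l"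
        "0 < (l + 1) * (1 / c1) + ln (trunc_moment P B l)" by (auto simp: \<mu>_def)
    then have "trunc_log_moment P B l / trunc_moment P B l = 1 / c1" by simp
    then show ?thesis using B zz by (intro exI[of _ B] conjI exI[of _ l]) auto
  qed
qed

end

section \<open>The tree and the lower bound\<close>

lemma parent_le:
  assumes "x i \<in> {0..<1}" shows "sarrt_parent x i \<le> i"
proof -
  have "real i * x i \<le> real i" using assms by (simp add: mult_left_le)
  then show ?thesis unfolding sarrt_parent_def by linarith
qed

lemma parent_less:
  assumes "x i \<in> {0..<1}" "0 < i" shows "sarrt_parent x i < i"
proof -
  have "real i * x i < real i" using assms by simp
  moreover have "0 \<le> real i * x i" using assms by simp
  ultimately show ?thesis unfolding sarrt_parent_def using assms(2) by linarith
qed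

lemma parent_0 [simp]: "sarrt_parent x 0 = 0" by (simp add: sarrt_parent_def)

lemma ancestor_0 [simp]: "sarrt_ancestor x 0 t = 0" by (induction t) auto

lemma ancestor_Suc_left: "sarrt_ancestor x i (Suc t) = sarrt_ancestor x (sarrt_parent x i) t"
  by (induction t) auto

lemma ancestor_add: "sarrt_ancestor x i (t + u) = sarrt_ancestor x (sarrt_ancestor x i t) u"
  by (induction u) auto

lemma ancestor_le: "(\<And>k. x k \<in> {0..<1}) \<Longrightarrow> sarrt_ancestor x i t \<le> i"
  by (induction t) (auto intro: order_trans[OF parent_le])

lemma ancestor_eq_0_mono: "sarrt_ancestor x i t = 0 \<Longrightarrow> t \<le> u \<Longrightarrow> sarrt_ancestor x i u = 0"
  by (metis ancestor_0 ancestor_add le_add_diff_inverse)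

lemma ancestor_self:
  assumes "\<And>k. x k \<in> {0..<1}" shows "sarrt_ancestor x i i = 0"
proof (induction i rule: less_induct)
  case (less i)
  show ?case
  proof (cases i)
    case (Suc j)
    have "sarrt_parent x i \<le> j" using parent_less[of x i] assms Suc by auto
    moreover have "sarrt_ancestor x (sarrt_parent x i) (sarrt_parent x i) = 0"
      using less[of "sarrt_parent x i"] \<open>sarrt_parent x i \<le> j\<close> Suc by simp
    ultimately show ?thesis unfolding Suc[symmetric]
      using ancestor_eq_0_mono Suc by (metis ancestor_Suc_left)
  qed simp
qed

text \<open>The root is a fixed point of the parent map and node \<open>i\<close> reaches it within
  \<open>i\<close> steps, so the \<open>LEAST\<close> is attained and depth events become events on
  the \<open>t\<close>-th ancestor.\<close>

lemma depth_le_iff: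
  assumes "\<And>k. x k \<in> {0..<1}"
  shows "sarrt_depth x i \<le> t \<longleftrightarrow> sarrt_ancestor x i t = 0"
proof
  have "sarrt_ancestor x i (sarrt_depth x i) = 0"
    unfolding sarrt_depth_def by (rule LeastI[of _ i]) (rule ancestor_self[OF assms])
  then show "sarrt_depth x i \<le> t \<Longrightarrow> sarrt_ancestor x i t = 0" by (rule ancestor_eq_0_mono)
qed (simp add: sarrt_depth_def Least_le)

lemma min_depth_le_iff:
  assumes "\<And>k. x k \<in> {0..<1}"
  shows "sarrt_min_depth x n \<le> t \<longleftrightarrow> (\<exists>i. real n / 2 \<le> real i \<and> i \<le> n \<and> sarrt_ancestor x i t = 0)"
proof -
  have "finite {i. real n / 2 \<le> real i \<and> i \<le> n}" by (rule finite_subset[of _ "{..n}"]) auto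
  moreover have "n \<in> {i. real n / 2 \<le> real i \<and> i \<le> n}" by simp
  ultimately show ?thesis unfolding sarrt_min_depth_def
    by (subst Min_le_iff) (auto simp: depth_le_iff[OF assms] intro: exI[of _ n])
qed

locale sarrt = attachment_law P f + tree: prob_space M
  for P :: "real measure" and f and M :: "'a measure" +
  fixes Xs :: "nat \<Rightarrow> 'a \<Rightarrow> real"
  assumes Xs_unit: "\<And>i \<omega>. \<omega> \<in> space M \<Longrightarrow> Xs i \<omega> \<in> {0..<1}"
    and Xs_indep: "tree.indep_vars (\<lambda>_. borel) Xs UNIV"
    and Xs_law: "\<And>i. distr M borel (Xs i) = P"
begin

section \<open>Measurability and independence along the labels\<close>

abbreviation ancestor :: "nat \<Rightarrow> nat \<Rightarrow> 'a \<Rightarrow> nat" where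
  "ancestor i t \<omega> \<equiv> sarrt_ancestor (\<lambda>k. Xs k \<omega>) i t"

abbreviation min_depth :: "nat \<Rightarrow> 'a \<Rightarrow> nat" where
  "min_depth n \<omega> \<equiv> sarrt_min_depth (\<lambda>k. Xs k \<omega>) n"

text \<open>The filtration of the tree grown label by label. The index counts the revealed
  attachments: \<open>Xs n\<close> is independent of \<open>past n\<close>, and what the labels up
  to \<open>v\<close> decide belongs to \<open>past (Suc v)\<close>.\<close>

definition past :: "nat \<Rightarrow> 'a measure" where
  "past n = sigma (space M) (\<Union>k\<in>{..<n}. {Xs k -` B \<inter> space M |B. B \<in> sets borel})"

lemma Xs_measurable [measurable]: "Xs i \<in> borel_measurable M"
  using Xs_indep unfolding tree.indep_vars_def by simp

lemma space_past [simp]: "space (past n) = space M"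
  unfolding past_def by (rule space_measure_of) auto

lemma sets_past_eq: "sets (past n) = sigma_sets (space M) (\<Union>k\<in>{..<n}. {Xs k -` B \<inter> space M |B. B \<in> sets borel})"
  unfolding past_def by (rule sets_measure_of) auto

lemma sets_past_subset: "sets (past n) \<subseteq> sets M"
  unfolding sets_past_eq by (rule sets.sigma_sets_subset) auto

lemma sets_past_mono: "m \<le> n \<Longrightarrow> sets (past m) \<subseteq> sets (past n)"
  unfolding sets_past_eq by (rule sigma_sets_subseteq, rule UN_mono) auto

lemma Xs_past_measurable: "k < n \<Longrightarrow> Xs k \<in> borel_measurable (past n)"
  by (rule measurableI) (auto simp: sets_past_eq)

text \<open>The index blocks \<open>{..<n}\<close> and \<open>{n}\<close> generate independent
  sigma-algebras.\<close>

lemma past_indep: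
  assumes "E \<in> sets (past n)" "B \<in> sets borel"
  shows "tree.prob (E \<inter> (Xs n -` B \<inter> space M)) = tree.prob E * prob B"
proof -
  define G where "G i = {Xs i -` B \<inter> space M |B. B \<in> sets borel}" for i
  define I where "I b = (if b then {..<n} else {n})" for b
  have "tree.indep_sets G UNIV" using Xs_indep unfolding tree.indep_vars_def2 G_def by simp
  then have "tree.indep_sets G (\<Union> (I ` UNIV))" by (rule tree.indep_sets_mono_index[OF subset_UNIV])
  then have "tree.indep_sets (\<lambda>b. sigma_sets (space M) (\<Union> (G ` I b))) UNIV"
  proof (rule tree.indep_sets_collect_sigma)
    show "Int_stable (G i)" for i
    proof (rule Int_stableI)
      fix a b assume "a \<in> G i" "b \<in> G i"
      then obtain A B where AB: "a = Xs i -` A \<inter> space M" "b = Xs i -` B \<inter> space M" "A \<in> sets borel" "B \<in> sets borel"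
        by (auto simp: G_def)
      have "a \<inter> b = Xs i -` (A \<inter> B) \<inter> space M" using AB by auto
      then show "a \<inter> b \<in> G i" using AB unfolding G_def by blast
    qed
    show "disjoint_family_on I UNIV" by (auto simp: disjoint_family_on_def I_def)
  qed
  from tree.indep_setsD[OF this, of UNIV "\<lambda>b. if b then E else Xs n -` B \<inter> space M"]
  have "tree.prob (E \<inter> (Xs n -` B \<inter> space M)) = tree.prob E * tree.prob (Xs n -` B \<inter> space M)"
    using assms by (auto simp: UNIV_bool I_def G_def sets_past_eq Int_commute mult.commute)
  moreover have "tree.prob (Xs n -` B \<inter> space M) = prob B"
    using assms(2) by (subst Xs_law[of n, symmetric]) (simp add: measure_distr)
  ultimately show ?thesis by simp
qed

lemma parent_eq_iff: "sarrt_parent (\<lambda>k. Xs k \<omega>) i = m \<longleftrightarrow> Xs i \<omega> \<in> hit i m"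
  by (simp add: sarrt_parent_def hit_def)

text \<open>Ancestors have smaller or equal labels, so following the line of \<open>i\<close>
  inspects only attachments with index at most \<open>i\<close>.\<close>

lemma ancestor_eq_past:
  "i < n \<Longrightarrow> {\<omega> \<in> space M. ancestor i t \<omega> = m} \<in> sets (past n)"
proof (induction t arbitrary: m)
  case 0
  have "{\<omega> \<in> space M. ancestor i 0 \<omega> = m} = (if i = m then space (past n) else {})" by auto
  then show ?case using sets.top[of "past n"] by simp
next
  case (Suc t)
  have "{\<omega> \<in> space M. ancestor i (Suc t) \<omega> = m}
    = (\<Union>j\<le>i. {\<omega> \<in> space M. ancestor i t \<omega> = j} \<inter> (Xs j -` hit j m \<inter> space M))"
    using ancestor_le[of "\<lambda>k. Xs k _"] Xs_unit by (auto simp: parent_eq_iff)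
  also have "\<dots> \<in> sets (past n)"
  proof (rule sets.finite_UN)
    fix j assume "j \<in> {..i}"
    then have "Xs j -` hit j m \<inter> space M \<in> sets (past n)"
      using measurable_sets[OF Xs_past_measurable[of j n] hit_measurable] Suc.prems by simp
    then show "{\<omega> \<in> space M. ancestor i t \<omega> = j} \<inter> (Xs j -` hit j m \<inter> space M) \<in> sets (past n)"
      using Suc.IH[OF Suc.prems] by (rule sets.Int[rotated])
  qed simp
  finally show ?case .
qed

lemma ancestor_in_past:
  assumes "i < n" shows "{\<omega> \<in> space M. ancestor i t \<omega> \<in> S} \<in> sets (past n)"
proof -
  have "{\<omega> \<in> space M. ancestor i t \<omega> \<in> S} = (\<Union>m\<in>S. {\<omega> \<in> space M. ancestor i t \<omega> = m})" by auto
  also have "\<dots> \<in> sets (past n)"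
    using ancestor_eq_past[OF assms] by (intro sets.countable_UN') auto
  finally show ?thesis .
qed

lemma ancestor_in_sets: "{\<omega> \<in> space M. ancestor i t \<omega> \<in> S} \<in> sets M"
  using ancestor_in_past[of i "Suc i"] sets_past_subset by blast

lemma ancestor_eq_sets: "{\<omega> \<in> space M. ancestor i t \<omega> = m} \<in> sets M"
  using ancestor_in_sets[of i t "{m}"] by simp

lemma hit_disjoint: "disjoint_family_on (hit i) S"
  by (auto simp: disjoint_family_on_def hit_def)

text \<open>First-step decomposition: the parent \<open>m\<close> of \<open>i > 0\<close> is smaller
  than \<open>i\<close>, so the further line of \<open>m\<close> belongs to \<open>past i\<close>,
  which is independent of \<open>Xs i\<close>.\<close>

lemma prob_ancestor_Suc:
  assumes "0 < i"
  shows "tree.prob {\<omega> \<in> space M. ancestor i (Suc t) \<omega> \<in> S}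
    = (\<Sum>m<i. prob (hit i m) * tree.prob {\<omega> \<in> space M. ancestor m t \<omega> \<in> S})"
proof -
  define E where "E m = {\<omega> \<in> space M. ancestor m t \<omega> \<in> S} \<inter> (Xs i -` hit i m \<inter> space M)" for m
  have "{\<omega> \<in> space M. ancestor i (Suc t) \<omega> \<in> S} = (\<Union>m<i. E m)"
    using parent_less[of "\<lambda>k. Xs k _" i] Xs_unit assms
    by (auto simp: ancestor_Suc_left E_def parent_eq_iff[symmetric] simp del: sarrt_ancestor.simps)
  moreover have "tree.prob (\<Union>m<i. E m) = (\<Sum>m<i. tree.prob (E m))"
  proof (rule tree.finite_measure_finite_Union)
    show "E ` {..<i} \<subseteq> sets M" using ancestor_in_sets by (auto simp: E_def)
    show "disjoint_family_on E {..<i}" using hit_disjoint[of i] by (auto simp: disjoint_family_on_def E_def)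
  qed simp
  moreover have "tree.prob (E m) = prob (hit i m) * tree.prob {\<omega> \<in> space M. ancestor m t \<omega> \<in> S}" if "m < i" for m
    unfolding E_def using that by (subst past_indep[OF ancestor_in_past]) auto
  ultimately show ?thesis by simp
qed

lemma neg_moment_ge_1:
  assumes s: "0 < s" and int: "integrable P (\<lambda>x. x powr (- s))"
  shows "1 \<le> (\<integral>x. x powr (- s) \<partial>P)"
  proof -
    have "(\<integral>x. 1 \<partial>P) \<le> (\<integral>x. x powr (- s) \<partial>P)"
    proof (rule integral_mono_AE)
      show "AE x in P. 1 \<le> x powr (- s)" using in_unit
      proof eventually_elim
        case (elim x)
        then show ?case using powr_mono2'[of "- s" x 1] s by simp
      qed
    qed (use int in auto)
    then show ?thesis by simp
  qed

text \<open>Chernoff bound by induction over the first step. If the parent label \<open>m\<close> is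
  at least \<open>K\<close>, rounding \<open>i * x\<close> down to \<open>m\<close> loses at most
  the factor \<open>1 - 1 / K\<close>, the origin of the extra factor in \<open>\<beta>\<close>; if
  it falls below \<open>K\<close>, the claimed bound is already at least 1. Asking for an ancestor
  below \<open>K\<close> rather than at the root stops the induction before rounding becomes
  coarse.\<close>

lemma prob_ancestor_small:
  fixes s :: real and K :: nat
  assumes s: "0 < s" and int: "integrable P (\<lambda>x. x powr (- s))" and K: "2 \<le> K" and i: "0 < i"
  defines "\<beta> \<equiv> (1 - 1 / real K) powr (- s) * (\<integral>x. x powr (- s) \<partial>P)"
  shows "tree.prob {\<omega> \<in> space M. ancestor i t \<omega> < K} \<le> real K powr s * \<beta> ^ t * real i powr (- s)"
  using i
proof (induction t arbitrary: i)
  case 0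
  show ?case
  proof (cases "i < K")
    case True
    then have "1 \<le> (real K / real i) powr s" using s 0 by (intro ge_one_powr_ge_zero) auto
    also have "\<dots> = real K powr s * real i powr (- s)" by (simp add: powr_divide powr_minus field_simps)
    finally have "1 \<le> real K powr s * \<beta> ^ 0 * real i powr (- s)" by simp
    then show ?thesis by (rule order_trans[OF tree.prob_le_1])
  qed simp
next
  case (Suc t)
  define r where "r = (1 - 1 / real K) powr (- s)"
  have K1: "0 < 1 - 1 / real K" "1 - 1 / real K \<le> 1" using K by auto
  have r: "1 \<le> r" using powr_mono2'[of "- s" "1 - 1 / real K" 1] K1 s by (simp add: r_def)
  have q: "1 \<le> (\<integral>x. x powr (- s) \<partial>P)" by (rule neg_moment_ge_1[OF s int])
  have \<beta>: "\<beta> = r * (\<integral>x. x powr (- s) \<partial>P)" by (simp add: \<beta>_def r_def)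
  have \<beta>1: "1 \<le> \<beta>" unfolding \<beta> using mult_mono[OF r q] r by simp
  define C where "C = real K powr s * \<beta> ^ t"
  have CK: "real K powr s \<le> C" using mult_left_mono[OF one_le_power[OF \<beta>1, of t], of "real K powr s"] by (simp add: C_def)
  have C0: "0 \<le> C" using \<beta>1 by (simp add: C_def)
  define p where "p m = tree.prob {\<omega> \<in> space M. ancestor m t \<omega> < K}" for m
  have p1: "p m \<le> 1" "0 \<le> p m" for m by (simp_all add: p_def)
  have pC: "p m \<le> C * real m powr (- s)" if "0 < m" for m using Suc.IH[OF that] by (simp add: p_def C_def)
  have "tree.prob {\<omega> \<in> space M. ancestor i (Suc t) \<omega> < K} = (\<Sum>m<i. prob (hit i m) * p m)"
    using prob_ancestor_Suc[OF Suc.prems, of t "{..<K}"] by (simp add: p_def del: sarrt_ancestor.simps)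
  also have "\<dots> = (\<integral>x. (\<Sum>m<i. p m * indicator (hit i m) x) \<partial>P)"
    by (subst Bochner_Integration.integral_sum)
      (auto intro!: integrable_mult_right integrable_real_indicator simp: emeasure_eq_measure mult.commute)
  also have "\<dots> \<le> (\<integral>x. C * r * real i powr (- s) * x powr (- s) \<partial>P)"
  proof (rule integral_mono_AE)
    show "integrable P (\<lambda>x. \<Sum>m<i. p m * indicator (hit i m) x)"
      by (intro Bochner_Integration.integrable_sum integrable_mult_right integrable_real_indicator)
        (simp_all add: emeasure_eq_measure)
    show "integrable P (\<lambda>x. C * r * real i powr (- s) * x powr (- s))" using int by simp
    show "AE x in P. (\<Sum>m<i. p m * indicator (hit i m) x) \<le> C * r * real i powr (- s) * x powr (- s)"
      using in_unit
    proof eventually_elim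
      case (elim x)
      define m where "m = nat \<lfloor>real i * x\<rfloor>"
      have y: "0 < real i * x" using elim Suc.prems by simp
      have "(\<Sum>m<i. p m * indicator (hit i m) x) = (\<Sum>m'<i. if m' = m then p m' else 0)"
        by (intro sum.cong refl) (auto simp: hit_def m_def)
      also have "\<dots> \<le> p m" using p1(2)[of m] by (simp add: sum.delta)
      also have "p m \<le> C * r * (real i * x) powr (- s)"
      proof (cases "K \<le> m")
        case True
        have "real i * x - 1 < m" "m \<le> real i * x" unfolding m_def using y by linarith+
        have "K \<le> real i * x" using True \<open>m \<le> real i * x\<close> by linarith
        then have "(1 - 1 / real K) * (real i * x) \<le> real i * x - 1"
          using K by (simp add: field_simps)
        then have "(1 - 1 / real K) * (real i * x) \<le> m" using \<open>real i * x - 1 < m\<close> by simp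
        moreover have "0 < (1 - 1 / real K) * (real i * x)" using K1 y by simp
        ultimately have "real m powr (- s) \<le> ((1 - 1 / real K) * (real i * x)) powr (- s)"
          using s by (intro powr_mono2') auto
        also have "\<dots> = r * (real i * x) powr (- s)" using K1 y by (simp add: r_def powr_mult)
        finally have "C * real m powr (- s) \<le> C * (r * (real i * x) powr (- s))" using C0 by (rule mult_left_mono)
        then show ?thesis using pC[of m] True K by (simp add: mult.assoc)
      next
        case False
        then have "m + 1 \<le> K" by simp
        then have "real i * x \<le> K" unfolding m_def by linarith
        then have "1 \<le> (K / (real i * x)) powr s" using y s by (intro ge_one_powr_ge_zero) auto
        also have "\<dots> = real K powr s * (real i * x) powr (- s)" using y by (simp add: powr_divide powr_minus field_simps)
        also have "\<dots> \<le> (C * r) * (real i * x) powr (- s)"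
        proof (rule mult_right_mono)
          show "real K powr s \<le> C * r" using mult_mono[OF CK r] C0 by simp
        qed simp
        finally show ?thesis using p1(1)[of m] by simp
      qed
      also have "(real i * x) powr (- s) = real i powr (- s) * x powr (- s)" using elim by (simp add: powr_mult)
      finally show ?case by (simp add: mult.assoc)
    qed
  qed
  also have "\<dots> = real K powr s * \<beta> ^ Suc t * real i powr (- s)" by (simp add: C_def \<beta>)
  finally show ?case .
qed

lemma min_depth_measurable: "min_depth n \<in> measurable M (count_space UNIV)"
proof -
  have le: "{\<omega> \<in> space M. min_depth n \<omega> \<le> t} \<in> sets M" for t
  proof -
    have "{\<omega> \<in> space M. min_depth n \<omega> \<le> t}
      = (\<Union>i\<in>{i. real n / 2 \<le> real i \<and> i \<le> n}. {\<omega> \<in> space M. ancestor i t \<omega> = 0})"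
      using Xs_unit by (auto simp: min_depth_le_iff)
    also have "\<dots> \<in> sets M" using ancestor_eq_sets by (intro sets.countable_UN') auto
    finally show ?thesis .
  qed
  have "min_depth n -` {t} \<inter> space M \<in> sets M" for t
  proof -
    have "min_depth n -` {t} \<inter> space M = {\<omega> \<in> space M. min_depth n \<omega> \<le> t}
      - (\<Union>u\<in>{..<t}. {\<omega> \<in> space M. min_depth n \<omega> \<le> u})"
    proof -
      have "d = t \<longleftrightarrow> d \<le> t \<and> (\<forall>u\<in>{..<t}. \<not> d \<le> u)" for d :: nat
        by (metis lessThan_iff linorder_not_less order_le_less)
      then show ?thesis by blast
    qed
    also have "\<dots> \<in> sets M" using le by (intro sets.Diff sets.finite_UN) auto
    finally show ?thesis .
  qed
  then show ?thesis by (intro iffD2[OF measurable_count_space_eq2_countable]) auto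
qed

text \<open>Union bound over at most \<open>n + 1\<close> labels. \<open>K\<close> is taken so large
  that the rounding factor in \<open>\<beta>\<close> keeps \<open>1 + c * ln \<beta> < s\<close>;
  the bound is then of order \<open>n powr (1 + c * ln \<beta> - s)\<close>.\<close>

lemma prob_min_depth_small:
  assumes c: "0 \<le> c" "c < alpha_min P (\<lambda>x. x)"
  shows "(\<lambda>n. tree.prob {\<omega> \<in> space M. real (min_depth n \<omega>) \<le> c * ln (real n)}) \<longlonglongrightarrow> 0"
proof -
  obtain s where s: "0 < s" "integrable P (\<lambda>x. x powr (- s))" "1 + c * ln (\<integral>x. x powr (- s) \<partial>P) < s"
    using neg_moment_below_alpha_min[OF c] by blast
  define q where "q = (\<integral>x. x powr (- s) \<partial>P)"
  have q: "0 < q" using powr_moment_pos[OF s(2)] by (simp add: q_def)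
  have "(\<lambda>K. 1 + c * (- s * ln (1 - 1 / real K) + ln q)) \<longlonglongrightarrow> 1 + c * (- s * ln 1 + ln q)"
    by (intro tendsto_intros) (real_asymp, simp)
  then have "\<forall>\<^sub>F K in sequentially. 1 + c * (- s * ln (1 - 1 / real K) + ln q) < s"
    using s(3) by (intro order_tendstoD) (auto simp: q_def)
  then have "\<forall>\<^sub>F K in sequentially. 1 + c * (- s * ln (1 - 1 / real K) + ln q) < s \<and> 2 \<le> K"
    using eventually_ge_at_top[of 2] by eventually_elim simp
  then obtain K where K: "1 + c * (- s * ln (1 - 1 / real K) + ln q) < s" "2 \<le> K"
    by (auto simp: eventually_sequentially)
  define \<beta> where "\<beta> = (1 - 1 / real K) powr (- s) * q"
  have K1: "0 < 1 - 1 / real K" using K(2) by simp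
  have q1: "1 \<le> q" unfolding q_def by (rule neg_moment_ge_1[OF s(1,2)])
  have r1: "1 \<le> (1 - 1 / real K) powr (- s)" using powr_mono2'[of "- s" "1 - 1 / real K" 1] K1 s by simp
  have \<beta>1: "1 \<le> \<beta>" unfolding \<beta>_def using mult_mono[OF r1 q1] by simp
  have ln\<beta>: "ln \<beta> = - s * ln (1 - 1 / real K) + ln q" 
  proof -
    have "ln \<beta> = ln ((1 - 1 / real K) powr (- s)) + ln q"
      unfolding \<beta>_def using q K1 by (intro ln_mult_pos) auto
    then show ?thesis using K1 by (simp add: ln_powr)
  qed
  have bound: "tree.prob {\<omega> \<in> space M. real (min_depth n \<omega>) \<le> c * ln (real n)}
    \<le> (real n + 1) * (real K powr s * \<beta> powr (c * ln n) * (real n / 2) powr (- s))" if n: "1 \<le> n" for n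
  proof -
    define t where "t = nat \<lfloor>c * ln (real n)\<rfloor>"
    have cl: "0 \<le> c * ln (real n)" using c n by simp
    have tt: "real d \<le> c * ln (real n) \<longleftrightarrow> d \<le> t" for d :: nat unfolding t_def using cl by linarith
    define S where "S = {i. real n / 2 \<le> real i \<and> i \<le> n}"
    have S: "finite S" "card S \<le> n + 1"
    proof -
      have "S \<subseteq> {..n}" by (auto simp: S_def)
      then show "finite S" "card S \<le> n + 1" using finite_subset card_mono[of "{..n}" S] by auto
    qed
    have "tree.prob {\<omega> \<in> space M. real (min_depth n \<omega>) \<le> c * ln (real n)}
      \<le> tree.prob (\<Union>i\<in>S. {\<omega> \<in> space M. ancestor i t \<omega> < K})"
    proof (rule tree.finite_measure_mono)
      show "{\<omega> \<in> space M. real (min_depth n \<omega>) \<le> c * ln (real n)}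
        \<subseteq> (\<Union>i\<in>S. {\<omega> \<in> space M. ancestor i t \<omega> < K})"
      proof
        fix \<omega> assume "\<omega> \<in> {\<omega> \<in> space M. real (min_depth n \<omega>) \<le> c * ln (real n)}"
        then have "\<omega> \<in> space M" "min_depth n \<omega> \<le> t" using tt by auto
        then obtain i where "i \<in> S" "ancestor i t \<omega> = 0"
          using Xs_unit by (auto simp: min_depth_le_iff S_def)
        then have "i \<in> S" "ancestor i t \<omega> < K" using K(2) by simp_all
        then show "\<omega> \<in> (\<Union>i\<in>S. {\<omega> \<in> space M. ancestor i t \<omega> < K})" using \<open>\<omega> \<in> space M\<close> by blast
      qed
      show "(\<Union>i\<in>S. {\<omega> \<in> space M. ancestor i t \<omega> < K}) \<in> sets M"
        using ancestor_in_sets[of _ t "{..<K}"] S by (intro sets.finite_UN) auto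
    qed
    also have "\<dots> \<le> (\<Sum>i\<in>S. tree.prob {\<omega> \<in> space M. ancestor i t \<omega> < K})"
      using ancestor_in_sets[of _ t "{..<K}"] S by (intro tree.finite_measure_subadditive_finite) auto
    also have "\<dots> \<le> (\<Sum>i\<in>S. real K powr s * \<beta> powr (c * ln n) * (real n / 2) powr (- s))"
    proof (rule sum_mono)
      fix i assume i: "i \<in> S"
      have n2: "0 < real n / 2" "real n / 2 \<le> real i" using i n by (auto simp: S_def)
      then have i0: "0 < i" by (metis less_le_trans of_nat_0_less_iff)
      have "tree.prob {\<omega> \<in> space M. ancestor i t \<omega> < K} \<le> real K powr s * \<beta> ^ t * real i powr (- s)"
        using prob_ancestor_small[OF s(1,2) K(2) i0] by (simp add: \<beta>_def q_def)
      also have "\<dots> \<le> real K powr s * \<beta> powr (c * ln n) * (real n / 2) powr (- s)"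
      proof (intro mult_mono)
        have "\<beta> ^ t = \<beta> powr real t" using \<beta>1 by (simp add: powr_realpow)
        also have "\<dots> \<le> \<beta> powr (c * ln n)" using tt[of t] \<beta>1 by (intro powr_mono) auto
        finally show "\<beta> ^ t \<le> \<beta> powr (c * ln n)" .
        show "real i powr (- s) \<le> (real n / 2) powr (- s)" using n2 s by (intro powr_mono2') auto
      qed (use \<beta>1 in auto)
      finally show "tree.prob {\<omega> \<in> space M. ancestor i t \<omega> < K} \<le> real K powr s * \<beta> powr (c * ln n) * (real n / 2) powr (- s)" .
    qed
    also have "\<dots> = real (card S) * (real K powr s * \<beta> powr (c * ln n) * (real n / 2) powr (- s))" by simp
    also have "\<dots> \<le> (real n + 1) * (real K powr s * \<beta> powr (c * ln n) * (real n / 2) powr (- s))"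
      using S(2) by (intro mult_right_mono) auto
    finally show ?thesis .
  qed
  define g where "g = c * ln \<beta>"
  have g: "1 + g < s" using K(1) ln\<beta> by (simp add: g_def)
  have "(\<lambda>n. (real n + 1) * (real K powr s * real n powr g * (real n / 2) powr (- s))) \<longlonglongrightarrow> 0"
  proof -
    have L: "(\<lambda>n. 2 powr s * (real K powr s * (real n powr (1 + g - s) + real n powr (g - s)))) \<longlonglongrightarrow> 2 powr s * (real K powr s * (0 + 0))"
      using g by (intro tendsto_intros tendsto_neg_powr filterlim_real_sequentially) auto
    have E: "\<forall>\<^sub>F n in sequentially. 2 powr s * (real K powr s * (real n powr (1 + g - s) + real n powr (g - s)))
        = (real n + 1) * (real K powr s * real n powr g * (real n / 2) powr (- s))"
      by (rule eventually_sequentiallyI[of 1])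
        (simp add: powr_divide powr_minus powr_add powr_diff field_simps)
    show ?thesis using Lim_transform_eventually[OF L E] by simp
  qed
  then show ?thesis
  proof (rule tendsto_sandwich[OF _ _ tendsto_const, rotated 2])
    show "\<forall>\<^sub>F n in sequentially. tree.prob {\<omega> \<in> space M. real (min_depth n \<omega>) \<le> c * ln (real n)}
      \<le> (real n + 1) * (real K powr s * real n powr g * (real n / 2) powr (- s))"
    proof (rule eventually_sequentiallyI[of 1])
      fix n :: nat assume n: "1 \<le> n"
      have "\<beta> powr (c * ln (real n)) = real n powr g"
        using n \<beta>1 by (simp add: powr_def g_def mult_ac)
      then show "tree.prob {\<omega> \<in> space M. real (min_depth n \<omega>) \<le> c * ln (real n)}
        \<le> (real n + 1) * (real K powr s * real n powr g * (real n / 2) powr (- s))"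
        using bound[OF n] by (simp only:)
    qed
  qed simp
qed

end

section \<open>Concentration of the number of children\<close>

text \<open>\<open>V\<close> consists of the at most \<open>n\<close> smallest elements of
  \<open>W\<close>. In this form the choice is adapted: whether \<open>v\<close> is selected depends
  only on \<open>v\<close> and on smaller elements.\<close>

lemma card_initial_segment:
  fixes W :: "nat set" and n :: nat
  assumes "finite W"
  defines "V \<equiv> {v \<in> W. card {u \<in> W. u < v} < n}"
  shows "card V \<le> n" and "n \<le> card W \<Longrightarrow> card V = n"
proof -
  have V: "finite V" "V \<subseteq> W" using assms by (auto simp: V_def)
  show le: "card V \<le> n"
  proof (cases "V = {}")
    case False
    then have m: "Max V \<in> V" using V by simp
    have "V - {Max V} \<subseteq> {u \<in> W. u < Max V}"
      using V by (auto simp: order_less_le)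
    then have "card (V - {Max V}) \<le> card {u \<in> W. u < Max V}" using assms by (intro card_mono) auto
    also have "\<dots> < n" using m by (simp add: V_def)
    finally show ?thesis using m V by (simp add: card_Diff_singleton)
  qed simp
  assume n: "n \<le> card W"
  show "card V = n"
  proof (rule ccontr)
    assume "card V \<noteq> n"
    then have lt: "card V < n" using le by simp
    then have "V \<noteq> W" using n by auto
    then have ne: "W - V \<noteq> {}" using V by auto
    define v where "v = Min (W - V)"
    have v: "v \<in> W - V" unfolding v_def using assms ne by (intro Min_in) auto
    have "{u \<in> W. u < v} \<subseteq> V"
    proof
      fix u assume u: "u \<in> {u \<in> W. u < v}"
      have "u \<notin> W - V"
      proof
        assume "u \<in> W - V"
        then have "v \<le> u" unfolding v_def using assms(1) by (intro Min_le) auto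
        then show False using u by simp
      qed
      then show "u \<in> V" using u by blast
    qed
    then have "card {u \<in> W. u < v} \<le> card V" using V by (intro card_mono) auto
    then show False using v lt by (simp add: V_def)
  qed
qed

context sarrt
begin

text \<open>Only \<open>v < i\<close> occurs, which leaves out the root as a child of itself. The
  union is disjoint, because the attachment of \<open>i\<close> determines its parent.\<close>

definition child_event :: "real set \<Rightarrow> (nat \<Rightarrow> 'a set) \<Rightarrow> nat \<Rightarrow> 'a set" where
  "child_event A D i = (\<Union>v<i. D v \<inter> (Xs i -` (A \<inter> hit i v) \<inter> space M))"

definition total :: "nat \<Rightarrow> (nat \<Rightarrow> real) \<Rightarrow> (nat \<Rightarrow> 'a set) \<Rightarrow> 'a \<Rightarrow> real" where
  "total n h D \<omega> = (\<Sum>v<n. h v * indicator (D v) \<omega>)"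

text \<open>\<open>D\<close> encodes the random set \<open>{v. \<omega> \<in> D v}\<close> of labels; the attachments of the nodes up to \<open>v\<close>
  decide whether \<open>v\<close> belongs to it.\<close>

definition adapted :: "nat \<Rightarrow> (nat \<Rightarrow> 'a set) \<Rightarrow> bool" where
  "adapted n D \<longleftrightarrow> (\<forall>v. D v \<in> sets (past (Suc v))) \<and> D 0 = {} \<and> (\<forall>v\<ge>n. D v = {})"

lemma adapted_past: "adapted n D \<Longrightarrow> v < j \<Longrightarrow> D v \<in> sets (past j)"
  using sets_past_mono[of "Suc v" j] by (auto simp: adapted_def)

lemma adapted_sets: "adapted n D \<Longrightarrow> D v \<in> sets M"
  using sets_past_subset by (auto simp: adapted_def)

lemma sets_past_cell: "A \<in> sets borel \<Longrightarrow> i < j \<Longrightarrow> Xs i -` (A \<inter> hit i v) \<inter> space M \<in> sets (past j)"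
  using measurable_sets[OF Xs_past_measurable[of i j], of "A \<inter> hit i v"] hit_measurable by auto

lemma child_event_past:
  assumes "adapted n D" "A \<in> sets borel" "i < j"
  shows "child_event A D i \<in> sets (past j)"
  unfolding child_event_def
proof (rule sets.finite_UN)
  fix v assume "v \<in> {..<i}"
  then show "D v \<inter> (Xs i -` (A \<inter> hit i v) \<inter> space M) \<in> sets (past j)"
    using assms adapted_past[OF assms(1), of v j] by (intro sets.Int[OF _ sets_past_cell]) auto
qed simp

lemma cell_hit_empty:
  assumes "A \<subseteq> {1 / real B..<1}" "0 < B"
  shows "0 < i \<Longrightarrow> i \<le> v \<Longrightarrow> A \<inter> hit i v = {}" "(v + 1) * B \<le> i \<Longrightarrow> A \<inter> hit i v = {}"
proof -
  have x: "0 < x" "1 / real B \<le> x" "x < 1" if "x \<in> A" for x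
    using that assms cell_subset_pos by auto
  show "A \<inter> hit i v = {}" if "0 < i" "i \<le> v"
  proof -
    have "real i * x < real v" if "x \<in> A" for x
    proof -
      have "real i * x < real i" using x[OF that] \<open>0 < i\<close> by simp
      then show ?thesis using \<open>i \<le> v\<close> by linarith
    qed
    then show ?thesis using x by (fastforce simp: hit_iff)
  qed
  show "A \<inter> hit i v = {}" if "(v + 1) * B \<le> i"
  proof -
    have "real v + 1 \<le> real i * x" if "x \<in> A" for x
    proof -
      have "real v + 1 = real ((v + 1) * B) * (1 / real B)" using assms by (simp add: add_divide_distrib)
      also have "\<dots> \<le> real i * x"
      proof (rule mult_mono[OF _ x(2)[OF that]])
        show "real ((v + 1) * B) \<le> real i" using \<open>(v + 1) * B \<le> i\<close> by (simp only: of_nat_le_iff)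
      qed auto
      finally show ?thesis .
    qed
    then show ?thesis using x by (fastforce simp: hit_iff)
  qed
qed

lemma child_event_adapted:
  assumes D: "adapted n D" and A: "A \<in> sets borel" "A \<subseteq> {1 / real B..<1}" "0 < B"
  shows "adapted (n * B) (child_event A D)"
proof -
  have "child_event A D i = {}" if i: "n * B \<le> i" for i
  proof -
    have "D v \<inter> (Xs i -` (A \<inter> hit i v) \<inter> space M) = {}" for v
    proof (cases "v < n")
      case True
      then have "(v + 1) * B \<le> n * B" by (intro mult_right_mono) auto
      then have "A \<inter> hit i v = {}" using cell_hit_empty(2)[OF A(2,3)] i by simp
      then show ?thesis by simp
    next
      case False
      then show ?thesis using D by (simp add: adapted_def)
    qed
    then show ?thesis by (simp add: child_event_def)
  qed
  moreover have "child_event A D 0 = {}" by (simp add: child_event_def)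
  moreover have "child_event A D v \<in> sets (past (Suc v))" for v
    by (rule child_event_past[OF D A(1)]) simp
  ultimately show ?thesis by (simp add: adapted_def)
qed

lemma child_event_iter_adapted:
  assumes D: "adapted n D" and A: "A \<in> sets borel" "A \<subseteq> {1 / real B..<1}" "0 < B"
  shows "adapted (n * B ^ k) ((child_event A ^^ k) D)"
proof (induction k)
  case (Suc k)
  then show ?case using child_event_adapted[OF Suc A] by (simp add: mult_ac)
qed (use D in simp)

lemma child_event_ancestor:
  assumes "\<And>v. D v \<subseteq> {\<omega> \<in> space M. ancestor v d \<omega> = 0}"
  shows "(child_event A ^^ k) D i \<subseteq> {\<omega> \<in> space M. ancestor i (d + k) \<omega> = 0}"
proof (induction k arbitrary: i)
  case (Suc k)
  show ?case
  proof
    fix \<omega> assume "\<omega> \<in> (child_event A ^^ Suc k) D i"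
    then obtain v where "\<omega> \<in> (child_event A ^^ k) D v" "Xs i \<omega> \<in> hit i v" "\<omega> \<in> space M"
      by (auto simp: child_event_def)
    then show "\<omega> \<in> {\<omega> \<in> space M. ancestor i (d + Suc k) \<omega> = 0}"
      using Suc[of v] by (auto simp: ancestor_Suc_left parent_eq_iff[symmetric] simp del: sarrt_ancestor.simps)
  qed
qed (use assms in simp)

lemma integrable_indicator_event: "E \<in> sets M \<Longrightarrow> integrable M (indicator E :: 'a \<Rightarrow> real)"
  by (intro integrable_real_indicator) (simp_all add: tree.emeasure_eq_measure)

lemma integrable_total: "adapted n D \<Longrightarrow> integrable M (total m h D)"
  unfolding total_def[abs_def]
  by (intro Bochner_Integration.integrable_sum integrable_mult_right integrable_indicator_event adapted_sets)

text \<open>Conditional child probabilities, summed over the children, are regrouped by parents. The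
  ranges differ only in void terms: for \<open>i > 0\<close> a child of \<open>v\<close> has a label
  above \<open>v\<close> and below \<open>(v + 1) * B\<close>. The exception is
  \<open>i = 0\<close>, as \<open>hit 0 0\<close> is the whole line; it is ruled out by
  \<open>D 0 = {}\<close>.\<close>

lemma total_sum_swap:
  assumes D: "adapted n D" and A: "A \<subseteq> {1 / real B..<1}" "0 < B"
  shows "(\<Sum>i<n * B. h i * (\<Sum>v<i. indicator (D v) \<omega> * prob (A \<inter> hit i v))) = total n (child_sum P A B h) D \<omega>"
proof -
  have eq: "(\<Sum>v<i. indicator (D v) \<omega> * prob (A \<inter> hit i v)) = (\<Sum>v<n. indicator (D v) \<omega> * prob (A \<inter> hit i v))"
    if "i < n * B" for i
  proof -
    have "(\<Sum>v<i. indicator (D v) \<omega> * prob (A \<inter> hit i v)) = (\<Sum>v<max i n. indicator (D v) \<omega> * prob (A \<inter> hit i v))"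
    proof (rule sum.mono_neutral_left)
      show "\<forall>v\<in>{..<max i n} - {..<i}. indicator (D v) \<omega> * prob (A \<inter> hit i v) = 0"
      proof
        fix v assume v: "v \<in> {..<max i n} - {..<i}"
        show "indicator (D v) \<omega> * prob (A \<inter> hit i v) = 0"
        proof (cases "i = 0 \<and> v = 0")
          case True
          then show ?thesis using D by (simp add: adapted_def)
        next
          case False
          then show ?thesis using v cell_hit_empty(1)[OF A, of i v] cell_hit_empty(1)[OF A, of "0" v] D
          proof (cases "i = 0")
            case True
            have "hit 0 v = {}" using False True by (auto simp: hit_def)
            then show ?thesis using True by simp
          qed (use v cell_hit_empty(1)[OF A, of i v] in auto)
        qed
      qed
    qed auto
    also have "\<dots> = (\<Sum>v<n. indicator (D v) \<omega> * prob (A \<inter> hit i v))"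
      using D by (intro sum.mono_neutral_right) (auto simp: adapted_def)
    finally show ?thesis .
  qed
  then have "(\<Sum>i<n * B. h i * (\<Sum>v<i. indicator (D v) \<omega> * prob (A \<inter> hit i v)))
    = (\<Sum>i<n * B. \<Sum>v<n. h i * (indicator (D v) \<omega> * prob (A \<inter> hit i v)))"
    by (intro sum.cong refl) (simp only: eq lessThan_iff sum_distrib_left)
  also have "\<dots> = (\<Sum>v<n. \<Sum>i<n * B. h i * (indicator (D v) \<omega> * prob (A \<inter> hit i v)))"
    by (rule sum.swap)
  also have "\<dots> = total n (child_sum P A B h) D \<omega>"
    unfolding total_def
  proof (rule sum.cong[OF refl])
    fix v assume "v \<in> {..<n}"
    then have le: "(v + 1) * B \<le> n * B" by (intro mult_right_mono) auto
    have "(\<Sum>i<n * B. h i * (indicator (D v) \<omega> * prob (A \<inter> hit i v)))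
      = (\<Sum>i<(v+1) * B. h i * (indicator (D v) \<omega> * prob (A \<inter> hit i v)))"
      using le cell_hit_empty(2)[OF A, of v] by (intro sum.mono_neutral_right) auto
    also have "\<dots> = child_sum P A B h v * indicator (D v) \<omega>"
      unfolding child_sum_def sum_distrib_right by (intro sum.cong refl) (simp only: mult_ac)
    finally show "(\<Sum>i<n * B. h i * (indicator (D v) \<omega> * prob (A \<inter> hit i v))) = child_sum P A B h v * indicator (D v) \<omega>" .
  qed
  finally show ?thesis .
qed

text \<open>Given the attachments of the nodes below \<open>i\<close>, the node \<open>i\<close> is a child of the random set
  with conditional probability \<open>\<Sum>v<i. indicator (D v) * prob (A \<inter> hit i v)\<close>. Hence the
  fluctuations around the expected weight of the children are a martingale in the label, and their
  second moments add up.\<close>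

lemma total_child_variance:
  assumes D: "adapted n D" and A: "A \<in> sets borel" "A \<subseteq> {1 / real B..<1}" "0 < B"
  shows "(\<integral>\<omega>. (total (n * B) h (child_event A D) \<omega> - total n (child_sum P A B h) D \<omega>)\<^sup>2 \<partial>M)
      \<le> (\<integral>\<omega>. total n (child_sum P A B (\<lambda>i. (h i)\<^sup>2)) D \<omega> \<partial>M)" (is ?variance)
    and "(\<integral>\<omega>. total (n * B) h (child_event A D) \<omega> \<partial>M) = (\<integral>\<omega>. total n (child_sum P A B h) D \<omega> \<partial>M)" (is ?mean)
    and "integrable M (\<lambda>\<omega>. (total (n * B) h (child_event A D) \<omega> - total n (child_sum P A B h) D \<omega>)\<^sup>2)"
proof -
  define q where "q i v = prob (A \<inter> hit i v)" for i v
  define c where "c i = (indicator (child_event A D i) :: 'a \<Rightarrow> real)" for i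
  define p where "p i \<omega> = (\<Sum>v<i. indicator (D v) \<omega> * q i v)" for i \<omega>
  define \<xi> where "\<xi> i \<omega> = c i \<omega> - p i \<omega>" for i \<omega>
  have DM [measurable]: "D v \<in> sets M" for v by (rule adapted_sets[OF D])
  have CM [measurable]: "child_event A D i \<in> sets M" for i
    by (rule adapted_sets[OF child_event_adapted[OF D A]])
  have q: "0 \<le> q i v" "q i v \<le> 1" for i v by (simp_all add: q_def)
  have \<xi>_meas [measurable]: "\<xi> i \<in> borel_measurable M" for i
    unfolding \<xi>_def[abs_def] c_def p_def[abs_def] by measurable
  have p_nonneg: "0 \<le> p i \<omega>" and p_le: "p i \<omega> \<le> i" for i \<omega>
  proof -
    show "0 \<le> p i \<omega>" unfolding p_def using q by (intro sum_nonneg mult_nonneg_nonneg) auto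
    have "p i \<omega> \<le> (\<Sum>v<i. 1 * 1)" unfolding p_def using q by (intro sum_mono mult_mono) auto
    then show "p i \<omega> \<le> i" by simp
  qed
  have \<xi>_bound: "\<bar>\<xi> i \<omega>\<bar> \<le> 1 + real i" for i \<omega>
    using p_nonneg[of i \<omega>] p_le[of i \<omega>] by (auto simp: \<xi>_def c_def indicator_def)
  have int_mult: "integrable M (\<lambda>\<omega>. \<xi> i \<omega> * g \<omega>)"
    if [measurable]: "g \<in> borel_measurable M" and g: "\<And>\<omega>. \<bar>g \<omega>\<bar> \<le> C" for g and i and C :: real
  proof (rule tree.integrable_const_bound[where B = "(1 + real i) * C"])
    show "AE \<omega> in M. norm (\<xi> i \<omega> * g \<omega>) \<le> (1 + real i) * C"
      using \<xi>_bound g by (intro AE_I2) (auto simp: abs_mult intro!: mult_mono)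
  qed measurable
  have c_sum: "c j \<omega> = (\<Sum>v<j. indicator (D v \<inter> (Xs j -` (A \<inter> hit j v) \<inter> space M)) \<omega>)" for j \<omega>
  proof -
    have "disjoint_family_on (\<lambda>v. D v \<inter> (Xs j -` (A \<inter> hit j v) \<inter> space M)) {..<j}"
      using hit_disjoint[of j "{..<j}"] by (auto simp: disjoint_family_on_def)
    then show ?thesis unfolding c_def child_event_def by (subst indicator_UN_disjoint) auto
  qed
  \<comment> \<open>\<open>\<xi> j\<close> has conditional mean 0 given \<open>past j\<close>,
    expressed by integrals over the events of \<open>past j\<close>.\<close>
  have zero: "(\<integral>\<omega>. \<xi> j \<omega> * indicator F \<omega> \<partial>M) = 0" if F: "F \<in> sets (past j)" for F j
  proof -
    have FM: "F \<in> sets M" using F sets_past_subset by blast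
    define G where "G v = D v \<inter> F \<inter> (Xs j -` (A \<inter> hit j v) \<inter> space M)" for v
    have GM: "G v \<in> sets M" for v unfolding G_def using FM A(1) by measurable
    have DFM: "D v \<inter> F \<in> sets M" for v using FM by measurable
    have "\<xi> j \<omega> * indicator F \<omega> = (\<Sum>v<j. indicator (G v) \<omega> - q j v * indicator (D v \<inter> F) \<omega>)" for \<omega>
      unfolding \<xi>_def c_sum p_def sum_subtractf[symmetric] sum_distrib_right
      by (intro sum.cong refl) (auto simp: G_def indicator_def)
    then have "(\<integral>\<omega>. \<xi> j \<omega> * indicator F \<omega> \<partial>M) = (\<integral>\<omega>. (\<Sum>v<j. indicator (G v) \<omega> - q j v * indicator (D v \<inter> F) \<omega>) \<partial>M)"
      by simp
    also have "\<dots> = (\<Sum>v<j. (\<integral>\<omega>. indicator (G v) \<omega> - q j v * indicator (D v \<inter> F) \<omega> \<partial>M))"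
      by (intro Bochner_Integration.integral_sum Bochner_Integration.integrable_diff integrable_mult_right integrable_indicator_event GM DFM)
    also have "\<dots> = (\<Sum>v<j. tree.prob (G v) - q j v * tree.prob (D v \<inter> F))"
    proof (intro sum.cong refl)
      fix v
      have "G v \<inter> space M = G v" "D v \<inter> F \<inter> space M = D v \<inter> F"
        using sets.sets_into_space[OF GM] sets.sets_into_space[OF DFM] by blast+
      then show "(\<integral>\<omega>. indicator (G v) \<omega> - q j v * indicator (D v \<inter> F) \<omega> \<partial>M) = tree.prob (G v) - q j v * tree.prob (D v \<inter> F)"
        by (subst Bochner_Integration.integral_diff)
          (use integrable_mult_right[OF integrable_indicator_event[OF DFM]] integrable_indicator_event[OF GM] in \<open>simp_all\<close>)
    qed
    also have "\<dots> = 0"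
    proof (intro sum.neutral ballI)
      fix v assume "v \<in> {..<j}"
      then have "D v \<inter> F \<in> sets (past j)" using adapted_past[OF D] F by (intro sets.Int) auto
      from past_indep[OF this, of "A \<inter> hit j v"] show "tree.prob (G v) - q j v * tree.prob (D v \<inter> F) = 0"
        using A(1) by (simp add: G_def q_def mult.commute)
    qed
    finally show ?thesis .
  qed
  have ind_bd: "\<bar>indicator (D v) \<omega>\<bar> \<le> (1 :: real)" for v \<omega> by (auto simp: indicator_def)
  have zero_p: "(\<integral>\<omega>. \<xi> j \<omega> * p i \<omega> \<partial>M) = 0" if "i \<le> j" for i j
  proof -
    have "(\<integral>\<omega>. \<xi> j \<omega> * p i \<omega> \<partial>M) = (\<integral>\<omega>. (\<Sum>v<i. q i v * (\<xi> j \<omega> * indicator (D v) \<omega>)) \<partial>M)"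
      unfolding p_def sum_distrib_left
      by (intro Bochner_Integration.integral_cong sum.cong refl) (simp only: mult_ac)
    also have "\<dots> = (\<Sum>v<i. \<integral>\<omega>. q i v * (\<xi> j \<omega> * indicator (D v) \<omega>) \<partial>M)"
      by (intro Bochner_Integration.integral_sum integrable_mult_right int_mult[OF borel_measurable_indicator[OF DM] ind_bd])
    also have "\<dots> = 0" using adapted_past[OF D] that by (intro sum.neutral) (auto simp: zero)
    finally show ?thesis .
  qed
  have p_meas [measurable]: "p i \<in> borel_measurable M" for i unfolding p_def[abs_def] by measurable
  have c_meas [measurable]: "c i \<in> borel_measurable M" for i unfolding c_def by measurable
  have c_bd: "\<bar>c i \<omega>\<bar> \<le> 1" for i \<omega> by (auto simp: c_def indicator_def)
  have p_bd: "\<bar>p i \<omega>\<bar> \<le> i" for i \<omega> using p_nonneg p_le by simp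
  \<comment> \<open>For \<open>i < j\<close> the variable \<open>\<xi> i\<close> is determined by
    \<open>past j\<close>, hence orthogonal to \<open>\<xi> j\<close>.\<close>
  have orth: "(\<integral>\<omega>. \<xi> j \<omega> * \<xi> i \<omega> \<partial>M) = 0" if "i < j" for i j
  proof -
    have "(\<integral>\<omega>. \<xi> j \<omega> * \<xi> i \<omega> \<partial>M) = (\<integral>\<omega>. \<xi> j \<omega> * c i \<omega> - \<xi> j \<omega> * p i \<omega> \<partial>M)"
      by (intro Bochner_Integration.integral_cong refl) (simp add: \<xi>_def[of i] right_diff_distrib)
    also have "\<dots> = (\<integral>\<omega>. \<xi> j \<omega> * c i \<omega> \<partial>M) - (\<integral>\<omega>. \<xi> j \<omega> * p i \<omega> \<partial>M)"
      by (rule Bochner_Integration.integral_diff[OF int_mult[OF c_meas c_bd] int_mult[OF p_meas p_bd]])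
    also have "\<dots> = 0"
      using zero_p[of i j] that zero[OF child_event_past[OF D A(1) that]] by (simp add: c_def)
    finally show ?thesis .
  qed
  have int_c: "integrable M (c i)" for i unfolding c_def by (rule integrable_indicator_event[OF CM])
  have int_p: "integrable M (p i)" for i
    unfolding p_def[abs_def] by (intro Bochner_Integration.integrable_sum integrable_mult_left integrable_indicator_event DM)
  have mean: "(\<integral>\<omega>. c i \<omega> \<partial>M) = (\<integral>\<omega>. p i \<omega> \<partial>M)" for i
  proof -
    have "(\<integral>\<omega>. \<xi> i \<omega> \<partial>M) = (\<integral>\<omega>. \<xi> i \<omega> * indicator (space M) \<omega> \<partial>M)"
      by (intro Bochner_Integration.integral_cong refl) simp
    also have "\<dots> = 0" using sets.top[of "past i"] by (intro zero) simp
    finally show ?thesis unfolding \<xi>_def using int_c[of i] int_p[of i] by simp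
  qed
  \<comment> \<open>\<open>\<xi> i\<close> is orthogonal to the predictable part \<open>p i\<close>,
    so its second moment is the mean of \<open>\<xi> i * c i\<close>, at most the mean of
    \<open>c i\<close>. This keeps the variance linear in the size of the set.\<close>
  have sq: "(\<integral>\<omega>. \<xi> i \<omega> * \<xi> i \<omega> \<partial>M) \<le> (\<integral>\<omega>. p i \<omega> \<partial>M)" for i
  proof -
    have "(\<integral>\<omega>. \<xi> i \<omega> * \<xi> i \<omega> \<partial>M) = (\<integral>\<omega>. \<xi> i \<omega> * c i \<omega> - \<xi> i \<omega> * p i \<omega> \<partial>M)"
      by (intro Bochner_Integration.integral_cong refl) (simp add: \<xi>_def right_diff_distrib)
    also have "\<dots> = (\<integral>\<omega>. \<xi> i \<omega> * c i \<omega> \<partial>M) - (\<integral>\<omega>. \<xi> i \<omega> * p i \<omega> \<partial>M)"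
      by (rule Bochner_Integration.integral_diff[OF int_mult[OF c_meas c_bd] int_mult[OF p_meas p_bd]])
    also have "\<dots> = (\<integral>\<omega>. \<xi> i \<omega> * c i \<omega> \<partial>M)" using zero_p[of i i] by simp
    also have "\<dots> \<le> (\<integral>\<omega>. c i \<omega> \<partial>M)"
    proof (rule integral_mono[OF int_mult[OF c_meas c_bd] int_c])
      show "\<xi> i \<omega> * c i \<omega> \<le> c i \<omega>" for \<omega>
        using p_nonneg[of i \<omega>] by (auto simp: \<xi>_def c_def indicator_def)
    qed
    finally show ?thesis using mean by simp
  qed
  have diff: "total (n * B) h (child_event A D) \<omega> - total n (child_sum P A B h) D \<omega> = (\<Sum>i<n * B. h i * \<xi> i \<omega>)" for h \<omega>
    unfolding total_sum_swap[OF D A(2,3), symmetric]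
    by (simp add: total_def \<xi>_def c_def p_def q_def right_diff_distrib sum_subtractf)
  have pE: "(\<integral>\<omega>. total n (child_sum P A B h) D \<omega> \<partial>M) = (\<Sum>i<n * B. h i * (\<integral>\<omega>. p i \<omega> \<partial>M))" for h
    unfolding total_sum_swap[OF D A(2,3), symmetric]
    using int_p by (subst Bochner_Integration.integral_sum) (simp_all add: p_def[abs_def] q_def)
  show ?mean
    unfolding pE using int_c mean
    by (simp add: total_def c_def[symmetric])
  have sqd: "(\<Sum>i<n * B. h i * \<xi> i \<omega>)\<^sup>2 = (\<Sum>i<n * B. \<Sum>j<n * B. (h i * h j) * (\<xi> i \<omega> * \<xi> j \<omega>))" for \<omega>
    unfolding power2_eq_square sum_product by (intro sum.cong refl) (simp add: mult_ac)
  have int\<xi>\<xi>: "integrable M (\<lambda>\<omega>. \<xi> i \<omega> * \<xi> j \<omega>)" for i j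
    by (rule int_mult[OF \<xi>_meas \<xi>_bound])
  show "integrable M (\<lambda>\<omega>. (total (n * B) h (child_event A D) \<omega> - total n (child_sum P A B h) D \<omega>)\<^sup>2)"
    unfolding diff sqd by (intro Bochner_Integration.integrable_sum integrable_mult_right int\<xi>\<xi>)
  have "(\<integral>\<omega>. (total (n * B) h (child_event A D) \<omega> - total n (child_sum P A B h) D \<omega>)\<^sup>2 \<partial>M)
    = (\<Sum>i<n * B. \<Sum>j<n * B. (h i * h j) * (\<integral>\<omega>. \<xi> i \<omega> * \<xi> j \<omega> \<partial>M))"
    unfolding diff sqd
    by (subst Bochner_Integration.integral_sum, intro Bochner_Integration.integrable_sum integrable_mult_right int\<xi>\<xi>,
        intro sum.cong refl, subst Bochner_Integration.integral_sum, intro integrable_mult_right int\<xi>\<xi>) simp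
  also have "\<dots> = (\<Sum>i<n * B. \<Sum>j<n * B. if j = i then (h i * h i) * (\<integral>\<omega>. \<xi> i \<omega> * \<xi> i \<omega> \<partial>M) else 0)"
  proof (intro sum.cong refl)
    fix i j
    show "(h i * h j) * (\<integral>\<omega>. \<xi> i \<omega> * \<xi> j \<omega> \<partial>M) = (if j = i then (h i * h i) * (\<integral>\<omega>. \<xi> i \<omega> * \<xi> i \<omega> \<partial>M) else 0)"
      using orth[of i j] orth[of j i] by (cases i j rule: linorder_cases) (auto simp: mult.commute[of "\<xi> i _"])
  qed
  also have "\<dots> = (\<Sum>i<n * B. (h i)\<^sup>2 * (\<integral>\<omega>. \<xi> i \<omega> * \<xi> i \<omega> \<partial>M))" by (simp add: power2_eq_square)
  also have "\<dots> \<le> (\<Sum>i<n * B. (h i)\<^sup>2 * (\<integral>\<omega>. p i \<omega> \<partial>M))" by (intro sum_mono mult_left_mono sq) auto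
  finally show ?variance unfolding pE .
qed

text \<open>Truncation pays off here: for an attachment in the cell, at most \<open>2 * B\<close>
  labels are mapped to a given parent.\<close>

lemma child_sum_bounds:
  assumes A: "A \<in> sets borel" "A \<subseteq> {1 / real B..<1}" "0 < B" and h: "\<And>i. 0 \<le> h i" "\<And>i. h i \<le> c"
  shows "0 \<le> child_sum P A B h v" "child_sum P A B h v \<le> 2 * real B * c"
proof -
  show "0 \<le> child_sum P A B h v" unfolding child_sum_def using h by (intro sum_nonneg) auto
  have c: "0 \<le> c" using h[of 0] by linarith
  have A01: "A \<subseteq> {0..<1}"
  proof
    fix x assume "x \<in> A"
    then show "x \<in> {0..<1}" using A(2) cell_subset_pos[OF A(3), of x] by auto
  qed
  have "child_sum P A B h v \<le> child_sum P A B (\<lambda>i. c * 1) v" using h A01 by (intro child_sum_mono) auto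
  also have "\<dots> = c * child_sum P A B (\<lambda>i. 1) v" by (rule child_sum_scale)
  finally have 1: "child_sum P A B h v \<le> c * child_sum P A B (\<lambda>i. 1) v" .
  have "child_sum P A B (\<lambda>i. 1) v = (\<integral>x. indicator A x * hits B v x \<partial>P)"
    unfolding child_sum_eq_integral[OF A(1)] hits_def by simp
  also have "\<dots> \<le> (\<integral>x. 2 * real B \<partial>P)"
  proof (rule integral_mono)
    have bd: "0 \<le> indicator A x * hits B v x \<and> indicator A x * hits B v x \<le> 2 * real B" for x
    proof (cases "x \<in> A")
      case True
      then show ?thesis using A hits_le_const[of B x v] hits_nonneg[of B v x] by auto
    qed (use A in simp)
    then show "indicator A x * hits B v x \<le> 2 * real B" for x by blast
    show "integrable P (\<lambda>x. indicator A x * hits B v x)"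
    proof (rule integrable_const_bound)
      show "AE x in P. norm (indicator A x * hits B v x) \<le> 2 * real B"
        using bd by (intro AE_I2) (metis abs_of_nonneg real_norm_def)
    qed (use A(1) in measurable)
  qed simp
  also have "(\<integral>x. 2 * real B \<partial>P) = 2 * real B" by simp
  finally have "c * child_sum P A B (\<lambda>i. 1) v \<le> c * (2 * real B)" using c by (rule mult_left_mono)
  then show "child_sum P A B h v \<le> 2 * real B * c" using 1 by (simp add: mult.commute)
qed

lemma child_sum_iter_bounds:
  assumes A: "A \<in> sets borel" "A \<subseteq> {1 / real B..<1}" "0 < B" and h: "\<And>i. 0 \<le> h i" "\<And>i. h i \<le> 1"
  shows "0 \<le> (child_sum P A B ^^ k) h v \<and> (child_sum P A B ^^ k) h v \<le> (2 * real B) ^ k"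
proof (induction k arbitrary: v)
  case (Suc k)
  show ?case using child_sum_bounds[OF A, of "(child_sum P A B ^^ k) h" "(2 * real B) ^ k" v] Suc by simp
qed (use h in simp)

lemma total_mono:
  "(\<And>v. h v \<le> g v) \<Longrightarrow> total n h D \<omega> \<le> total n g D \<omega>"
  unfolding total_def by (intro sum_mono mult_right_mono) auto

lemma total_scale: "total n (\<lambda>v. c * h v) D \<omega> = c * total n h D \<omega>"
  unfolding total_def sum_distrib_left by (intro sum.cong refl) (simp only: mult.assoc)

lemma integrable_total_diff_square:
  assumes D: "adapted n D" "adapted n' D'"
  shows "integrable M (\<lambda>\<omega>. (total m h D \<omega> - total m' h' D' \<omega>)\<^sup>2)"
proof -
  have bd: "\<bar>total n h D \<omega>\<bar> \<le> (\<Sum>v<n. \<bar>h v\<bar>)" for n h D \<omega>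
    unfolding total_def by (rule order_trans[OF sum_abs]) (intro sum_mono, auto simp: indicator_def)
  have [measurable]: "total m h D \<in> borel_measurable M" "total m' h' D' \<in> borel_measurable M"
    using integrable_total[OF D(1)] integrable_total[OF D(2)] by (auto dest: borel_measurable_integrable)
  show ?thesis
  proof (rule tree.integrable_const_bound)
    show "AE \<omega> in M. norm ((total m h D \<omega> - total m' h' D' \<omega>)\<^sup>2) \<le> ((\<Sum>v<m. \<bar>h v\<bar>) + (\<Sum>v<m'. \<bar>h' v\<bar>))\<^sup>2"
    proof (rule AE_I2)
      fix \<omega>
      have "\<bar>total m h D \<omega> - total m' h' D' \<omega>\<bar> \<le> \<bar>(\<Sum>v<m. \<bar>h v\<bar>) + (\<Sum>v<m'. \<bar>h' v\<bar>)\<bar>"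
        using bd[of m h D \<omega>] bd[of m' h' D' \<omega>] by linarith
      then have "(total m h D \<omega> - total m' h' D' \<omega>)\<^sup>2 \<le> ((\<Sum>v<m. \<bar>h v\<bar>) + (\<Sum>v<m'. \<bar>h' v\<bar>))\<^sup>2"
        by (rule iffD1[OF abs_le_square_iff])
      then show "norm ((total m h D \<omega> - total m' h' D' \<omega>)\<^sup>2) \<le> ((\<Sum>v<m. \<bar>h v\<bar>) + (\<Sum>v<m'. \<bar>h' v\<bar>))\<^sup>2" by simp
    qed
  qed measurable
qed

text \<open>Induction with the first generation split off. With \<open>Y\<close> the weight expected
  from the children, \<open>X - Z = (X - Y) + (Y - Z)\<close>: the first part is the induction
  hypothesis for the set of children, whose mean size is at most \<open>b\<close> times that of
  \<open>D\<close>; the second is a single step with the weight \<open>g \<le> b ^ k\<close>. The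
  constant depends on \<open>A\<close>, \<open>B\<close> and \<open>k\<close> only.\<close>

lemma total_iter_variance:
  assumes A: "A \<in> sets borel" "A \<subseteq> {1 / real B..<1}" "0 < B"
  shows "\<exists>C\<ge>0. \<forall>h n D. (\<forall>i. 0 \<le> h i \<and> h i \<le> 1) \<longrightarrow> adapted n D \<longrightarrow>
    (\<integral>\<omega>. (total (n * B ^ k) h ((child_event A ^^ k) D) \<omega> - total n ((child_sum P A B ^^ k) h) D \<omega>)\<^sup>2 \<partial>M)
      \<le> C * (\<integral>\<omega>. total n (\<lambda>_. 1) D \<omega> \<partial>M)"
proof (induction k)
  case 0
  show ?case by (intro exI[of _ 0]) auto
next
  case (Suc k)
  then obtain C where C: "0 \<le> C" and
    IH: "\<And>h n D. (\<And>i. 0 \<le> h i \<and> h i \<le> 1) \<Longrightarrow> adapted n D \<Longrightarrow>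
    (\<integral>\<omega>. (total (n * B ^ k) h ((child_event A ^^ k) D) \<omega> - total n ((child_sum P A B ^^ k) h) D \<omega>)\<^sup>2 \<partial>M)
      \<le> C * (\<integral>\<omega>. total n (\<lambda>_. 1) D \<omega> \<partial>M)" by blast
  define b where "b = 2 * real B"
  have b: "0 < b" using A by (simp add: b_def)
  have main: "(\<integral>\<omega>. (total (n * B ^ Suc k) h ((child_event A ^^ Suc k) D) \<omega> - total n ((child_sum P A B ^^ Suc k) h) D \<omega>)\<^sup>2 \<partial>M)
      \<le> (2 * (C * b) + 2 * (b * (b ^ k)\<^sup>2)) * (\<integral>\<omega>. total n (\<lambda>_. 1) D \<omega> \<partial>M)"
    if h: "\<And>i. 0 \<le> h i \<and> h i \<le> 1" and D: "adapted n D" for h n D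
  proof -
    define D' where "D' = child_event A D"
    define g where "g = (child_sum P A B ^^ k) h"
    have D': "adapted (n * B) D'" unfolding D'_def by (rule child_event_adapted[OF D A])
    have Dk: "adapted (n * B * B ^ k) ((child_event A ^^ k) D')" by (rule child_event_iter_adapted[OF D' A])
    define X Y Z where "X = total (n * B * B ^ k) h ((child_event A ^^ k) D')"
      and "Y = total (n * B) g D'" and "Z = total n (child_sum P A B g) D"
    have g: "0 \<le> g i \<and> g i \<le> b ^ k" for i unfolding g_def b_def
      using child_sum_iter_bounds[OF A] h by blast
    have "total (n * B ^ Suc k) h ((child_event A ^^ Suc k) D) = X"
      by (simp add: X_def D'_def funpow_swap1 mult_ac)
    moreover have "total n ((child_sum P A B ^^ Suc k) h) D = Z" by (simp add: Z_def g_def)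
    moreover have "(\<integral>\<omega>. (X \<omega> - Z \<omega>)\<^sup>2 \<partial>M) \<le> (\<integral>\<omega>. 2 * (X \<omega> - Y \<omega>)\<^sup>2 + 2 * (Y \<omega> - Z \<omega>)\<^sup>2 \<partial>M)"
    proof (rule integral_mono)
      show "integrable M (\<lambda>\<omega>. (X \<omega> - Z \<omega>)\<^sup>2)" unfolding X_def Z_def by (rule integrable_total_diff_square[OF Dk D])
      show "integrable M (\<lambda>\<omega>. 2 * (X \<omega> - Y \<omega>)\<^sup>2 + 2 * (Y \<omega> - Z \<omega>)\<^sup>2)"
        unfolding X_def Y_def Z_def
        by (intro Bochner_Integration.integrable_add integrable_mult_right integrable_total_diff_square[OF Dk D'] integrable_total_diff_square[OF D' D])
      show "(X \<omega> - Z \<omega>)\<^sup>2 \<le> 2 * (X \<omega> - Y \<omega>)\<^sup>2 + 2 * (Y \<omega> - Z \<omega>)\<^sup>2" for \<omega>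
      proof -
        have "0 \<le> ((X \<omega> - Y \<omega>) - (Y \<omega> - Z \<omega>))\<^sup>2" by simp
        then show ?thesis by (simp add: power2_eq_square algebra_simps)
      qed
    qed
    moreover have "(\<integral>\<omega>. 2 * (X \<omega> - Y \<omega>)\<^sup>2 + 2 * (Y \<omega> - Z \<omega>)\<^sup>2 \<partial>M)
        = 2 * (\<integral>\<omega>. (X \<omega> - Y \<omega>)\<^sup>2 \<partial>M) + 2 * (\<integral>\<omega>. (Y \<omega> - Z \<omega>)\<^sup>2 \<partial>M)"
      unfolding X_def Y_def Z_def
      using integrable_total_diff_square[OF Dk D'] integrable_total_diff_square[OF D' D] by simp
    moreover have "(\<integral>\<omega>. (X \<omega> - Y \<omega>)\<^sup>2 \<partial>M) \<le> C * (\<integral>\<omega>. total (n * B) (\<lambda>_. 1) D' \<omega> \<partial>M)"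
      unfolding X_def Y_def g_def using h D' by (rule IH)
    moreover have "(\<integral>\<omega>. total (n * B) (\<lambda>_. 1) D' \<omega> \<partial>M) \<le> b * (\<integral>\<omega>. total n (\<lambda>_. 1) D \<omega> \<partial>M)"
    proof -
      have "(\<integral>\<omega>. total (n * B) (\<lambda>_. 1) D' \<omega> \<partial>M) = (\<integral>\<omega>. total n (child_sum P A B (\<lambda>_. 1)) D \<omega> \<partial>M)"
        unfolding D'_def by (rule total_child_variance(2)[OF D A])
      also have "\<dots> \<le> (\<integral>\<omega>. total n (\<lambda>_. b * 1) D \<omega> \<partial>M)"
        using child_sum_bounds(2)[OF A, of "\<lambda>_. 1" 1]
        by (intro integral_mono integrable_total[OF D] total_mono) (simp add: b_def)
      finally show ?thesis by (simp only: total_scale integral_mult_right_zero)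
    qed
    moreover have "(\<integral>\<omega>. (Y \<omega> - Z \<omega>)\<^sup>2 \<partial>M) \<le> b * (b ^ k)\<^sup>2 * (\<integral>\<omega>. total n (\<lambda>_. 1) D \<omega> \<partial>M)"
    proof -
      have "(\<integral>\<omega>. (Y \<omega> - Z \<omega>)\<^sup>2 \<partial>M) \<le> (\<integral>\<omega>. total n (child_sum P A B (\<lambda>i. (g i)\<^sup>2)) D \<omega> \<partial>M)"
        unfolding Y_def Z_def D'_def by (rule total_child_variance(1)[OF D A])
      also have "\<dots> \<le> (\<integral>\<omega>. total n (\<lambda>_. (b * (b ^ k)\<^sup>2) * 1) D \<omega> \<partial>M)"
      proof (intro integral_mono integrable_total[OF D] total_mono)
        fix v
        have "(g i)\<^sup>2 \<le> (b ^ k)\<^sup>2" for i using g[of i] by (intro power_mono) auto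
        then show "child_sum P A B (\<lambda>i. (g i)\<^sup>2) v \<le> b * (b ^ k)\<^sup>2 * 1"
          using child_sum_bounds(2)[OF A, of "\<lambda>i. (g i)\<^sup>2" "(b ^ k)\<^sup>2" v] by (simp add: b_def)
      qed
      finally show ?thesis by (simp only: total_scale integral_mult_right_zero)
    qed
    moreover define e where "e = (\<integral>\<omega>. total n (\<lambda>_. 1) D \<omega> \<partial>M)"
    ultimately have 1: "(\<integral>\<omega>. (total (n * B ^ Suc k) h ((child_event A ^^ Suc k) D) \<omega> - total n ((child_sum P A B ^^ Suc k) h) D \<omega>)\<^sup>2 \<partial>M)
      \<le> 2 * (C * (\<integral>\<omega>. total (n * B) (\<lambda>_. 1) D' \<omega> \<partial>M)) + 2 * (b * (b ^ k)\<^sup>2 * e)"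
      and 2: "(\<integral>\<omega>. total (n * B) (\<lambda>_. 1) D' \<omega> \<partial>M) \<le> b * e" by auto
    have "C * (\<integral>\<omega>. total (n * B) (\<lambda>_. 1) D' \<omega> \<partial>M) \<le> C * (b * e)" using 2 C by (rule mult_left_mono)
    then show ?thesis using 1 unfolding e_def[symmetric] by (simp add: algebra_simps)
  qed
  show ?case
    by (intro exI[of _ "2 * (C * b) + 2 * (b * (b ^ k)\<^sup>2)"]) (use main C b in auto)
qed

section \<open>Spreading of shallow nodes from one window to another\<close>

definition shallow_count :: "real \<Rightarrow> real \<Rightarrow> nat \<Rightarrow> 'a \<Rightarrow> nat" where
  "shallow_count a b d \<omega> = card {v. a \<le> real v \<and> real v < b \<and> ancestor v d \<omega> = 0}"

definition spread_failure :: "real \<Rightarrow> real \<Rightarrow> real \<Rightarrow> real \<Rightarrow> nat \<Rightarrow> real \<Rightarrow> real \<Rightarrow> nat \<Rightarrow> 'a set" where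
  "spread_failure a b a' b' k \<beta> N d = {\<omega> \<in> space M. N \<le> real (shallow_count a b d \<omega>)
    \<and> real (shallow_count a' b' (d + k) \<omega>) < \<beta> * N}"

text \<open>\<open>C\<close> and \<open>m0\<close> are uniform in the scale \<open>m\<close>, the
  number \<open>N\<close> and the depth \<open>d\<close>; so the guaranteed output,
  \<open>\<beta> * N\<close> nodes at depth \<open>d + k\<close>, can serve as the input of a
  further stage, and the failure bound \<open>C / N\<close> improves as the set grows.\<close>

definition spreads :: "real \<Rightarrow> real \<Rightarrow> real \<Rightarrow> real \<Rightarrow> nat \<Rightarrow> real \<Rightarrow> bool" where
  "spreads a b a' b' k \<beta> \<longleftrightarrow> (\<exists>C\<ge>0. \<exists>m0. \<forall>m\<ge>m0. \<forall>N>0. \<forall>d.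
    tree.prob (spread_failure (m * a) (m * b) (m * a') (m * b') k \<beta> N d) \<le> C / N)"

lemma finite_shallow: "finite {v. a \<le> real v \<and> real v < b \<and> Q v}"
proof (rule finite_subset)
  show "{v. a \<le> real v \<and> real v < b \<and> Q v} \<subseteq> {..nat \<lceil>b\<rceil>}" by (auto simp: ) linarith
qed simp

lemma shallow_count_eq_total:
  assumes "\<omega> \<in> space M" "b \<le> real n"
  shows "real (shallow_count a b d \<omega>) = total n (window a b) (\<lambda>v. {\<omega> \<in> space M. ancestor v d \<omega> = 0}) \<omega>"
proof -
  have "total n (window a b) (\<lambda>v. {\<omega> \<in> space M. ancestor v d \<omega> = 0}) \<omega>
    = (\<Sum>v<n. if v \<in> {v. a \<le> real v \<and> real v < b \<and> ancestor v d \<omega> = 0} then 1 else 0)"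
    unfolding total_def using assms by (intro sum.cong refl) (auto simp: window_def indicator_def)
  also have "\<dots> = (\<Sum>v\<in>{..<n} \<inter> {v. a \<le> real v \<and> real v < b \<and> ancestor v d \<omega> = 0}. 1)"
    by (rule sum.inter_restrict[symmetric]) simp
  also have "{..<n} \<inter> {v. a \<le> real v \<and> real v < b \<and> ancestor v d \<omega> = 0} = {v. a \<le> real v \<and> real v < b \<and> ancestor v d \<omega> = 0}"
    using assms by auto
  finally show ?thesis by (simp add: shallow_count_def)
qed

lemma shallow_count_measurable [measurable]: "(\<lambda>\<omega>. real (shallow_count a b d \<omega>)) \<in> borel_measurable M"
proof -
  obtain n :: nat where n: "b \<le> real n" using real_arch_simple by blast
  have [measurable]: "{\<omega> \<in> space M. ancestor v d \<omega> = 0} \<in> sets M" for v by (rule ancestor_eq_sets)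
  have "total n (window a b) (\<lambda>v. {\<omega> \<in> space M. ancestor v d \<omega> = 0}) \<in> borel_measurable M"
    unfolding total_def[abs_def] by measurable
  then show ?thesis using shallow_count_eq_total[OF _ n] by (subst measurable_cong) auto
qed

lemma spread_failure_sets [measurable]: "spread_failure a b a' b' k \<beta> N d \<in> sets M"
  unfolding spread_failure_def by measurable

text \<open>Chebyshev's inequality. The expected output is at least \<open>2 * \<beta> * r\<close>,
  so an output below \<open>\<beta> * N\<close> is a deviation of at least
  \<open>\<beta> * r\<close>, against a second moment of at most \<open>C * r\<close>. To this end
  the source set, whose size is random and only bounded from below, is thinned to its
  \<open>r\<close> smallest elements: the thinned set has at most \<open>r\<close> elements
  everywhere and exactly \<open>r\<close> on the bad event.\<close>

lemma spreads_iter: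
  assumes A: "A \<in> sets borel" "A \<subseteq> {1 / real B..<1}" "0 < B" and a: "0 < a" and \<beta>: "0 < \<beta>"
    and growth: "\<And>m v. m0 \<le> m \<Longrightarrow> m * a \<le> real v \<Longrightarrow> real v < m * b
      \<Longrightarrow> 2 * \<beta> \<le> (child_sum P A B ^^ k) (window (m * a') (m * b')) v"
  shows "spreads a b a' b' k \<beta>"
proof -
  obtain C where C: "0 \<le> C" and var: "\<And>h n D. (\<And>i. 0 \<le> h i \<and> h i \<le> 1) \<Longrightarrow> adapted n D \<Longrightarrow>
    (\<integral>\<omega>. (total (n * B ^ k) h ((child_event A ^^ k) D) \<omega> - total n ((child_sum P A B ^^ k) h) D \<omega>)\<^sup>2 \<partial>M)
      \<le> C * (\<integral>\<omega>. total n (\<lambda>_. 1) D \<omega> \<partial>M)"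
    using total_iter_variance[OF A, of k] by blast
  have "tree.prob (spread_failure (m * a) (m * b) (m * a') (m * b') k \<beta> N d) \<le> C / \<beta>\<^sup>2 / N"
    if m: "max m0 (1 / a) \<le> m" and N: "0 < N" for m N d
  proof -
    \<comment> \<open>All labels of the source window are positive, which gives
      \<open>D 0 = {}\<close> as \<open>adapted\<close> demands.\<close>
    have ma: "1 \<le> m * a" using m a by (simp add: field_simps)
    define r where "r = nat \<lceil>N\<rceil>"
    have r: "0 < r" "N \<le> real r" using N unfolding r_def by linarith+
    define W where "W \<omega> = {v. m * a \<le> real v \<and> real v < m * b \<and> ancestor v d \<omega> = 0}" for \<omega>
    define D where "D v = {\<omega> \<in> space M. v \<in> W \<omega> \<and> card {u \<in> W \<omega>. u < v} < r}" for v
    define n where "n = nat \<lceil>m * b\<rceil>"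
    have Wn: "v < n" "1 \<le> v" if "v \<in> W \<omega>" for v \<omega>
    proof -
      have v: "m * a \<le> real v" "real v < m * b" using that by (auto simp: W_def)
      show "v < n" using v(2) unfolding n_def by linarith
      show "1 \<le> v" using v(1) ma by linarith
    qed
    have finW: "finite (W \<omega>)" for \<omega> unfolding W_def by (rule finite_shallow)
    have inW: "{\<omega> \<in> space M. u \<in> W \<omega>} \<in> sets (past (Suc v))" if "u \<le> v" for u v
    proof -
      have "{\<omega> \<in> space M. u \<in> W \<omega>} = (if m * a \<le> real u \<and> real u < m * b then {\<omega> \<in> space M. ancestor u d \<omega> = 0} else {})"
        by (auto simp: W_def)
      then show ?thesis using ancestor_eq_past[of u "Suc v" d 0] that by auto
    qed
    have D: "adapted n D"
    proof -
      \<comment> \<open>Selection of \<open>v\<close> counts only the elements of \<open>W\<close>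
        below \<open>v\<close>, so it is decided by the attachments up to \<open>v\<close>.\<close>
      have "D v \<in> sets (past (Suc v))" for v
      proof -
        have "real (card {u \<in> W \<omega>. u < v}) = (\<Sum>u<v. indicator {\<omega> \<in> space M. u \<in> W \<omega>} \<omega>)" if "\<omega> \<in> space M" for \<omega>
        proof -
          have "(\<Sum>u<v. indicator {\<omega> \<in> space M. u \<in> W \<omega>} \<omega> :: real) = (\<Sum>u<v. if u \<in> W \<omega> then 1 else 0)"
            using that by (intro sum.cong refl) auto
          also have "\<dots> = (\<Sum>u\<in>{..<v} \<inter> W \<omega>. 1)" by (rule sum.inter_restrict[symmetric]) simp
          also have "{..<v} \<inter> W \<omega> = {u \<in> W \<omega>. u < v}" by auto
          finally show ?thesis by simp
        qed
        moreover have [measurable]: "{\<omega> \<in> space M. u \<in> W \<omega>} \<in> sets (past (Suc v))" if "u \<in> {..<v}" for u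
          using that by (intro inW) auto
        have "(\<lambda>\<omega>. \<Sum>u<v. indicator {\<omega> \<in> space M. u \<in> W \<omega>} \<omega> :: real) \<in> borel_measurable (past (Suc v))"
          by measurable
        ultimately have "(\<lambda>\<omega>. real (card {u \<in> W \<omega>. u < v})) \<in> borel_measurable (past (Suc v))"
          by (subst measurable_cong) auto
        then have "{\<omega> \<in> space (past (Suc v)). real (card {u \<in> W \<omega>. u < v}) < real r} \<in> sets (past (Suc v))"
          by (rule borel_measurable_less[OF _ borel_measurable_const])
        then have "{\<omega> \<in> space M. v \<in> W \<omega>} \<inter> {\<omega> \<in> space (past (Suc v)). real (card {u \<in> W \<omega>. u < v}) < real r} \<in> sets (past (Suc v))"
          by (rule sets.Int[OF inW[OF order_refl]])
        also have "{\<omega> \<in> space M. v \<in> W \<omega>} \<inter> {\<omega> \<in> space (past (Suc v)). real (card {u \<in> W \<omega>. u < v}) < real r} = D v"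
          by (auto simp: D_def)
        finally show ?thesis .
      qed
      moreover have "D v = {}" if "v = 0 \<or> n \<le> v" for v
      proof -
        have "v \<notin> W \<omega>" for \<omega> using Wn[of v \<omega>] that by auto
        then show ?thesis by (simp add: D_def)
      qed
      ultimately show ?thesis by (auto simp: adapted_def)
    qed
    have total_D: "total n (\<lambda>_. c) D \<omega> = c * card {v \<in> W \<omega>. card {u \<in> W \<omega>. u < v} < r}" if "\<omega> \<in> space M" for \<omega> c
    proof -
      have "total n (\<lambda>_. c) D \<omega> = (\<Sum>v<n. if v \<in> {v \<in> W \<omega>. card {u \<in> W \<omega>. u < v} < r} then c else 0)"
        unfolding total_def using that by (intro sum.cong refl) (auto simp: D_def indicator_def)
      also have "\<dots> = (\<Sum>v\<in>{..<n} \<inter> {v \<in> W \<omega>. card {u \<in> W \<omega>. u < v} < r}. c)"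
        by (rule sum.inter_restrict[symmetric]) simp
      also have "{..<n} \<inter> {v \<in> W \<omega>. card {u \<in> W \<omega>. u < v} < r} = {v \<in> W \<omega>. card {u \<in> W \<omega>. u < v} < r}"
        using Wn by auto
      finally show ?thesis by simp
    qed
    define h where "h = window (m * a') (m * b')"
    have h01: "0 \<le> h i \<and> h i \<le> 1" for i by (simp add: h_def window_def)
    define Z Z0 where "Z = total (n * B ^ k) h ((child_event A ^^ k) D)"
      and "Z0 = total n ((child_sum P A B ^^ k) h) D"
    define bad where "bad = spread_failure (m * a) (m * b) (m * a') (m * b') k \<beta> N d"
    have bad_sets: "bad \<in> sets M" unfolding bad_def by (rule spread_failure_sets)
    have Z_le: "Z \<omega> \<le> shallow_count (m * a') (m * b') (d + k) \<omega>" if \<omega>: "\<omega> \<in> space M" for \<omega>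
    proof -
      define n' where "n' = max (n * B ^ k) (nat \<lceil>m * b'\<rceil>)"
      have n': "m * b' \<le> real n'" unfolding n'_def by linarith
      have "Z \<omega> \<le> total n' h ((child_event A ^^ k) D) \<omega>"
        unfolding Z_def total_def using h01 by (intro sum_mono2) (auto simp: n'_def)
      also have "\<dots> \<le> total n' h (\<lambda>v. {\<omega> \<in> space M. ancestor v (d + k) \<omega> = 0}) \<omega>"
        unfolding total_def
      proof (intro sum_mono mult_left_mono)
        fix v
        have "(child_event A ^^ k) D v \<subseteq> {\<omega> \<in> space M. ancestor v (d + k) \<omega> = 0}"
          by (rule child_event_ancestor) (auto simp: D_def W_def)
        then show "indicator ((child_event A ^^ k) D v) \<omega> \<le> (indicator {\<omega> \<in> space M. ancestor v (d + k) \<omega> = 0} \<omega> :: real)"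
          by (auto simp: indicator_def)
      qed (use h01 in auto)
      also have "\<dots> = shallow_count (m * a') (m * b') (d + k) \<omega>"
        unfolding h_def using shallow_count_eq_total[OF \<omega> n'] by simp
      finally show ?thesis .
    qed
    have dev: "(\<beta> * r)\<^sup>2 \<le> (Z \<omega> - Z0 \<omega>)\<^sup>2" if "\<omega> \<in> bad" for \<omega>
    proof -
      have \<omega>: "\<omega> \<in> space M" "N \<le> card (W \<omega>)" "real (shallow_count (m * a') (m * b') (d + k) \<omega>) < \<beta> * N"
        using that by (auto simp: bad_def spread_failure_def shallow_count_def W_def)
      have "r \<le> card (W \<omega>)" using \<omega>(2) unfolding r_def by linarith
      then have card: "card {v \<in> W \<omega>. card {u \<in> W \<omega>. u < v} < r} = r" by (rule card_initial_segment(2)[OF finW])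
      have "2 * \<beta> * r = total n (\<lambda>_. 2 * \<beta>) D \<omega>" unfolding total_D[OF \<omega>(1)] card by simp
      also have "\<dots> \<le> Z0 \<omega>" unfolding Z0_def total_def
      proof (intro sum_mono)
        fix v
        show "2 * \<beta> * indicator (D v) \<omega> \<le> (child_sum P A B ^^ k) h v * indicator (D v) \<omega>"
        proof (cases "\<omega> \<in> D v")
          case True
          then have "m * a \<le> real v" "real v < m * b" by (auto simp: D_def W_def)
          then show ?thesis using growth[of m v] m True by (simp add: h_def)
        qed simp
      qed
      finally have "2 * \<beta> * r \<le> Z0 \<omega>" .
      moreover have "Z \<omega> \<le> \<beta> * r"
        using Z_le[OF \<omega>(1)] \<omega>(3) r(2) \<beta> mult_left_mono[OF r(2), of \<beta>] by linarith
      ultimately have "\<bar>\<beta> * r\<bar> \<le> \<bar>Z \<omega> - Z0 \<omega>\<bar>" using \<beta> by simp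
      then show ?thesis by (simp add: abs_le_square_iff)
    qed
    have Dk: "adapted (n * B ^ k) ((child_event A ^^ k) D)" by (rule child_event_iter_adapted[OF D A])
    have "(\<beta> * r)\<^sup>2 * tree.prob bad = (\<integral>\<omega>. (\<beta> * r)\<^sup>2 * indicator bad \<omega> \<partial>M)"
      using bad_sets sets.sets_into_space[OF bad_sets] by (simp add: Int_absorb2)
    also have "\<dots> \<le> (\<integral>\<omega>. (Z \<omega> - Z0 \<omega>)\<^sup>2 \<partial>M)"
    proof (rule integral_mono)
      show "integrable M (\<lambda>\<omega>. (\<beta> * r)\<^sup>2 * indicator bad \<omega>)" by (intro integrable_mult_right integrable_indicator_event bad_sets)
      show "integrable M (\<lambda>\<omega>. (Z \<omega> - Z0 \<omega>)\<^sup>2)" unfolding Z_def Z0_def by (rule integrable_total_diff_square[OF Dk D])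
      show "(\<beta> * r)\<^sup>2 * indicator bad \<omega> \<le> (Z \<omega> - Z0 \<omega>)\<^sup>2" for \<omega>
        using dev[of \<omega>] by (cases "\<omega> \<in> bad") simp_all
    qed
    also have "\<dots> \<le> C * (\<integral>\<omega>. total n (\<lambda>_. 1) D \<omega> \<partial>M)" unfolding Z_def Z0_def by (rule var[OF h01 D])
    also have "(\<integral>\<omega>. total n (\<lambda>_. 1) D \<omega> \<partial>M) \<le> (\<integral>\<omega>. real r \<partial>M)"
    proof (rule integral_mono[OF integrable_total[OF D]])
      show "total n (\<lambda>_. 1) D \<omega> \<le> real r" if "\<omega> \<in> space M" for \<omega>
        unfolding total_D[OF that] using card_initial_segment(1)[OF finW, of \<omega> r] by simp
    qed simp
    also have "(\<integral>\<omega>. real r \<partial>M) = real r" using tree.prob_space by simp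
    finally have "(\<beta> * r)\<^sup>2 * tree.prob bad \<le> C * r" using C by (simp add: mult_left_mono)
    then have "tree.prob bad \<le> C * r / (\<beta> * r)\<^sup>2" using \<beta> r by (simp add: field_simps)
    also have "\<dots> = C / \<beta>\<^sup>2 / r" using r by (simp add: power2_eq_square field_simps)
    also have "\<dots> \<le> C / \<beta>\<^sup>2 / N" using r N C by (intro divide_left_mono) auto
    finally show ?thesis by (simp add: bad_def)
  qed
  moreover have "0 \<le> C / \<beta>\<^sup>2" using C by simp
  ultimately show ?thesis unfolding spreads_def by (intro exI[of _ "C / \<beta>\<^sup>2"]) blast
qed

end

section \<open>Growth of the set of shallow nodes\<close>

context sarrt
begin

section \<open>Rules for combining \<open>spreads\<close>\<close>

lemma shallow_count_mono:
  assumes "a' \<le> a" "b \<le> b'" "d \<le> d'"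
  shows "shallow_count a b d \<omega> \<le> shallow_count a' b' d' \<omega>"
  unfolding shallow_count_def
  by (rule card_mono[OF finite_shallow]) (use assms ancestor_eq_0_mono in \<open>auto intro: order_trans\<close>)

lemma shallow_count_split:
  "shallow_count a b d \<omega> \<le> shallow_count a c d \<omega> + shallow_count c b d \<omega>"
proof -
  have "shallow_count a b d \<omega> \<le> card ({v. a \<le> real v \<and> real v < c \<and> ancestor v d \<omega> = 0} \<union> {v. c \<le> real v \<and> real v < b \<and> ancestor v d \<omega> = 0})"
    unfolding shallow_count_def by (rule card_mono) (auto simp: finite_shallow)
  also have "\<dots> \<le> shallow_count a c d \<omega> + shallow_count c b d \<omega>"
    unfolding shallow_count_def by (rule card_Un_le)
  finally show ?thesis .
qed

lemma spreads_mono: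
  assumes "spreads a b a' b' k \<beta>" "a \<le> a1" "b1 \<le> b" "a1' \<le> a'" "b' \<le> b1'" "k \<le> k1" "\<beta>1 \<le> \<beta>"
  shows "spreads a1 b1 a1' b1' k1 \<beta>1"
proof -
  obtain C m0 where C: "0 \<le> C" and *: "\<And>m N d. m0 \<le> m \<Longrightarrow> 0 < N \<Longrightarrow>
    tree.prob (spread_failure (m * a) (m * b) (m * a') (m * b') k \<beta> N d) \<le> C / N"
    using assms(1) unfolding spreads_def by blast
  have "tree.prob (spread_failure (m * a1) (m * b1) (m * a1') (m * b1') k1 \<beta>1 N d) \<le> C / N"
    if m: "max m0 0 \<le> m" and N: "0 < N" for m N d
  proof -
    have "tree.prob (spread_failure (m * a1) (m * b1) (m * a1') (m * b1') k1 \<beta>1 N d)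
      \<le> tree.prob (spread_failure (m * a) (m * b) (m * a') (m * b') k \<beta> N d)"
    proof (rule tree.finite_measure_mono)
      have 1: "shallow_count (m * a1) (m * b1) d \<omega> \<le> shallow_count (m * a) (m * b) d \<omega>" for \<omega>
        using assms m by (intro shallow_count_mono mult_left_mono) auto
      have 2: "shallow_count (m * a') (m * b') (d + k) \<omega> \<le> shallow_count (m * a1') (m * b1') (d + k1) \<omega>" for \<omega>
        using assms m by (intro shallow_count_mono mult_left_mono) auto
      have 3: "\<beta>1 * N \<le> \<beta> * N" using assms N by (intro mult_right_mono) auto
      show "spread_failure (m * a1) (m * b1) (m * a1') (m * b1') k1 \<beta>1 N d
        \<subseteq> spread_failure (m * a) (m * b) (m * a') (m * b') k \<beta> N d"
        unfolding spread_failure_def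
      proof safe
        fix \<omega> assume "N \<le> real (shallow_count (m * a1) (m * b1) d \<omega>)"
        then show "N \<le> real (shallow_count (m * a) (m * b) d \<omega>)" using 1[of \<omega>] by linarith
      next
        fix \<omega> assume "real (shallow_count (m * a1') (m * b1') (d + k1) \<omega>) < \<beta>1 * N"
        then show "real (shallow_count (m * a') (m * b') (d + k) \<omega>) < \<beta> * N" using 2[of \<omega>] 3 by linarith
      qed
    qed measurable
    also have "\<dots> \<le> C / N" using m N by (intro *) auto
    finally show ?thesis .
  qed
  then show ?thesis unfolding spreads_def using C by (intro exI[of _ C] conjI exI[of _ "max m0 0"]) auto
qed

lemma prob_le_add:
  assumes "E \<subseteq> E1 \<union> E2" "E1 \<in> sets M" "E2 \<in> sets M" "tree.prob E1 \<le> p1" "tree.prob E2 \<le> p2"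
  shows "tree.prob E \<le> p1 + p2"
proof -
  have "tree.prob E \<le> tree.prob (E1 \<union> E2)" using assms by (intro tree.finite_measure_mono) auto
  also have "\<dots> \<le> tree.prob E1 + tree.prob E2" using assms by (intro measure_Un_le) auto
  finally show ?thesis using assms by linarith
qed

text \<open>Of \<open>N\<close> nodes at least half lie in one of the two pieces; using its bound
  with \<open>N / 2\<close> halves the growth factor.\<close>

lemma spreads_union:
  assumes "spreads a c a' b' k \<beta>" "spreads c b a' b' k \<beta>"
  shows "spreads a b a' b' k (\<beta> / 2)"
proof -
  obtain C1 m1 where C1: "0 \<le> C1" and 1: "\<And>m N d. m1 \<le> m \<Longrightarrow> 0 < N \<Longrightarrow>
    tree.prob (spread_failure (m * a) (m * c) (m * a') (m * b') k \<beta> N d) \<le> C1 / N"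
    using assms(1) unfolding spreads_def by blast
  obtain C2 m2 where C2: "0 \<le> C2" and 2: "\<And>m N d. m2 \<le> m \<Longrightarrow> 0 < N \<Longrightarrow>
    tree.prob (spread_failure (m * c) (m * b) (m * a') (m * b') k \<beta> N d) \<le> C2 / N"
    using assms(2) unfolding spreads_def by blast
  have "tree.prob (spread_failure (m * a) (m * b) (m * a') (m * b') k (\<beta> / 2) N d) \<le> (2 * C1 + 2 * C2) / N"
    if m: "max m1 m2 \<le> m" and N: "0 < N" for m N d
  proof -
    have "tree.prob (spread_failure (m * a) (m * b) (m * a') (m * b') k (\<beta> / 2) N d) \<le> C1 / (N / 2) + C2 / (N / 2)"
    proof (rule prob_le_add)
      show "spread_failure (m * a) (m * b) (m * a') (m * b') k (\<beta> / 2) N d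
        \<subseteq> spread_failure (m * a) (m * c) (m * a') (m * b') k \<beta> (N / 2) d
        \<union> spread_failure (m * c) (m * b) (m * a') (m * b') k \<beta> (N / 2) d"
        unfolding spread_failure_def
      proof safe
        fix \<omega> assume h: "N \<le> real (shallow_count (m * a) (m * b) d \<omega>)"
          "\<not> N / 2 \<le> real (shallow_count (m * c) (m * b) d \<omega>)"
        have "real (shallow_count (m * a) (m * b) d \<omega>)
          \<le> real (shallow_count (m * a) (m * c) d \<omega>) + real (shallow_count (m * c) (m * b) d \<omega>)"
          using shallow_count_split[of "m * a" "m * b" d \<omega> "m * c"] by linarith
        then show "N / 2 \<le> real (shallow_count (m * a) (m * c) d \<omega>)" using h by linarith
      qed auto
      show "tree.prob (spread_failure (m * a) (m * c) (m * a') (m * b') k \<beta> (N / 2) d) \<le> C1 / (N / 2)"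
        using m N by (intro 1) auto
      show "tree.prob (spread_failure (m * c) (m * b) (m * a') (m * b') k \<beta> (N / 2) d) \<le> C2 / (N / 2)"
        using m N by (intro 2) auto
    qed measurable
    then show ?thesis by (simp add: add_divide_distrib mult.commute)
  qed
  then show ?thesis unfolding spreads_def using C1 C2
    by (intro exI[of _ "2 * C1 + 2 * C2"] conjI exI[of _ "max m1 m2"]) auto
qed

lemma spreads_compose:
  assumes "spreads a b a' b' k \<beta>" "spreads a' b' a'' b'' k' \<beta>'" "0 < \<beta>"
  shows "spreads a b a'' b'' (k + k') (\<beta> * \<beta>')"
proof -
  obtain C1 m1 where C1: "0 \<le> C1" and 1: "\<And>m N d. m1 \<le> m \<Longrightarrow> 0 < N \<Longrightarrow>
    tree.prob (spread_failure (m * a) (m * b) (m * a') (m * b') k \<beta> N d) \<le> C1 / N"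
    using assms(1) unfolding spreads_def by blast
  obtain C2 m2 where C2: "0 \<le> C2" and 2: "\<And>m N d. m2 \<le> m \<Longrightarrow> 0 < N \<Longrightarrow>
    tree.prob (spread_failure (m * a') (m * b') (m * a'') (m * b'') k' \<beta>' N d) \<le> C2 / N"
    using assms(2) unfolding spreads_def by blast
  have "tree.prob (spread_failure (m * a) (m * b) (m * a'') (m * b'') (k + k') (\<beta> * \<beta>') N d) \<le> (C1 + C2 / \<beta>) / N"
    if m: "max m1 m2 \<le> m" and N: "0 < N" for m N d
  proof -
    have "tree.prob (spread_failure (m * a) (m * b) (m * a'') (m * b'') (k + k') (\<beta> * \<beta>') N d) \<le> C1 / N + C2 / (\<beta> * N)"
    proof (rule prob_le_add)
      show "spread_failure (m * a) (m * b) (m * a'') (m * b'') (k + k') (\<beta> * \<beta>') N d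
        \<subseteq> spread_failure (m * a) (m * b) (m * a') (m * b') k \<beta> N d
        \<union> spread_failure (m * a') (m * b') (m * a'') (m * b'') k' \<beta>' (\<beta> * N) (d + k)"
        by (auto simp: spread_failure_def add.assoc mult_ac)
      show "tree.prob (spread_failure (m * a) (m * b) (m * a') (m * b') k \<beta> N d) \<le> C1 / N"
        using m N by (intro 1) auto
      show "tree.prob (spread_failure (m * a') (m * b') (m * a'') (m * b'') k' \<beta>' (\<beta> * N) (d + k)) \<le> C2 / (\<beta> * N)"
        using m N assms(3) by (intro 2) auto
    qed measurable
    then show ?thesis by (simp add: add_divide_distrib)
  qed
  then show ?thesis unfolding spreads_def using C1 C2 assms(3)
    by (intro exI[of _ "C1 + C2 / \<beta>"] conjI exI[of _ "max m1 m2"]) auto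
qed

lemma spreads_scale:
  assumes "spreads a b a' b' k \<beta>" "0 < c"
  shows "spreads (c * a) (c * b) (c * a') (c * b') k \<beta>"
proof -
  obtain C m0 where C: "0 \<le> C" and *: "\<And>m N d. m0 \<le> m \<Longrightarrow> 0 < N \<Longrightarrow>
    tree.prob (spread_failure (m * a) (m * b) (m * a') (m * b') k \<beta> N d) \<le> C / N"
    using assms(1) unfolding spreads_def by blast
  have "tree.prob (spread_failure (m * (c * a)) (m * (c * b)) (m * (c * a')) (m * (c * b')) k \<beta> N d) \<le> C / N"
    if "m0 / c \<le> m" "0 < N" for m N d
  proof -
    have "m0 \<le> m * c" using that assms(2) by (simp add: field_simps)
    from *[OF this that(2), of d] show ?thesis by (simp add: mult.assoc)
  qed
  then show ?thesis unfolding spreads_def using C by (intro exI[of _ C] conjI exI[of _ "m0 / c"]) auto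
qed

text \<open>Each attachment value in \<open>{x0..x1}\<close> makes at least one label a child of
  \<open>v\<close>, so the expected number of children through this cell is at least its
  probability. The resulting growth factor is below 1, which is harmless for a bounded number of
  generations.\<close>

lemma spreads_cell:
  assumes x: "0 < x0" "x1 < 1" and p: "0 < prob {x0..x1}" and a: "0 < a" "a \<le> b"
    and a': "a' \<le> a / x1" and b': "b / x0 < b'"
  shows "spreads a b a' b' 1 (prob {x0..x1} / 2)"
proof -
  obtain n :: nat where n: "1 / x0 < real n" using reals_Archimedean2 by blast
  define B where "B = Suc n"
  have B: "0 < B" "1 / real B \<le> x0"
  proof -
    show "0 < B" by (simp add: B_def)
    have "1 < real n * x0" using n x by (simp add: field_simps)
    then have "1 \<le> real B * x0" using x by (simp add: B_def algebra_simps)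
    then show "1 / real B \<le> x0" by (simp add: B_def field_simps)
  qed
  define A where "A = {x0..x1}"
  have A: "A \<in> sets borel" "A \<subseteq> {1 / real B..<1}" using B x by (auto simp: A_def)
  \<comment> \<open>Rounding adds at most \<open>1 / x0\<close> to a child label; the slack
    \<open>e\<close> absorbs this once \<open>m * e \<ge> 1\<close>.\<close>
  define e where "e = b' * x0 - b"
  have e: "0 < e" using b' x by (simp add: e_def field_simps)
  show ?thesis unfolding A_def[symmetric]
  proof (rule spreads_iter[OF A B(1) a(1), of _ "1 / e"])
    show "0 < prob A / 2" using p by (simp add: A_def)
    fix m :: real and v :: nat
    assume m: "1 / e \<le> m" and v: "m * a \<le> real v" "real v < m * b"
    have me: "1 \<le> m * e" using m e by (simp add: field_simps)
    have m0: "0 < m" using m e by (smt (verit) divide_pos_pos)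
    have "prob A = (\<integral>x. indicator A x \<partial>P)" by simp
    also have "\<dots> \<le> (\<integral>x. indicator A x * (\<Sum>i<(v+1)*B. window (m * a') (m * b') i * indicator (hit i v) x) \<partial>P)"
    proof (rule integral_mono)
      show "integrable P (indicator A :: real \<Rightarrow> real)" using A by (intro integrable_real_indicator) (auto simp: emeasure_eq_measure)
      show "integrable P (\<lambda>x. indicator A x * (\<Sum>i<(v+1)*B. window (m * a') (m * b') i * indicator (hit i v) x))"
      proof (rule integrable_const_bound)
        show "AE x in P. norm (indicator A x * (\<Sum>i<(v+1)*B. window (m * a') (m * b') i * indicator (hit i v) x)) \<le> (\<Sum>i<(v+1)*B. 1)"
        proof (rule AE_I2)
          fix x
          have "(\<Sum>i<(v+1)*B. window (m * a') (m * b') i * indicator (hit i v) x) \<le> (\<Sum>i<(v+1)*B. 1)"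
            by (intro sum_mono) (auto simp: window_def indicator_def)
          moreover have "0 \<le> (\<Sum>i<(v+1)*B. window (m * a') (m * b') i * indicator (hit i v) x)"
            by (intro sum_nonneg) (auto simp: window_def)
          ultimately show "norm (indicator A x * (\<Sum>i<(v+1)*B. window (m * a') (m * b') i * indicator (hit i v) x)) \<le> (\<Sum>i<(v+1)*B. 1)"
            by (cases "x \<in> A") (simp_all only: indicator_simps mult_1 mult_zero_left norm_zero real_norm_def abs_of_nonneg, simp)
        qed
      qed (use A(1) in measurable)
      fix x
      show "indicator A x \<le> indicator A x * (\<Sum>i<(v+1)*B. window (m * a') (m * b') i * indicator (hit i v) x)"
      proof (cases "x \<in> A")
        case True
        then have xx: "x0 \<le> x" "x \<le> x1" "0 < x" using x by (auto simp: A_def)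
        have "(\<Sum>i<(v+1)*B. window (m * a') (m * b') i * indicator (hit i v) x) = hits B v x"
          unfolding hits_def
        proof (intro sum.cong refl)
          fix i
          show "window (m * a') (m * b') i * indicator (hit i v) x = (indicator (hit i v) x :: real)"
          proof (cases "x \<in> hit i v")
            case True
            then have h: "real v \<le> i * x" "i * x < real v + 1" using xx by (auto simp: hit_iff)
            have "m * a \<le> i * x1" using v h xx mult_left_mono[of x x1 "real i"] by linarith
            then have "m * (a / x1) \<le> i" using xx by (simp add: field_simps)
            moreover have "m * a' \<le> m * (a / x1)" using a' m0 by (intro mult_left_mono) auto
            moreover have "i * x0 < m * b + 1" using v h xx mult_left_mono[of x0 x "real i"] by linarith
            then have "i * x0 < m * b' * x0" using me by (simp add: e_def algebra_simps)
            then have "i < m * b'" using x by simp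
            ultimately show ?thesis by (simp add: window_def)
          qed simp
        qed
        also have "1 \<le> \<dots>" using A True B by (intro hits_ge_1) auto
        finally show ?thesis using True by simp
      qed simp
    qed
    also have "\<dots> = child_sum P A B (window (m * a') (m * b')) v" by (rule child_sum_eq_integral[OF A(1), symmetric])
    finally show "2 * (prob A / 2) \<le> (child_sum P A B ^^ 1) (window (m * a') (m * b')) v" by simp
  qed
qed

text \<open>With a density the law has no atoms, so its distribution function is continuous. Some
  interval of ratio \<open>exp (1/10)\<close> is charged; a point \<open>s\<close> halving its mass
  and a small gap around \<open>s\<close> leave a charged cell on either side.\<close>

lemma two_cells:
  "\<exists>u w s \<delta>. 0 < u \<and> u < s \<and> s < w \<and> w < 1 \<and> w \<le> u * exp (1/10) \<and> 0 < \<delta>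
    \<and> 0 < prob {u..s * exp (- \<delta>)} \<and> 0 < prob {s * exp \<delta>..w}"
proof -
  interpret F: finite_borel_measure P by unfold_locales simp
  have cont: "isCont (cdf P) x" for x
  proof -
    have "emeasure P {x} = 0" unfolding P_eq by (subst emeasure_density) (auto intro!: nn_integral_null_set[unfolded null_sets_def] simp: mult.commute)
    then show ?thesis unfolding F.isCont_cdf by (simp add: measure_def)
  qed
  \<comment> \<open>Countably many intervals of this shape, with rational right endpoints, cover the
    open unit interval, so one of them is charged.\<close>
  have "\<exists>q\<in>\<rat>. q \<in> {0<..<1} \<and> 0 < prob {q * exp (- (1/10))<..q}"
  proof (rule ccontr)
    assume no: "\<not> ?thesis"
    have "AE x in P. x \<notin> {q * exp (- (1/10))<..q}" if q: "q \<in> \<rat> \<inter> {0<..<1}" for q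
    proof -
      have "prob {q * exp (- (1/10))<..q} = 0"
        using no q measure_nonneg[of P "{q * exp (- (1/10))<..q}"] by (metis IntD1 IntD2 less_eq_real_def)
      then show ?thesis by (subst (asm) prob_eq_0) auto
    qed
    then have "AE x in P. \<forall>q\<in>\<rat> \<inter> {0<..<1}. x \<notin> {q * exp (- (1/10))<..q}"
      by (subst AE_ball_countable) (auto simp: countable_rat)
    with in_unit have "AE x in P. False"
    proof eventually_elim
      case (elim x)
      have "x < min 1 (x * exp (1/10))" using elim by simp
      then obtain q where q: "q \<in> \<rat>" "x < q" "q < min 1 (x * exp (1/10))" using Rats_dense_in_real by blast
      then have "q * exp (- (1/10)) < x" by (simp add: exp_minus field_simps)
      then show ?case using elim q by force
    qed
    then show False by simp
  qed
  then obtain w where w: "0 < w" "w < 1" and p: "0 < prob {w * exp (- (1/10))<..w}" by auto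
  define u where "u = w * exp (- (1/10))"
  have u: "0 < u" "u < w" using w by (auto simp: u_def)
  have cuw: "cdf P u < cdf P w" using F.cdf_diff_eq[OF u(2)] p by (simp add: u_def)
  have "\<exists>s\<ge>u. s \<le> w \<and> cdf P s = (cdf P u + cdf P w) / 2"
    using cont u cuw by (intro IVT) auto
  then obtain s where s: "u \<le> s" "s \<le> w" "cdf P s = (cdf P u + cdf P w) / 2" by blast
  have su: "u < s" "s < w" using s cuw by (auto simp: order_less_le)
  have "((\<lambda>d. cdf P (s * exp (- d))) \<longlongrightarrow> cdf P (s * exp (- 0))) (at_right 0)"
    by (intro isCont_tendsto_compose[OF cont] tendsto_intros)
  then have 1: "\<forall>\<^sub>F d in at_right 0. cdf P u < cdf P (s * exp (- d))"
    using order_tendstoD(1)[of _ "cdf P s" _ "cdf P u"] s cuw by simp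
  have "((\<lambda>d. cdf P (s * exp d)) \<longlongrightarrow> cdf P (s * exp 0)) (at_right 0)"
    by (intro isCont_tendsto_compose[OF cont] tendsto_intros)
  then have 2: "\<forall>\<^sub>F d in at_right 0. cdf P (s * exp d) < cdf P w"
    using order_tendstoD(2)[of _ "cdf P s" _ "cdf P w"] s cuw by simp
  have "\<forall>\<^sub>F d in at_right 0. 0 < d \<and> cdf P u < cdf P (s * exp (- d)) \<and> cdf P (s * exp d) < cdf P w"
    using 1 2 eventually_at_right_less by eventually_elim simp
  then obtain d where d: "0 < d" "cdf P u < cdf P (s * exp (- d))" "cdf P (s * exp d) < cdf P w"
    using eventually_happens'[OF trivial_limit_at_right_real] by blast
  have "u < s * exp (- d)" using d(2) F.cdf_nondecreasing by (metis linorder_not_less)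
  then have "prob {u<..s * exp (- d)} = cdf P (s * exp (- d)) - cdf P u" by (simp add: F.cdf_diff_eq)
  then have "0 < prob {u<..s * exp (- d)}" using d by simp
  also have "\<dots> \<le> prob {u..s * exp (- d)}" by (intro finite_measure_mono) auto
  finally have p1: "0 < prob {u..s * exp (- d)}" .
  have "s * exp d < w" using d(3) F.cdf_nondecreasing by (metis linorder_not_less)
  then have "prob {s * exp d<..w} = cdf P w - cdf P (s * exp d)" by (simp add: F.cdf_diff_eq)
  then have "0 < prob {s * exp d<..w}" using d by simp
  also have "\<dots> \<le> prob {s * exp d..w}" by (intro finite_measure_mono) auto
  finally have p2: "0 < prob {s * exp d..w}" .
  have "w \<le> u * exp (1/10)" by (simp add: u_def mult.assoc flip: exp_add)
  then show ?thesis using u su w d p1 p2 by blast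
qed

text \<open>One step of steering: nodes ahead of the schedule \<open>s\<^sup>-\<^sup>1, s\<^sup>-\<^sup>2, \<dots>\<close> use attachments slightly
  above \<open>s\<close>, the other nodes use attachments slightly below \<open>s\<close>, so the deviation
  from the schedule shrinks.\<close>

lemma spreads_steer:
  assumes s: "0 < u" "u < s" "s < w" "w < 1" "w \<le> u * exp (1/10)" "0 < \<delta>"
    and p: "0 < prob {u..s * exp (- \<delta>)}" "0 < prob {s * exp \<delta>..w}" and r: "0 < r"
  defines "r' \<equiv> max (r - \<delta> / 2) (1/5)"
  shows "\<exists>\<beta>>0. spreads (exp (- r)) (exp r) (exp (- r') / s) (exp r' / s) 1 \<beta>"
proof -
  have s0: "0 < s" using s by simp
  \<comment> \<open>A step gains \<open>\<delta>\<close> on the outer side; half of it is given up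
    for the strict inequality in \<open>spreads_cell\<close>. The floor \<open>1/5\<close> leaves
    room on the other side: a node on schedule can overshoot, but \<open>u\<close> and
    \<open>w\<close> are within a factor \<open>exp (1/10)\<close> of \<open>s\<close>.\<close>
  have r': "r - \<delta> / 2 \<le> r'" "1/5 \<le> r'" by (simp_all add: r'_def)
  have ws: "w \<le> s * exp (1/10)"
  proof -
    have "w \<le> u * exp (1/10)" by (rule s(5))
    also have "\<dots> \<le> s * exp (1/10)" using s by simp
    finally show ?thesis .
  qed
  have su: "s \<le> u * exp (1/10)" using s by simp
  have ahead: "spreads 1 (exp r) (exp (- r') / s) (exp r' / s) 1 (prob {s * exp \<delta>..w} / 2)"
  proof (rule spreads_cell)
    show "exp (- r') / s \<le> 1 / w"
    proof -
      have "exp (- r') * w \<le> exp (- r') * (s * exp (1/10))" using ws by (intro mult_left_mono) auto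
      also have "\<dots> = s * exp (1/10 - r')" by (simp add: mult.left_commute flip: exp_add)
      also have "\<dots> \<le> s * 1" using r' s0 by (intro mult_left_mono) auto
      finally show ?thesis using s0 s by (simp add: field_simps)
    qed
    have "exp (r - \<delta>) < exp r'" using r' s by simp
    then show "exp r / (s * exp \<delta>) < exp r' / s" using s0 by (simp add: exp_diff divide_simps)
  qed (use s s0 p r in auto)
  have behind: "spreads (exp (- r)) 1 (exp (- r') / s) (exp r' / s) 1 (prob {u..s * exp (- \<delta>)} / 2)"
  proof (rule spreads_cell)
    have "s * exp (- \<delta>) < 1 * 1" using s s0 by (intro mult_strict_mono) auto
    then show "s * exp (- \<delta>) < 1" by simp
    have "exp (- r') \<le> exp (\<delta> - r)" using r' s by simp
    then have "exp (- r') / s \<le> exp (\<delta> - r) / s" using s0 by (intro divide_right_mono) auto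
    also have "\<dots> = exp (- r) / (s * exp (- \<delta>))" using s0 by (simp add: exp_diff exp_minus field_simps)
    finally show "exp (- r') / s \<le> exp (- r) / (s * exp (- \<delta>))" .
    have "s \<le> u * exp (1/10)" by (rule su)
    also have "\<dots> < u * exp r'" using s r' by simp
    finally show "1 / u < exp r' / s" using s s0 by (simp add: field_simps)
  qed (use s p r in auto)
  define \<beta> where "\<beta> = min (prob {s * exp \<delta>..w} / 2) (prob {u..s * exp (- \<delta>)} / 2)"
  have "spreads (exp (- r)) (exp r) (exp (- r') / s) (exp r' / s) 1 (\<beta> / 2)"
  proof (rule spreads_union)
    show "spreads (exp (- r)) 1 (exp (- r') / s) (exp r' / s) 1 \<beta>"
      by (rule spreads_mono[OF behind]) (auto simp: \<beta>_def)
    show "spreads 1 (exp r) (exp (- r') / s) (exp r' / s) 1 \<beta>"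
      by (rule spreads_mono[OF ahead]) (auto simp: \<beta>_def)
  qed
  moreover have "0 < \<beta> / 2" using p by (simp add: \<beta>_def)
  ultimately show ?thesis by blast
qed

text \<open>The block windows have an uncontrolled ratio \<open>\<rho>\<close>, while the depth is
  minimized over a window of ratio 2. Each steering step shortens the logarithmic half-width by
  \<open>\<delta> / 2\<close> until it is \<open>1/5\<close>; as \<open>exp (2/5) \<le> 2\<close>,
  the window then fits into \<open>{g / 2..<g}\<close>.\<close>

lemma spreads_final:
  assumes "1 < \<rho>"
  shows "\<exists>k g \<beta>. 0 < g \<and> 0 < \<beta> \<and> spreads 1 \<rho> (g / 2) g k \<beta>"
proof -
  obtain u w s \<delta> where s: "0 < u" "u < s" "s < w" "w < 1" "w \<le> u * exp (1/10)" "0 < \<delta>"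
    and p: "0 < prob {u..s * exp (- \<delta>)}" "0 < prob {s * exp \<delta>..w}"
    using two_cells by blast
  have s0: "0 < s" using s by simp
  \<comment> \<open>Steering works in windows centred at 1; the factor \<open>exp r\<close> at the
    end moves the left endpoint \<open>exp (- r)\<close> to 1.\<close>
  define r where "r = max (ln \<rho> / 2) (1/5)"
  have r: "0 < r" "ln \<rho> \<le> 2 * r" by (auto simp: r_def)
  define R where "R j = max (r - real j * (\<delta> / 2)) (1/5)" for j :: nat
  have iter: "\<exists>\<beta>>0. spreads (exp (- r)) (exp r) (exp (- R j) / s ^ j) (exp (R j) / s ^ j) j \<beta>" if "0 < j" for j
    using that
  proof (induction j rule: nat_induct_non_zero)
    case 1
    show ?case using spreads_steer[OF s p r(1)] by (simp add: R_def)
  next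
    case (Suc j)
    then obtain \<beta>1 where \<beta>1: "0 < \<beta>1" "spreads (exp (- r)) (exp r) (exp (- R j) / s ^ j) (exp (R j) / s ^ j) j \<beta>1" by blast
    have "0 < R j" by (simp add: R_def)
    have "max (max (r - t) (1/5) - \<delta> / 2) (1/5) = max (r - (t + \<delta> / 2)) (1/5)" for t
      using s(6) by (auto simp: max_def)
    moreover have "real (Suc j) * (\<delta> / 2) = real j * (\<delta> / 2) + \<delta> / 2"
      by (simp add: distrib_right add_divide_distrib)
    ultimately have R: "max (R j - \<delta> / 2) (1/5) = R (Suc j)" by (simp only: R_def)
    obtain \<beta>2 where \<beta>2: "0 < \<beta>2" "spreads (exp (- R j)) (exp (R j)) (exp (- R (Suc j)) / s) (exp (R (Suc j)) / s) 1 \<beta>2"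
      using spreads_steer[OF s p \<open>0 < R j\<close>] unfolding R by blast
    have "spreads (1 / s ^ j * exp (- R j)) (1 / s ^ j * exp (R j)) (1 / s ^ j * (exp (- R (Suc j)) / s)) (1 / s ^ j * (exp (R (Suc j)) / s)) 1 \<beta>2"
      using \<beta>2(2) s0 by (intro spreads_scale) auto
    then have "spreads (exp (- R j) / s ^ j) (exp (R j) / s ^ j) (exp (- R (Suc j)) / s ^ Suc j) (exp (R (Suc j)) / s ^ Suc j) 1 \<beta>2"
      by (simp add: mult.commute)
    from spreads_compose[OF \<beta>1(2) this \<beta>1(1)] \<beta>1 \<beta>2 show ?case by (intro exI[of _ "\<beta>1 * \<beta>2"]) simp
  qed
  obtain j :: nat where j: "r / (\<delta> / 2) < real j" using reals_Archimedean2 by blast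
  have "r < real j * (\<delta> / 2)" using j s by (simp add: field_simps)
  then have Rj: "R j = 1/5" by (simp add: R_def)
  have "0 < j" using j r s by (intro gr0I) (auto simp: field_simps)
  then obtain \<beta> where \<beta>: "0 < \<beta>" "spreads (exp (- r)) (exp r) (exp (- (1/5)) / s ^ j) (exp (1/5) / s ^ j) j \<beta>"
    using iter[OF \<open>0 < j\<close>] unfolding Rj by blast
  define g where "g = exp r * (exp (1/5) / s ^ j)"
  have "spreads (exp r * exp (- r)) (exp r * exp r) (exp r * (exp (- (1/5)) / s ^ j)) g j \<beta>"
    unfolding g_def using \<beta>(2) by (rule spreads_scale) simp
  then have "spreads 1 \<rho> (g / 2) g j \<beta>"
  proof (rule spreads_mono)
    show "exp r * exp (- r) \<le> 1" by (simp flip: exp_add)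
    have "\<rho> = exp (ln \<rho>)" using assms by simp
    also have "\<dots> \<le> exp (2 * r)" using r by (simp only: exp_le_cancel_iff)
    finally show "\<rho> \<le> exp r * exp r" by (simp flip: exp_add)
    have "exp (2/5 :: real) \<le> 2" using exp_bound[of "2/5 :: real"] by (simp add: power2_eq_square)
    then have "exp (1/5 :: real) / 2 \<le> exp (- (1/5))"
      by (simp add: exp_minus field_simps flip: exp_add)
    then have "exp r * (exp (1/5 :: real) / 2) / s ^ j \<le> exp r * exp (- (1/5)) / s ^ j"
      using s0 by (intro divide_right_mono mult_left_mono) auto
    then show "g / 2 \<le> exp r * (exp (- (1/5)) / s ^ j)" by (simp add: g_def)
  qed auto
  moreover have "0 < g" using s0 by (simp add: g_def)
  ultimately show ?thesis using \<beta>(1) by blast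
qed

section \<open>The self-reproducing window and the chain of blocks\<close>

lemma window_mono: "a' \<le> a \<Longrightarrow> b \<le> b' \<Longrightarrow> window a b i \<le> window a' b' i"
  by (auto simp: window_def)

text \<open>\<open>K1\<close> generations move labels by factors between \<open>exp b\<close> and
  \<open>exp W\<close>, too far for nodes near the top of the window. So the window of ratio
  \<open>exp (2 * W)\<close> is split at \<open>exp W\<close>: nodes of the lower part take
  \<open>K1\<close> generations, those of the upper part only \<open>K2\<close>, moving by at most
  \<open>exp b\<close>. Both parts land in the window multiplied by \<open>exp b\<close>, and fewer
  generations only help the depth.\<close>

lemma spreads_block:
  assumes c: "alpha_min P (\<lambda>x. x) < c"
  shows "\<exists>\<rho> b K. 1 < \<rho> \<and> 0 < b \<and> real K < c * b \<and> spreads 1 \<rho> (exp b) (exp b * \<rho>) K 2"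
proof -
  have c0: "0 < c" using alpha_min_nonneg[OF c] c by simp
  obtain B l where B: "0 < B" and mom: "0 < trunc_moment P B l"
    and xc: "1 / c < trunc_log_moment P B l / trunc_moment P B l"
    and grow: "0 < (l + 1) * (trunc_log_moment P B l / trunc_moment P B l) + ln (trunc_moment P B l)"
    using growth_above_alpha_min[OF c] by blast
  define x where "x = trunc_log_moment P B l / trunc_moment P B l"
  define A where "A = {1 / real B..<1}"
  have A: "A \<in> sets borel" "A \<subseteq> {1 / real B..<1}" by (simp_all add: A_def)
  have A01: "A \<subseteq> {0..<1}"
  proof
    fix y assume "y \<in> A" then show "y \<in> {0..<1}" using cell_subset_pos[OF B, of y] by (auto simp: A_def)
  qed
  have x: "1 / c < x" "0 < x" using xc c0 by (auto simp: x_def intro: less_trans[rotated])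
  obtain \<eta>0 where \<eta>0: "0 < \<eta>0" and ev: "\<And>\<eta>. 0 < \<eta> \<Longrightarrow> \<eta> < \<eta>0 \<Longrightarrow> \<exists>K0. \<forall>K\<ge>K0. \<forall>\<^sub>F v in sequentially.
    8 \<le> (child_sum P A B ^^ K) (window (v * exp (K * (x - \<eta>))) (v * exp (K * (x + \<eta>)))) v"
    using eventually_window_ge[OF B mom x_def, folded A_def] grow[folded x_def] by blast
  \<comment> \<open>\<open>x - \<eta>\<close> stays above \<open>1 / c\<close>, so that
    \<open>K1\<close> generations gain \<open>b > K1 / c\<close> in logarithmic label.\<close>
  define \<eta> where "\<eta> = min (\<eta>0 / 2) ((x - 1 / c) / 2)"
  have \<eta>: "0 < \<eta>" "\<eta> < \<eta>0" "1 / c < x - \<eta>" using \<eta>0 x by (auto simp: \<eta>_def min_def field_simps)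
  have x\<eta>: "0 < x - \<eta>" using \<eta> c0 by (intro less_trans[OF _ \<eta>(3)]) simp
  obtain K0 where K0: "\<And>K. K \<ge> K0 \<Longrightarrow> \<forall>\<^sub>F v in sequentially.
    8 \<le> (child_sum P A B ^^ K) (window (v * exp (K * (x - \<eta>))) (v * exp (K * (x + \<eta>)))) v"
    using ev[OF \<eta>(1,2)] by blast
  define K2 where "K2 = max K0 1"
  \<comment> \<open>Over \<open>K2\<close> generations the fastest growth in the windows stays below
    the slowest growth over \<open>K1\<close> generations.\<close>
  obtain K1' :: nat where "K2 * (x + \<eta>) / (x - \<eta>) < real K1'" using reals_Archimedean2 by blast
  then have K1': "K2 * (x + \<eta>) < K1' * (x - \<eta>)" using x\<eta> by (simp add: field_simps)
  define K1 where "K1 = max K1' K2"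
  have K1: "K2 \<le> K1" "K0 \<le> K1" "0 < K1" by (auto simp: K1_def K2_def)
  define b W where "b = K1 * (x - \<eta>)" and "W = K1 * (x + \<eta>)"
  have K2b: "K2 * (x + \<eta>) \<le> b"
  proof -
    have "K1' * (x - \<eta>) \<le> b" using x\<eta> by (auto simp: b_def K1_def intro!: mult_right_mono)
    then show ?thesis using K1' by simp
  qed
  have bW: "0 < b" "b \<le> W" "0 < W" using x\<eta> K1 x \<eta> by (auto simp: b_def W_def)
  have step: "spreads a1 b1 (exp b) (exp (b + 2 * W)) K 4"
    if a1: "1 \<le> a1" and K: "K0 \<le> K" and lo: "exp b \<le> a1 * exp (K * (x - \<eta>))"
      and hi: "b1 * exp (K * (x + \<eta>)) \<le> exp (b + 2 * W)" for a1 b1 K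
  proof -
    obtain v0 where v0: "\<And>v. v0 \<le> v \<Longrightarrow>
      8 \<le> (child_sum P A B ^^ K) (window (v * exp (K * (x - \<eta>))) (v * exp (K * (x + \<eta>)))) v"
      using K0[OF K] by (auto simp: eventually_sequentially)
    show ?thesis
    proof (rule spreads_iter[OF A B, of _ _ "max 0 (real v0)"])
      fix m :: real and v :: nat assume m: "max 0 (real v0) \<le> m" and v: "m * a1 \<le> real v" "real v < m * b1"
      have "m * 1 \<le> m * a1" using a1 m by (intro mult_left_mono) auto
      then have "v0 \<le> v" using m v by simp
      from v0[OF this] have "8 \<le> (child_sum P A B ^^ K) (window (v * exp (K * (x - \<eta>))) (v * exp (K * (x + \<eta>)))) v" .
      also have "\<dots> \<le> (child_sum P A B ^^ K) (window (m * exp b) (m * exp (b + 2 * W))) v"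
      proof (rule child_sum_pow_mono[OF window_mono A01])
        have "m * exp b \<le> m * (a1 * exp (K * (x - \<eta>)))" using lo m by (intro mult_left_mono) auto
        also have "\<dots> \<le> v * exp (K * (x - \<eta>))" using v by (simp add: mult.assoc[symmetric])
        finally show "m * exp b \<le> v * exp (K * (x - \<eta>))" .
        have "v * exp (K * (x + \<eta>)) \<le> m * b1 * exp (K * (x + \<eta>))" using v by (intro mult_right_mono) auto
        also have "\<dots> \<le> m * exp (b + 2 * W)" using hi m by (simp add: mult.assoc mult_left_mono)
        finally show "v * exp (K * (x + \<eta>)) \<le> m * exp (b + 2 * W)" .
      qed
      finally show "2 * 4 \<le> (child_sum P A B ^^ K) (window (m * exp b) (m * exp (b + 2 * W))) v" by simp
    qed (use a1 in auto)
  qed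
  have "spreads 1 (exp (2 * W)) (exp b) (exp (b + 2 * W)) K1 (4 / 2)"
  proof (rule spreads_union)
    show "spreads 1 (exp W) (exp b) (exp (b + 2 * W)) K1 4"
      using K1 bW by (intro step) (auto simp: b_def[symmetric] W_def[symmetric] simp flip: exp_add)
    have "spreads (exp W) (exp (2 * W)) (exp b) (exp (b + 2 * W)) K2 4"
      using bW x\<eta> K2b by (intro step) (auto simp: K2_def simp flip: exp_add intro: order_trans[of b W])
    then show "spreads (exp W) (exp (2 * W)) (exp b) (exp (b + 2 * W)) K1 4"
      by (rule spreads_mono) (use K1 in auto)
  qed
  moreover have "real K1 < c * b"
  proof -
    have "real K1 * 1 < real K1 * (c * (x - \<eta>))"
      using K1 \<eta>(3) c0 by (intro mult_strict_left_mono) (auto simp: field_simps)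
    then show ?thesis by (simp add: b_def mult_ac)
  qed
  ultimately show ?thesis using bW
    by (intro exI[of _ "exp (2 * W)"] exI[of _ b] exI[of _ K1]) (simp add: exp_add)
qed

text \<open>After \<open>R\<close> successful blocks \<open>2 ^ R * N\<close> nodes are available,
  so the next block fails with probability at most \<open>C / (2 ^ R * N)\<close>; the bound is the
  partial sum of this geometric series.\<close>

lemma prob_blocks:
  assumes C: "0 \<le> C" and b: "0 < b" and m0: "0 < m0"
    and block: "\<And>m N d. m0 \<le> m \<Longrightarrow> 0 < N \<Longrightarrow>
    tree.prob (spread_failure m (m * \<rho>) (m * exp b) (m * exp b * \<rho>) K 2 N d) \<le> C / N"
    and m: "m0 \<le> m" and N: "0 < N"
  shows "tree.prob (spread_failure m (m * \<rho>) (m * exp (b * R)) (m * exp (b * R) * \<rho>) (K * R) (2 ^ R) N d)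
      \<le> C / N * (2 - 2 / 2 ^ R)"
proof (induction R)
  case 0
  have "spread_failure m (m * \<rho>) m (m * \<rho>) 0 1 N d = {}" by (auto simp: spread_failure_def)
  then have "tree.prob (spread_failure m (m * \<rho>) m (m * \<rho>) 0 1 N d) = 0" by (simp only: measure_empty)
  then show ?case by simp
next
  case (Suc R)
  define m' where "m' = m * exp (b * R)"
  have m': "m0 \<le> m'"
  proof -
    have "m * 1 \<le> m'" unfolding m'_def using b m m0 by (intro mult_left_mono) auto
    then show ?thesis using m by simp
  qed
  have e: "m * exp (b * real (Suc R)) = m' * exp b" by (simp add: m'_def algebra_simps exp_add)
  have "tree.prob (spread_failure m (m * \<rho>) (m' * exp b) (m' * exp b * \<rho>) (K * Suc R) (2 ^ Suc R) N d)
      \<le> C / N * (2 - 2 / 2 ^ R) + C / (2 ^ R * N)"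
  proof (rule prob_le_add)
    show "spread_failure m (m * \<rho>) (m' * exp b) (m' * exp b * \<rho>) (K * Suc R) (2 ^ Suc R) N d
      \<subseteq> spread_failure m (m * \<rho>) (m * exp (b * R)) (m * exp (b * R) * \<rho>) (K * R) (2 ^ R) N d
      \<union> spread_failure m' (m' * \<rho>) (m' * exp b) (m' * exp b * \<rho>) K 2 (2 ^ R * N) (d + K * R)"
      by (auto simp: spread_failure_def m'_def[symmetric] algebra_simps)
    show "tree.prob (spread_failure m' (m' * \<rho>) (m' * exp b) (m' * exp b * \<rho>) K 2 (2 ^ R * N) (d + K * R)) \<le> C / (2 ^ R * N)"
      using N m' by (intro block) auto
    show "tree.prob (spread_failure m (m * \<rho>) (m * exp (b * R)) (m * exp (b * R) * \<rho>) (K * R) (2 ^ R) N d)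
      \<le> C / N * (2 - 2 / 2 ^ R)" by (rule Suc)
  qed measurable
  also have "\<dots> = C / N * (2 - 2 / 2 ^ Suc R)" using N by (simp add: field_simps)
  finally show ?case by (simp only: e)
qed

text \<open>The chain is anchored at its end: \<open>\<mu>\<close> is chosen so that after
  \<open>R\<close> blocks and the final steering the window is exactly \<open>{n / 2..<n}\<close>.
  Then \<open>\<mu>\<close> lies between \<open>m\<close> and \<open>m * exp b\<close>, so the
  starting labels and depths are bounded; \<open>N\<close>, \<open>m\<close> and \<open>d0\<close>
  are independent of \<open>n\<close>.\<close>

lemma prob_min_depth_large:
  assumes c: "alpha_min P (\<lambda>x. x) < c"
  shows "(\<lambda>n. tree.prob {\<omega> \<in> space M. c * ln (real n) < real (min_depth n \<omega>)}) \<longlonglongrightarrow> 0"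
proof -
  obtain \<rho> b K where \<rho>: "1 < \<rho>" and b: "0 < b" and K: "real K < c * b"
    and block: "spreads 1 \<rho> (exp b) (exp b * \<rho>) K 2" using spreads_block[OF c] by blast
  obtain k g \<beta> where g: "0 < g" and \<beta>: "0 < \<beta>" and final: "spreads 1 \<rho> (g / 2) g k \<beta>"
    using spreads_final[OF \<rho>] by blast
  obtain C1 m1 where C1: "0 \<le> C1" and 1: "\<And>m N d. m1 \<le> m \<Longrightarrow> 0 < N \<Longrightarrow>
    tree.prob (spread_failure (m * 1) (m * \<rho>) (m * exp b) (m * (exp b * \<rho>)) K 2 N d) \<le> C1 / N"
    using block unfolding spreads_def by blast
  obtain C2 m2 where C2: "0 \<le> C2" and 2: "\<And>m N d. m2 \<le> m \<Longrightarrow> 0 < N \<Longrightarrow>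
    tree.prob (spread_failure (m * 1) (m * \<rho>) (m * (g / 2)) (m * g) k \<beta> N d) \<le> C2 / N"
    using final unfolding spreads_def by blast
  have unit: "\<And>j. Xs j \<omega> \<in> {0..<1}" if "\<omega> \<in> space M" for \<omega> using Xs_unit[OF that] .
  show ?thesis
  proof (rule LIMSEQ_I)
    fix \<epsilon> :: real assume \<epsilon>: "0 < \<epsilon>"
    define N where "N = (2 * C1 + C2 + 1) / \<epsilon>"
    have N: "0 < N" using C1 C2 \<epsilon> by (simp add: N_def)
    \<comment> \<open>A window of ratio \<open>\<rho>\<close> starting at or above \<open>m\<close>
      contains at least \<open>N\<close> integers; the extra 1 pays for rounding.\<close>
    define m where "m = max (max 1 (max m1 m2)) ((N + 1) / (\<rho> - 1))"
    have m: "1 \<le> m" "m1 \<le> m" "m2 \<le> m" "(N + 1) / (\<rho> - 1) \<le> m" by (auto simp: m_def)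
    \<comment> \<open>The depth of a node is at most its label, and the starting labels are below
      \<open>m * exp b * \<rho>\<close>.\<close>
    define d0 where "d0 = nat \<lceil>m * exp b * \<rho>\<rceil>"
    have bound: "tree.prob {\<omega> \<in> space M. c * ln (real n) < real (min_depth n \<omega>)} < \<epsilon>"
      if n: "0 < n" "ln g + ln m \<le> ln (real n)" and large: "real (d0 + k) + real K / b * (ln (real n) - ln g - ln m) \<le> c * ln (real n)" for n
    proof -
      define R where "R = nat \<lfloor>(ln (real n) - ln g - ln m) / b\<rfloor>"
      have "0 \<le> (ln (real n) - ln g - ln m) / b" using n b by simp
      then have R: "real R \<le> (ln (real n) - ln g - ln m) / b" "(ln (real n) - ln g - ln m) / b < real R + 1"
        unfolding R_def by linarith+
      then have R': "b * R \<le> ln (real n) - ln g - ln m" "ln (real n) - ln g - ln m < b * R + b"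
        using b by (auto simp: field_simps)
      define \<mu> where "\<mu> = real n / g * exp (- (b * R))"
      have \<mu>0: "0 < \<mu>" using n g by (simp add: \<mu>_def)
      have ln\<mu>: "ln \<mu> = ln (real n) - ln g - b * R" using n g by (simp add: \<mu>_def ln_mult ln_div)
      have \<mu>1: "m \<le> \<mu>" using R'(1) m(1) \<mu>0 by (subst ln_le_cancel_iff[symmetric]) (auto simp: ln\<mu>)
      have \<mu>2: "\<mu> \<le> m * exp b"
        using R'(2) m(1) \<mu>0 by (subst ln_le_cancel_iff[symmetric]) (auto simp: ln\<mu> ln_mult)
      have \<mu>R: "\<mu> * exp (b * R) * g = real n" using g by (simp add: \<mu>_def exp_minus)
      have base: "N \<le> real (shallow_count \<mu> (\<mu> * \<rho>) d0 \<omega>)" if \<omega>: "\<omega> \<in> space M" for \<omega>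
      proof -
        have "{v. \<mu> \<le> real v \<and> real v < \<mu> * \<rho> \<and> ancestor v d0 \<omega> = 0} = {nat \<lceil>\<mu>\<rceil>..<nat \<lceil>\<mu> * \<rho>\<rceil>}"
        proof -
          have "ancestor v d0 \<omega> = 0" if "real v < \<mu> * \<rho>" for v
          proof -
            have "\<mu> * \<rho> \<le> m * exp b * \<rho>" using \<mu>2 \<rho> by (intro mult_right_mono) auto
            then have "v \<le> d0" using that unfolding d0_def by linarith
            then show ?thesis using ancestor_self[of "\<lambda>j. Xs j \<omega>" v] unit[OF \<omega>] by (metis ancestor_eq_0_mono)
          qed
          then have "{v. \<mu> \<le> real v \<and> real v < \<mu> * \<rho> \<and> ancestor v d0 \<omega> = 0} = {v. \<mu> \<le> real v \<and> real v < \<mu> * \<rho>}" by blast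
          also have "\<dots> = {nat \<lceil>\<mu>\<rceil>..<nat \<lceil>\<mu> * \<rho>\<rceil>}"
            by (auto simp: nat_le_iff zless_nat_eq_int_zless ceiling_le_iff less_ceiling_iff)
          finally show ?thesis .
        qed
        then have card: "shallow_count \<mu> (\<mu> * \<rho>) d0 \<omega> = nat \<lceil>\<mu> * \<rho>\<rceil> - nat \<lceil>\<mu>\<rceil>" by (simp add: shallow_count_def)
        have "N + 1 \<le> m * (\<rho> - 1)" using m(4) \<rho> by (simp add: field_simps)
        also have "\<dots> \<le> \<mu> * (\<rho> - 1)" using \<mu>1 \<rho> by (intro mult_right_mono) auto
        finally have "N + 1 \<le> \<mu> * \<rho> - \<mu>" by (simp add: algebra_simps)
        then show ?thesis unfolding card using \<mu>0 N by linarith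
      qed
      have P1: "tree.prob (spread_failure \<mu> (\<mu> * \<rho>) (\<mu> * exp (b * R)) (\<mu> * exp (b * R) * \<rho>) (K * R) (2 ^ R) N d0) \<le> 2 * C1 / N"
      proof -
        have "tree.prob (spread_failure \<mu> (\<mu> * \<rho>) (\<mu> * exp (b * R)) (\<mu> * exp (b * R) * \<rho>) (K * R) (2 ^ R) N d0)
          \<le> C1 / N * (2 - 2 / 2 ^ R)"
        proof (rule prob_blocks[OF C1 b _ _ \<mu>1 N])
          show "0 < m" using m by simp
          fix m' N' d assume "m \<le> m'" "(0::real) < N'"
          then show "tree.prob (spread_failure m' (m' * \<rho>) (m' * exp b) (m' * exp b * \<rho>) K 2 N' d) \<le> C1 / N'"
            using 1[of m' N' d] m by (simp add: mult.assoc)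
        qed
        also have "\<dots> \<le> C1 / N * 2" using C1 N by (intro mult_left_mono) auto
        finally show ?thesis by (simp add: mult.commute)
      qed
      define \<nu> where "\<nu> = \<mu> * exp (b * R)"
      have \<nu>: "\<nu> * g = n" "m2 \<le> \<nu>"
      proof -
        show "\<nu> * g = n" using \<mu>R by (simp add: \<nu>_def)
        have "\<mu> * 1 \<le> \<nu>" unfolding \<nu>_def using \<mu>0 b by (intro mult_left_mono) auto
        then show "m2 \<le> \<nu>" using \<mu>1 m by simp
      qed
      have P2: "tree.prob (spread_failure (\<nu> * 1) (\<nu> * \<rho>) (\<nu> * (g / 2)) (\<nu> * g) k \<beta> (2 ^ R * N) (d0 + K * R)) \<le> C2 / N"
      proof -
        have "C2 / (2 ^ R * N) \<le> C2 / N" using C2 N by (intro divide_left_mono) auto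
        then show ?thesis using 2[OF \<nu>(2), of "2 ^ R * N" "d0 + K * R"] N by simp
      qed
      have "tree.prob {\<omega> \<in> space M. c * ln (real n) < real (min_depth n \<omega>)} \<le> 2 * C1 / N + C2 / N"
      proof (rule prob_le_add[OF _ _ _ P1 P2])
        show "{\<omega> \<in> space M. c * ln (real n) < real (min_depth n \<omega>)}
          \<subseteq> spread_failure \<mu> (\<mu> * \<rho>) (\<mu> * exp (b * R)) (\<mu> * exp (b * R) * \<rho>) (K * R) (2 ^ R) N d0
          \<union> spread_failure (\<nu> * 1) (\<nu> * \<rho>) (\<nu> * (g / 2)) (\<nu> * g) k \<beta> (2 ^ R * N) (d0 + K * R)"
        proof (rule subsetI, rule ccontr)
          fix \<omega> assume in1: "\<omega> \<in> {\<omega> \<in> space M. c * ln (real n) < real (min_depth n \<omega>)}"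
            and out: "\<omega> \<notin> spread_failure \<mu> (\<mu> * \<rho>) (\<mu> * exp (b * R)) (\<mu> * exp (b * R) * \<rho>) (K * R) (2 ^ R) N d0
          \<union> spread_failure (\<nu> * 1) (\<nu> * \<rho>) (\<nu> * (g / 2)) (\<nu> * g) k \<beta> (2 ^ R * N) (d0 + K * R)"
          have \<omega>: "\<omega> \<in> space M" using in1 by simp
          have "2 ^ R * N \<le> real (shallow_count \<nu> (\<nu> * \<rho>) (d0 + K * R) \<omega>)"
            using out base[OF \<omega>] \<omega> by (auto simp: \<nu>_def spread_failure_def)
          then have "\<beta> * (2 ^ R * N) \<le> real (shallow_count (\<nu> * (g / 2)) (\<nu> * g) (d0 + K * R + k) \<omega>)"
            using out \<omega> by (auto simp: spread_failure_def)
          moreover have "0 < \<beta> * (2 ^ R * N)" using \<beta> N by simp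
          ultimately have "0 < shallow_count (\<nu> * (g / 2)) (\<nu> * g) (d0 + K * R + k) \<omega>" by linarith
          then have "{v. \<nu> * (g / 2) \<le> real v \<and> real v < \<nu> * g \<and> ancestor v (d0 + K * R + k) \<omega> = 0} \<noteq> {}"
            unfolding shallow_count_def by (metis card.empty less_irrefl)
          then obtain v where v: "\<nu> * (g / 2) \<le> real v" "real v < \<nu> * g" "ancestor v (d0 + K * R + k) \<omega> = 0" by blast
          have "real n / 2 \<le> real v" "v \<le> n" using v(1,2) \<nu>(1) by auto
          then have "min_depth n \<omega> \<le> d0 + K * R + k"
            using v(3) unit[OF \<omega>] by (subst min_depth_le_iff) auto
          then have "real (min_depth n \<omega>) \<le> real (d0 + k) + real K * real R"
            by (simp flip: of_nat_mult of_nat_add)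
          also have "real K * real R \<le> real K / b * (ln (real n) - ln g - ln m)"
            using mult_left_mono[OF R(1), of "real K"] by simp
          also have "real (d0 + k) + real K / b * (ln (real n) - ln g - ln m) \<le> c * ln (real n)" by (rule large)
          finally show False using in1 by simp
        qed
      qed measurable
      also have "\<dots> = (2 * C1 + C2) / N" by (simp add: add_divide_distrib)
      also have "\<dots> < \<epsilon>" using \<epsilon> C1 C2 N by (simp add: N_def field_simps)
      finally show ?thesis .
    qed
    have "real K / b < c" using K b by (simp add: field_simps)
    then have "filterlim (\<lambda>n. c * ln (real n) - (real (d0 + k) + real K / b * (ln (real n) - ln g - ln m))) at_top sequentially"
      by real_asymp
    then have "\<forall>\<^sub>F n in sequentially. 0 \<le> c * ln (real n) - (real (d0 + k) + real K / b * (ln (real n) - ln g - ln m))"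
      unfolding filterlim_at_top by blast
    moreover have "filterlim (\<lambda>n. ln (real n)) at_top sequentially" by real_asymp
    then have "\<forall>\<^sub>F n in sequentially. ln g + ln m \<le> ln (real n)" unfolding filterlim_at_top by blast
    ultimately have "\<forall>\<^sub>F n in sequentially. tree.prob {\<omega> \<in> space M. c * ln (real n) < real (min_depth n \<omega>)} < \<epsilon>"
      using eventually_gt_at_top[of 0] by eventually_elim (intro bound, auto)
    then show "\<exists>n0. \<forall>n\<ge>n0. norm (tree.prob {\<omega> \<in> space M. c * ln (real n) < real (min_depth n \<omega>)} - 0) < \<epsilon>"
      by (simp add: eventually_sequentially)
  qed
qed

end

section \<open>Transfer to the given random variables\<close>

lemma alpha_min_distr:
  assumes [measurable]: "X \<in> borel_measurable N"
  shows "alpha_min (distr N borel X) (\<lambda>x. x) = alpha_min N X"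
proof -
  have "neg_log_mean (distr N borel X) (\<lambda>x. x) = neg_log_mean N X"
    unfolding neg_log_mean_def by (subst nn_integral_distr) auto
  moreover have "power_moment (distr N borel X) (\<lambda>x. x) l = power_moment N X l" for l
    unfolding power_moment_def by (subst nn_integral_distr) auto
  ultimately show ?thesis
    unfolding alpha_min_def rate_Psi_def log_moment_conj_def log_moment_def by (simp cong: if_cong)
qed

text \<open>The density integrates to 1, so it is finite almost everywhere and
  \<open>enn2real\<close> keeps the law. The point 0 is a null set, which turns
  \<open>0 \<le> x\<close> into \<open>0 < x\<close> almost surely.\<close>

lemma attachment_law_distr:
  assumes N: "prob_space N" and X: "\<And>\<omega>. \<omega> \<in> space N \<Longrightarrow> X \<omega> \<in> {0..<1}"
    and f: "distributed N lborel X f"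
  shows "attachment_law (distr N borel X) (\<lambda>x. enn2real (f x))"
proof -
  interpret N: prob_space N by (rule N)
  have X_meas [measurable]: "X \<in> borel_measurable N" using distributed_measurable[OF f] by simp
  have f_meas [measurable]: "f \<in> borel_measurable borel" using distributed_borel_measurable[OF f] by simp
  define P where "P = distr N borel X"
  interpret P: prob_space P unfolding P_def by (rule N.prob_space_distr) simp
  have "distr N borel X = distr N lborel X" by (rule distr_cong) auto
  then have P_f: "P = density lborel f" using distributed_distr_eq_density[OF f] by (simp add: P_def)
  have "(\<integral>\<^sup>+x. f x \<partial>lborel) = emeasure P (space P)" unfolding P_f by (simp add: emeasure_density)
  then have "(\<integral>\<^sup>+x. f x \<partial>lborel) \<noteq> \<infinity>" using P.emeasure_space_1 by simp
  then have "AE x in lborel. f x \<noteq> \<infinity>" by (intro nn_integral_PInf_AE) auto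
  then have "density lborel f = density lborel (\<lambda>x. ennreal (enn2real (f x)))"
    by (intro density_cong) (auto elim!: eventually_mono simp: less_top)
  moreover have "AE x in P. 0 < x \<and> x < 1"
  proof -
    have "AE x in P. x \<noteq> 0" unfolding P_f
      using AE_lborel_singleton[of "0 :: real"] by (subst AE_density) (auto elim!: eventually_mono)
    moreover have "AE x in P. 0 \<le> x \<and> x < 1" unfolding P_def
      using X by (subst AE_distr_iff) auto
    ultimately show ?thesis by eventually_elim auto
  qed
  ultimately show ?thesis unfolding P_def[symmetric] using P_f
    by unfold_locales auto
qed

theorem theorem6:
  fixes N :: "'b measure" and X :: "'b \<Rightarrow> real" and f :: "real \<Rightarrow> ennreal"
    and M :: "'a measure" and Xs :: "nat \<Rightarrow> 'a \<Rightarrow> real"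
  assumes "prob_space N"
    and "\<And>\<omega>. \<omega> \<in> space N \<Longrightarrow> X \<omega> \<in> {0..<1}"
    and "distributed N lborel X f"
    and "prob_space M"
    and "\<And>i \<omega>. \<omega> \<in> space M \<Longrightarrow> Xs i \<omega> \<in> {0..<1}"
    and "prob_space.indep_vars M (\<lambda>_. borel) Xs UNIV"
    and "\<And>i. distr M borel (Xs i) = distr N borel X"
  shows "tendsto_in_prob M
           (\<lambda>n \<omega>. real (sarrt_min_depth (\<lambda>i. Xs i \<omega>) n) / ln (real n))
           (alpha_min N X)"
proof -
  define P where "P = distr N borel X"
  interpret L: attachment_law P "\<lambda>x. enn2real (f x)"
    unfolding P_def by (rule attachment_law_distr[OF assms(1-3)])
  interpret T: prob_space M by (rule assms(4))
  interpret sarrt P "\<lambda>x. enn2real (f x)" M Xs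
    by unfold_locales (use assms(5-7) in \<open>auto simp: P_def\<close>)
  have X_meas: "X \<in> borel_measurable N" using distributed_measurable[OF assms(3)] by simp
  define \<alpha> where "\<alpha> = alpha_min P (\<lambda>x. x)"
  have \<alpha>: "alpha_min N X = \<alpha>" unfolding \<alpha>_def P_def by (rule alpha_min_distr[OF X_meas, symmetric])
  have depth_meas [measurable]: "(\<lambda>\<omega>. real (sarrt_min_depth (\<lambda>i. Xs i \<omega>) n)) \<in> borel_measurable M" for n
    using measurable_comp[OF min_depth_measurable, of real borel n] by (simp add: comp_def)
  show ?thesis unfolding tendsto_in_prob_def \<alpha>
  proof (intro conjI allI impI)
    show "(\<lambda>\<omega>. real (sarrt_min_depth (\<lambda>i. Xs i \<omega>) n) / ln (real n)) \<in> borel_measurable M" for n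
      by measurable
    fix \<epsilon> :: real assume \<epsilon>: "0 < \<epsilon>"
    \<comment> \<open>For \<open>\<alpha> < \<epsilon>\<close> this set is empty: depths are
      nonnegative, so there is no downward deviation of this size.\<close>
    define lo where "lo n = {\<omega> \<in> space M. 0 \<le> \<alpha> - \<epsilon> \<and> real (sarrt_min_depth (\<lambda>i. Xs i \<omega>) n) \<le> (\<alpha> - \<epsilon>) * ln (real n)}" for n
    define hi where "hi n = {\<omega> \<in> space M. (\<alpha> + \<epsilon>) * ln (real n) < real (sarrt_min_depth (\<lambda>i. Xs i \<omega>) n)}" for n
    have sets: "lo n \<in> sets M" "hi n \<in> sets M" for n unfolding lo_def hi_def by measurable
    have lo_lim: "(\<lambda>n. measure M (lo n)) \<longlonglongrightarrow> 0"
    proof (cases "0 \<le> \<alpha> - \<epsilon>")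
      case True
      then show ?thesis using prob_min_depth_small[of "\<alpha> - \<epsilon>"] \<epsilon> by (simp add: lo_def \<alpha>_def)
    next
      case False
      then show ?thesis by (simp add: lo_def)
    qed
    have hi_lim: "(\<lambda>n. measure M (hi n)) \<longlonglongrightarrow> 0"
      using prob_min_depth_large[of "\<alpha> + \<epsilon>"] \<epsilon> by (simp add: hi_def \<alpha>_def)
    have sum_lim: "(\<lambda>n. measure M (lo n) + measure M (hi n)) \<longlonglongrightarrow> 0"
      using tendsto_add[OF lo_lim hi_lim] by simp
    show "(\<lambda>n. measure M {\<omega> \<in> space M. \<epsilon> < \<bar>real (sarrt_min_depth (\<lambda>i. Xs i \<omega>) n) / ln (real n) - \<alpha>\<bar>}) \<longlonglongrightarrow> 0"
    proof (rule tendsto_sandwich[OF _ _ tendsto_const sum_lim])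
      show "\<forall>\<^sub>F n in sequentially. measure M {\<omega> \<in> space M. \<epsilon> < \<bar>real (sarrt_min_depth (\<lambda>i. Xs i \<omega>) n) / ln (real n) - \<alpha>\<bar>}
        \<le> measure M (lo n) + measure M (hi n)"
      proof (rule eventually_sequentiallyI[of 2])
        \<comment> \<open>From 2 on \<open>ln n\<close> is positive, so multiplying by it preserves
          the inequalities.\<close>
        fix n :: nat assume "2 \<le> n"
        then have ln: "0 < ln (real n)" by simp
        show "measure M {\<omega> \<in> space M. \<epsilon> < \<bar>real (sarrt_min_depth (\<lambda>i. Xs i \<omega>) n) / ln (real n) - \<alpha>\<bar>}
          \<le> measure M (lo n) + measure M (hi n)"
        proof (rule prob_le_add[OF _ sets order_refl order_refl], rule subsetI)
          fix \<omega> assume "\<omega> \<in> {\<omega> \<in> space M. \<epsilon> < \<bar>real (sarrt_min_depth (\<lambda>i. Xs i \<omega>) n) / ln (real n) - \<alpha>\<bar>}"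
          then have \<omega>: "\<omega> \<in> space M" "\<epsilon> < \<bar>real (sarrt_min_depth (\<lambda>i. Xs i \<omega>) n) / ln (real n) - \<alpha>\<bar>" by auto
          define y where "y = real (sarrt_min_depth (\<lambda>i. Xs i \<omega>) n) / ln (real n)"
          have y: "0 \<le> y" "real (sarrt_min_depth (\<lambda>i. Xs i \<omega>) n) = y * ln (real n)" using ln by (simp_all add: y_def)
          consider "y < \<alpha> - \<epsilon>" | "\<alpha> + \<epsilon> < y" using \<omega>(2) unfolding y_def[symmetric] by linarith
          then show "\<omega> \<in> lo n \<union> hi n"
          proof cases
            case 1
            then have "y * ln (real n) \<le> (\<alpha> - \<epsilon>) * ln (real n)" using ln by (intro mult_right_mono) auto
            then show ?thesis using 1 y \<omega>(1) by (simp add: lo_def)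
          next
            case 2
            then have "(\<alpha> + \<epsilon>) * ln (real n) < y * ln (real n)" using ln by (intro mult_strict_right_mono) auto
            then show ?thesis using y \<omega>(1) by (simp add: hi_def)
          qed
        qed
      qed
    qed simp
  qed
qed

end
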